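(* Let $n\ge1$ be an integer. Suppose that $1\le p_1,p_2\le\infty$, $0<\lambda<n$ and $0<q\le\infty$ are such that $$\frac1{p_1}+\frac1{p_2}=\frac1q+\frac{n-\lambda}{n}.$$ Let $A=\begin{pmatrix} A_{11} & A_{12} \\ A_{21} & A_{22} \end{pmatrix}$, where $A_{ij}$ ($1\le i,j\le2$) are $n\times n$ real matrices, and define $$T_\lambda f(x_2)=\int_{\mathbb R^n}\frac{f(A_{11}x_1+A_{12}x_2, A_{21}x_1+A_{22}x_2)}{|x_1|^\lambda}\,dx_1,\qquad x_2\in\mathbb R^n .$$ Then, with $\vec p=(p_1,p_2)$, $T_\lambda$ is bounded from $L^{\vec p}(\mathbb R^{2n})$ to $L^q(\mathbb R^n)$ if and only if $1<p_2<q<p_1\le\infty$ and $A$, $A_{21}$, $A_{22}$ are invertible matrices.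
   Context: $L^{\vec p}(\mathbb R^{2n})$ is the mixed-norm Lebesgue space of measurable functions $f(x_1,x_2)$, $x_1,x_2\in\mathbb R^n$, with $\|f\|_{L^{\vec p}}=\big\|\,\|f\|_{L^{p_1}_{x_1}}\big\|_{L^{p_2}_{x_2}}<\infty$ (the norm in $x_1$ is innermost). "Bounded" means that there is a constant $C$ with $\|T_\lambda f\|_{L^q}\le C\|f\|_{L^{\vec p}}$ for all $f\in L^{\vec p}$. Convention: $1/\infty=0$. *)

theory Defs
  imports "HOL-Analysis.Analysis" "HOL-Probability.Essential_Supremum"
begin

text \<open>Real powers of extended nonnegative reals; only used with positive exponents,
  so that \<open>0\<close> is sent to \<open>0\<close> and \<open>\<infinity>\<close> to \<open>\<infinity>\<close>.\<close>

definition epowr :: "ennreal \<Rightarrow> real \<Rightarrow> ennreal" where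
  "epowr x r = (if x = \<infinity> then \<infinity> else ennreal (enn2real x powr r))"

text \<open>The \<open>L\<^sup>p\<close> (quasi-)norm of a \<open>[0,\<infinity>]\<close>-valued function, for \<open>0 < p \<le> \<infinity>\<close>.
  It is \<open>[0,\<infinity>]\<close>-valued so that it can be iterated.\<close>

definition Lp_norm :: "ennreal \<Rightarrow> 'a measure \<Rightarrow> ('a \<Rightarrow> ennreal) \<Rightarrow> ennreal" where
  "Lp_norm p M g =
     (if p = \<infinity> then esssup M g
      else epowr (\<integral>\<^sup>+ x. epowr (g x) (enn2real p) \<partial>M) (1 / enn2real p))"

text \<open>Functions on \<open>\<real>\<^sup>2\<^sup>n\<close> are functions of a pair \<open>(x\<^sub>1, x\<^sub>2)\<close>; the inner norm is in \<open>x\<^sub>1\<close>.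
  For Lebesgue measurable \<open>f\<close> the slices \<open>f (\<cdot>, x\<^sub>2)\<close> are measurable only for almost all \<open>x\<^sub>2\<close>;
  the exceptional null set does not affect the outer norm.\<close>

definition mixed_norm ::
    "ennreal \<Rightarrow> ennreal \<Rightarrow> ((real^'n) \<times> (real^'n) \<Rightarrow> complex) \<Rightarrow> ennreal" where
  "mixed_norm p1 p2 f =
     Lp_norm p2 lebesgue (\<lambda>x2. Lp_norm p1 lebesgue (\<lambda>x1. ennreal (norm (f (x1, x2)))))"

definition mixed_Lp ::
    "ennreal \<Rightarrow> ennreal \<Rightarrow> ((real^'n) \<times> (real^'n) \<Rightarrow> complex) set" where
  "mixed_Lp p1 p2 = {f \<in> borel_measurable lebesgue. mixed_norm p1 p2 f < \<infinity>}"

definition block_matrix ::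
    "real^'n^'n \<Rightarrow> real^'n^'n \<Rightarrow> real^'n^'n \<Rightarrow> real^'n^'n \<Rightarrow> real^('n + 'n)^('n + 'n)" where
  "block_matrix A11 A12 A21 A22 =
     (\<chi> i j. case i of
        Inl k \<Rightarrow> (case j of Inl l \<Rightarrow> A11 $ k $ l | Inr l \<Rightarrow> A12 $ k $ l)
      | Inr k \<Rightarrow> (case j of Inl l \<Rightarrow> A21 $ k $ l | Inr l \<Rightarrow> A22 $ k $ l))"

definition T_integrand ::
    "real \<Rightarrow> real^'n^'n \<Rightarrow> real^'n^'n \<Rightarrow> real^'n^'n \<Rightarrow> real^'n^'n \<Rightarrow>
     ((real^'n) \<times> (real^'n) \<Rightarrow> complex) \<Rightarrow> real^'n \<Rightarrow> real^'n \<Rightarrow> complex" where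
  "T_integrand lam A11 A12 A21 A22 f x2 x1 =
     f (A11 *v x1 + A12 *v x2, A21 *v x1 + A22 *v x2) / complex_of_real (norm x1 powr lam)"

definition T_op ::
    "real \<Rightarrow> real^'n^'n \<Rightarrow> real^'n^'n \<Rightarrow> real^'n^'n \<Rightarrow> real^'n^'n \<Rightarrow>
     ((real^'n) \<times> (real^'n) \<Rightarrow> complex) \<Rightarrow> real^'n \<Rightarrow> complex" where
  "T_op lam A11 A12 A21 A22 f x2 =
     integral\<^sup>L lebesgue (T_integrand lam A11 A12 A21 A22 f x2)"

text \<open>A Bochner integral that does not exist has the value \<open>0\<close>. Hence the existence of the
  defining integral at almost every point, and the measurability of the resulting function,
  are part of what it means for the operator to map \<open>L\<^sup>p\<close> boundedly into \<open>L\<^sup>q\<close>.\<close>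

definition T_bounded ::
    "ennreal \<Rightarrow> ennreal \<Rightarrow> ennreal \<Rightarrow> real \<Rightarrow>
     real^'n^'n \<Rightarrow> real^'n^'n \<Rightarrow> real^'n^'n \<Rightarrow> real^'n^'n \<Rightarrow> bool" where
  "T_bounded p1 p2 q lam A11 A12 A21 A22 \<longleftrightarrow>
     (\<exists>C::real. C \<ge> 0 \<and> (\<forall>f \<in> mixed_Lp p1 p2.
        (AE x2 in lebesgue. integrable lebesgue (T_integrand lam A11 A12 A21 A22 f x2)) \<and>
        T_op lam A11 A12 A21 A22 f \<in> borel_measurable lebesgue \<and>
        Lp_norm q lebesgue (\<lambda>x2. ennreal (norm (T_op lam A11 A12 A21 A22 f x2)))
          \<le> ennreal C * mixed_norm p1 p2 f))"

end

theory Submission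
  imports Defs
begin

text \<open>
Sufficiency. Substituting \<open>x\<^sub>1 = A\<^sub>2\<^sub>1\<inverse> A\<^sub>2\<^sub>2 (y - x\<^sub>2)\<close> turns the operator into
\<open>\<integral> h(x\<^sub>2, y) |y - x\<^sub>2|\<^sup>-\<^sup>\<lambda> dy\<close>, where the mixed norm of \<open>h\<close> is comparable to that of \<open>f\<close>. Testing against
\<open>\<phi> \<in> L\<^sup>q\<^sup>'\<close> and applying Hoelder's inequality in \<open>x\<^sub>2\<close> with exponent \<open>p\<^sub>1\<close> leaves a Riesz potential
of \<open>\<phi>\<close> raised to the power \<open>p\<^sub>1'\<close>, with kernel exponent \<open>\<lambda> p\<^sub>1' < n\<close>; the Hardy--Littlewood--Sobolev
inequality, which is proved by the layer cake representation, and Hoelder's inequality in \<open>y\<close>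
conclude.

Necessity. If the block matrix is singular, the indicator of a hyperplane containing its range has
norm zero but a divergent integral. Otherwise let \<open>f\<close> be a product function in the coordinates
\<open>(x\<^sub>1, x\<^sub>2) = A\<inverse> (u, y)\<close>. Indicators of long chains of balls and of thin slabs in \<open>x\<^sub>2\<close> give
the non-strict inequalities between the exponents, according to the kernels of \<open>A\<^sub>2\<^sub>1\<close> and
\<open>A\<^sub>2\<^sub>2\<close>; the powers of \<open>|x|\<close> that make the critical integrals logarithmically divergent exclude
the cases of equality.
\<close>

text \<open>After the Hoelder step the Hardy--Littlewood--Sobolev inequality is applied from
  \<open>L^s\<close> to \<open>L^t\<close> with s = q'/p1' and t = p2'/p1'. The conditions q < p1,
  p2 < q and 1 < p2 say exactly that 1 < s, s < t and t < \<infinity>. For the converse, the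
  relation between the exponents makes the problem invariant under dilations, so dilating a test
  function gives no information. Slabs and chains change size in one direction only, and the kernels
  of the blocks decide whether this change is visible in the slices in u or in the projection to y.
  At equality of exponents such a test is balanced; a truncated critical power, whose critical
  integral h is as large as desired, then leaves a comparison of two powers of h. To exclude p1 = q
  and p2 = 1, the product in (x1, x2) is replaced by a product in (y, x2) with y = A21 x1 + A22 x2.
  Its norm is under control once A21 is invertible, so this has to be proved before the strict
  inequalities.\<close>

abbreviation nn_integral_lborel :: "('a::euclidean_space \<Rightarrow> ennreal) \<Rightarrow> ennreal" (binder "\<integral>\<^sup>+" [61] 61)
  where "nn_integral_lborel \<equiv> integral\<^sup>N lborel"

section \<open>Powers of extended reals and duality\<close>

lemma epowr_top [simp]: "epowr \<infinity> r = \<infinity>" "epowr top r = top"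
  by (simp_all add: epowr_def)

lemma epowr_0 [simp]: "epowr 0 r = 0"
  by (simp add: epowr_def)

lemma epowr_1 [simp]: "epowr 1 r = 1"
  by (simp add: epowr_def)

lemma epowr_ennreal: "0 \<le> x \<Longrightarrow> epowr (ennreal x) r = ennreal (x powr r)"
  by (simp add: epowr_def)

lemma epowr_one_right [simp]: "epowr x 1 = x"
  by (cases x) (simp_all add: epowr_ennreal)

lemma epowr_epowr: "epowr (epowr x r) s = epowr x (r * s)"
  by (cases x) (simp_all add: epowr_ennreal powr_powr)

lemma epowr_mono: "x \<le> y \<Longrightarrow> 0 \<le> r \<Longrightarrow> epowr x r \<le> epowr y r"
  by (cases x; cases y) (simp_all add: epowr_ennreal powr_mono2 top_unique)

lemma epowr_mult: "0 < r \<Longrightarrow> epowr (x * y) r = epowr x r * epowr y r"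
proof (cases x; cases y)
  fix a assume "0 < r" "x = top" "y = ennreal a" "0 \<le> a"
  then show ?thesis by (cases "a = 0") (simp_all add: epowr_ennreal ennreal_top_mult)
next
  fix a assume "0 < r" "y = top" "x = ennreal a" "0 \<le> a"
  then show ?thesis by (cases "a = 0") (simp_all add: epowr_ennreal ennreal_mult_top)
qed (simp_all add: epowr_ennreal powr_mult ennreal_mult[symmetric])

lemma epowr_add: "0 < r \<Longrightarrow> 0 < s \<Longrightarrow> epowr x (r + s) = epowr x r * epowr x s"
  by (cases x) (simp_all add: epowr_ennreal powr_add ennreal_mult)

lemma epowr_eq_0_iff [simp]: "epowr x r = 0 \<longleftrightarrow> x = 0"
  by (cases x) (auto simp add: epowr_ennreal)

lemma epowr_eq_top_iff [simp]: "epowr x r = top \<longleftrightarrow> x = top"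
  by (cases x) (auto simp add: epowr_ennreal)

lemma epowr_less_top_iff [simp]: "epowr x r < top \<longleftrightarrow> x < top"
  by (simp add: less_top[symmetric])

text \<open>The powers r and 1 / r are mutually inverse order isomorphisms of [0,\<infinity>]. In
  this adjoint form commutation with suprema is formal and roots move across inequalities.\<close>

lemma epowr_le_iff: "0 < r \<Longrightarrow> epowr x r \<le> y \<longleftrightarrow> x \<le> epowr y (1 / r)"
  using epowr_mono[of "epowr x r" y "1 / r"] epowr_mono[of x "epowr y (1 / r)" r]
  by (auto simp: epowr_epowr)

lemma borel_measurable_epowr [measurable]:
  "f \<in> borel_measurable M \<Longrightarrow> (\<lambda>x. epowr (f x) r) \<in> borel_measurable M"
proof -
  assume [measurable]: "f \<in> borel_measurable M"
  have "(\<lambda>x. epowr (f x) r) = (\<lambda>x. if f x \<in> {\<infinity>} then \<infinity> else ennreal (enn2real (f x) powr r))"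
    by (simp add: epowr_def)
  also have "\<dots> \<in> borel_measurable M" by measurable
  finally show ?thesis .
qed

lemma epowr_SUP:
  assumes "0 < r"
  shows "epowr (SUP i\<in>I. X i) r = (SUP i\<in>I. epowr (X i) r)"
proof (rule antisym)
  show "epowr (SUP i\<in>I. X i) r \<le> (SUP i\<in>I. epowr (X i) r)"
    unfolding epowr_le_iff[OF assms]
    by (intro SUP_least, subst epowr_le_iff[OF assms, symmetric]) (rule SUP_upper)
  show "(SUP i\<in>I. epowr (X i) r) \<le> epowr (SUP i\<in>I. X i) r"
    using assms by (intro SUP_least epowr_mono SUP_upper) auto
qed

text \<open>The weights are the reciprocals of conjugate exponents. Once the integrals 0 and
  \<infinity> are set apart, this is Young's inequality for \<open>f\<close> and \<open>g\<close>
  divided by their integrals, integrated.\<close>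

lemma nn_integral_Holder:
  assumes [measurable]: "f \<in> borel_measurable M" "g \<in> borel_measurable M"
    and ab: "0 < a" "0 < b" "a + b = 1"
  shows "(\<integral>\<^sup>+x. epowr (f x) a * epowr (g x) b \<partial>M)
    \<le> epowr (\<integral>\<^sup>+x. f x \<partial>M) a * epowr (\<integral>\<^sup>+x. g x \<partial>M) b"
proof -
  let ?F = "\<integral>\<^sup>+x. f x \<partial>M" and ?G = "\<integral>\<^sup>+x. g x \<partial>M"
  consider "?F = 0 \<or> ?G = 0" | "?F \<noteq> 0" "?G \<noteq> 0" "?F = top \<or> ?G = top"
    | "?F \<noteq> 0" "?G \<noteq> 0" "?F \<noteq> top" "?G \<noteq> top" by blast
  then show ?thesis
  proof cases
    case 1
    then have "AE x in M. f x = 0 \<or> g x = 0"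
      by (auto simp: nn_integral_0_iff_AE elim: eventually_mono)
    then have "(\<integral>\<^sup>+x. epowr (f x) a * epowr (g x) b \<partial>M) = 0"
      by (subst nn_integral_0_iff_AE) auto
    then show ?thesis by simp
  next
    case 2
    then show ?thesis by (auto simp: ennreal_top_mult ennreal_mult_top)
  next
    case 3
    obtain F where F: "?F = ennreal F" "0 < F"
      using 3 by (cases ?F) (auto simp: ennreal_eq_0_iff)
    obtain G where G: "?G = ennreal G" "0 < G"
      using 3 by (cases ?G) (auto simp: ennreal_eq_0_iff)
    let ?c = "ennreal (F powr a * G powr b)"
    have real_case: "s powr a * t powr b \<le> F powr a * G powr b * (a / F * s + b / G * t)"
      if "0 \<le> s" "0 \<le> t" for s t :: real
    proof (cases "s = 0 \<or> t = 0")
      case True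
      then show ?thesis using that F G ab by auto
    next
      case False
      then have "(s / F) powr a * (t / G) powr b \<le> a * (s / F) + b * (t / G)"
        using that F G ab by (intro Youngs_inequality_0) auto
      then have "F powr a * G powr b * ((s / F) powr a * (t / G) powr b)
          \<le> F powr a * G powr b * (a * (s / F) + b * (t / G))"
        by (intro mult_left_mono) auto
      moreover have "F powr a * (s / F) powr a = s powr a"
        using that F by (simp add: powr_mult[symmetric] del: times_divide_eq_right) simp
      moreover have "G powr b * (t / G) powr b = t powr b"
        using that G by (simp add: powr_mult[symmetric] del: times_divide_eq_right) simp
      ultimately show ?thesis by (simp add: ac_simps) (metis mult.assoc mult.commute)
    qed
    have "epowr (f x) a * epowr (g x) b \<le> ?c * (ennreal (a / F) * f x + ennreal (b / G) * g x)" for x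
    proof (cases "f x = top \<or> g x = top")
      case True
      then show ?thesis
        using F G ab by (auto simp: ennreal_mult_top ennreal_top_mult)
    next
      case False
      then obtain s t where "f x = ennreal s" "0 \<le> s" "g x = ennreal t" "0 \<le> t"
        by (metis ennreal_cases infinity_ennreal_def)
      then show ?thesis
        using real_case[of s t] F G ab
        by (simp add: epowr_ennreal ennreal_mult[symmetric] ennreal_plus[symmetric] del: ennreal_plus)
    qed
    then have "(\<integral>\<^sup>+x. epowr (f x) a * epowr (g x) b \<partial>M)
      \<le> (\<integral>\<^sup>+x. ?c * (ennreal (a / F) * f x + ennreal (b / G) * g x) \<partial>M)"
      by (intro nn_integral_mono)
    also have "\<dots> = ?c * (ennreal (a / F) * ?F + ennreal (b / G) * ?G)"
      by (simp add: nn_integral_cmult nn_integral_add)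
    also have "\<dots> = ?c"
      unfolding F G using F G ab by (simp add: ennreal_mult[symmetric] ennreal_plus[symmetric] del: ennreal_plus)
    also have "\<dots> = epowr ?F a * epowr ?G b"
      unfolding F G using F G by (simp add: epowr_ennreal ennreal_mult)
    finally show ?thesis .
  qed
qed

text \<open>The natural test function \<open>G\<^sup>q\<^sup>-\<^sup>1\<close> is admissible only for truncations of \<open>G\<close>, whose norms are
known to be finite.\<close>

lemma nn_integral_Lq_dual:
  fixes G :: "'a::euclidean_space \<Rightarrow> ennreal"
  assumes [measurable]: "G \<in> borel_measurable lborel"
    and q: "1 < q"
    and le: "\<And>\<phi>. \<phi> \<in> borel_measurable lborel \<Longrightarrow> (\<integral>\<^sup>+x. epowr (\<phi> x) (q / (q - 1))) \<le> 1
      \<Longrightarrow> (\<integral>\<^sup>+x. G x * \<phi> x) \<le> K"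
  shows "(\<integral>\<^sup>+x. epowr (G x) q) \<le> epowr K q"
proof -
  define H where "H k x = min (G x) (of_nat k) * indicator (ball 0 (real k)) x" for k :: nat and x
  have [measurable]: "H k \<in> borel_measurable lborel" for k
    unfolding H_def by (intro borel_measurable_times_ennreal borel_measurable_min borel_measurable_indicator) auto
  have H_le: "H k x \<le> G x" for k x
    by (simp add: H_def indicator_def)
  have inc: "incseq H"
    by (auto simp: incseq_def le_fun_def H_def indicator_def min_le_iff_disj intro: min.coboundedI1 min.coboundedI2
      order_trans[OF min.cobounded2])
  have SUP_H: "(SUP k. H k x) = G x" for x
  proof (rule antisym)
    show "(SUP k. H k x) \<le> G x" by (intro SUP_least H_le)
    show "G x \<le> (SUP k. H k x)"
    proof (rule ccontr)
      assume "\<not> G x \<le> (SUP k. H k x)"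
      then have less: "(SUP k. H k x) < G x" by simp
      then have "(SUP k. H k x) < top" using less_le_trans top_greatest by blast
      then obtain k1 where k1: "(SUP k. H k x) < of_nat k1"
        using ennreal_Ex_less_of_nat by (metis infinity_ennreal_def)
      obtain k2 where k2: "norm x < real k2" using reals_Archimedean2 by blast
      let ?k = "max k1 k2"
      have "H ?k x = min (G x) (of_nat ?k)"
        using k2 by (auto simp: H_def indicator_def)
      moreover have "of_nat k1 \<le> (of_nat ?k :: ennreal)" by (intro of_nat_mono) simp
      ultimately have "(SUP k. H k x) < H ?k x"
        using k1 less by (metis less_le_trans min_less_iff_conj)
      moreover have "H ?k x \<le> (SUP k. H k x)" by (rule SUP_upper) simp
      ultimately show False by simp
    qed
  qed
  have bound: "(\<integral>\<^sup>+x. epowr (H k x) q) \<le> epowr K q" for k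
  proof -
    let ?S = "\<integral>\<^sup>+x. epowr (H k x) q"
    have "?S \<le> (\<integral>\<^sup>+x. epowr (of_nat k) q * indicator (ball (0::'a) (real k)) x)"
      using q by (intro nn_integral_mono) (auto simp: H_def indicator_def intro!: epowr_mono)
    also have "\<dots> = epowr (of_nat k) q * emeasure lborel (ball (0::'a) (real k))"
      by (subst nn_integral_cmult_indicator) auto
    also have "\<dots> < top"
      using emeasure_lborel_ball_finite[of "0::'a" "real k"]
      by (simp add: ennreal_mult_less_top of_nat_less_top)
    finally have fin: "?S < top" .
    show ?thesis
    proof (cases "?S = 0")
      case True then show ?thesis by simp
    next
      case False
      then obtain s where s: "?S = ennreal s" "0 < s"
        using fin by (cases ?S) (auto simp: ennreal_eq_0_iff)
      \<comment> \<open>Here \<open>s\<close> is the integral of H^q. The factor gives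
        \<phi>^(q/(q-1)) the integral 1, and the pairing of \<phi> with \<open>H k\<close> becomes
        s^(1/q).\<close>
      define \<phi> where "\<phi> x = ennreal (s powr (- (q - 1) / q)) * epowr (H k x) (q - 1)" for x
      have [measurable]: "\<phi> \<in> borel_measurable lborel" unfolding \<phi>_def by measurable
      have "s powr ((1 - q) / (q - 1)) = 1 / s"
      proof -
        have "(1 - q) / (q - 1) = - 1" using q by (simp add: field_simps)
        then show ?thesis using s by (simp add: powr_minus_divide)
      qed
      then have "epowr (\<phi> x) (q / (q - 1)) = ennreal (1 / s) * epowr (H k x) q" for x
        using q s unfolding \<phi>_def
        by (subst epowr_mult) (auto simp: epowr_epowr epowr_ennreal powr_powr powr_minus_divide)
      then have "(\<integral>\<^sup>+x. epowr (\<phi> x) (q / (q - 1))) = ennreal (1 / s) * ?S"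
        by (simp add: nn_integral_cmult)
      also have "\<dots> = 1" using s by (simp add: ennreal_mult[symmetric])
      finally have "(\<integral>\<^sup>+x. G x * \<phi> x) \<le> K"
        by (intro le) auto
      moreover have "(\<integral>\<^sup>+x. H k x * \<phi> x) \<le> (\<integral>\<^sup>+x. G x * \<phi> x)"
        by (intro nn_integral_mono mult_right_mono H_le) auto
      moreover have "H k x * \<phi> x = ennreal (s powr (- (q - 1) / q)) * epowr (H k x) q" for x
        using epowr_add[of 1 "q - 1" "H k x"] q by (simp add: \<phi>_def ac_simps)
      then have "(\<integral>\<^sup>+x. H k x * \<phi> x) = ennreal (s powr (- (q - 1) / q)) * ?S"
        by (simp add: nn_integral_cmult)
      moreover have "s powr (- (q - 1) / q) * s = s powr (1 / q)"
      proof -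
        have "s powr (- (q - 1) / q) * s powr 1 = s powr (- (q - 1) / q + 1)" by (rule powr_add[symmetric])
        also have "- (q - 1) / q + 1 = 1 / q" using q by (simp add: field_simps)
        finally show ?thesis using s by simp
      qed
      ultimately have "ennreal (s powr (1 / q)) \<le> K"
        using s by (simp add: ennreal_mult[symmetric])
      then have "epowr ?S (1 / q) \<le> K" using s by (simp add: epowr_ennreal)
      then show ?thesis using q by (subst (asm) epowr_le_iff) auto
    qed
  qed
  have "(\<integral>\<^sup>+x. epowr (G x) q) = (\<integral>\<^sup>+x. (SUP k. epowr (H k x) q))"
    using q by (simp add: epowr_SUP[symmetric] SUP_H)
  also have "\<dots> = (SUP k. \<integral>\<^sup>+x. epowr (H k x) q)"
    using q inc by (intro nn_integral_monotone_convergence_SUP)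
      (auto simp: incseq_def le_fun_def intro!: epowr_mono)
  also have "\<dots> \<le> epowr K q" by (intro SUP_least bound)
  finally show ?thesis .
qed

section \<open>Riesz kernels and layer cakes\<close>

lemma nn_integral_swap:
  assumes "(\<lambda>(x, y). f x y) \<in> borel_measurable (lborel \<Otimes>\<^sub>M lborel)"
  shows "(\<integral>\<^sup>+x. \<integral>\<^sup>+y. f x y) = (\<integral>\<^sup>+y. \<integral>\<^sup>+x. f x y)"
  using lborel_pair.Fubini'[OF assms] by simp

lemma nn_integral_lborel_translate:
  fixes c :: "'a::euclidean_space"
  assumes [measurable]: "g \<in> borel_measurable borel"
  shows "(\<integral>\<^sup>+y. g (y + c)) = (\<integral>\<^sup>+y. g y)"
proof -
  have "(\<integral>\<^sup>+y. g y) = (\<integral>\<^sup>+y. g y \<partial>distr lborel borel ((+) c))"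
    by (simp add: lborel_distr_plus)
  also have "\<dots> = (\<integral>\<^sup>+y. g (y + c))"
    by (subst nn_integral_distr) (auto simp: add.commute)
  finally show ?thesis ..
qed

lemma nn_integral_powr_from_0:
  assumes "- 1 < s" "0 \<le> A"
  shows "(\<integral>\<^sup>+b. indicator {0..A} b * ennreal (b powr s)) = ennreal (A powr (s + 1) / (s + 1))"
  using nn_integral_has_integral_lebesgue'[OF _ has_integral_powr_from_0[OF assms]]
  by (simp add: mult.commute)

lemma nn_integral_powr_to_inf:
  assumes "s < - 1" "0 < A"
  shows "(\<integral>\<^sup>+b. indicator {A..} b * ennreal (b powr s)) = ennreal (- (A powr (s + 1) / (s + 1)))"
  using nn_integral_has_integral_lebesgue'[OF _ has_integral_powr_to_inf[OF assms]]
  by (simp add: mult.commute)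

text \<open>The condition \<open>0 < a\<close> matters: \<open>ennreal\<close> sends negative levels
  to 0 and would count them all for positive \<open>y\<close>. For infinite \<open>y\<close> the
  integral dominates every finite power, hence is infinite.\<close>

lemma nn_integral_layer_cake_powr:
  assumes "0 < r"
  shows "epowr y r = (\<integral>\<^sup>+a. ennreal (r * a powr (r - 1)) * of_bool (0 < a \<and> ennreal a < y))"
proof -
  have fin: "ennreal (z powr r) = (\<integral>\<^sup>+a. ennreal (r * a powr (r - 1)) * of_bool (0 < a \<and> ennreal a < ennreal z))"
    if "0 \<le> z" for z
  proof -
    have "(\<integral>\<^sup>+a. ennreal (r * a powr (r - 1)) * of_bool (0 < a \<and> ennreal a < ennreal z))
      = (\<integral>\<^sup>+a. ennreal r * (indicator {0..z} a * ennreal (a powr (r - 1))))"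
    proof (rule nn_integral_cong_AE)
      have "AE a in lborel. a \<noteq> z" by (rule AE_lborel_singleton)
      moreover have "AE a in lborel. a \<noteq> (0::real)" by (rule AE_lborel_singleton)
      ultimately show "AE a in lborel. ennreal (r * a powr (r - 1)) * of_bool (0 < a \<and> ennreal a < ennreal z)
        = ennreal r * (indicator {0..z} a * ennreal (a powr (r - 1)))"
        by (rule eventually_elim2) (use assms that in \<open>auto simp: ennreal_mult indicator_def ennreal_less_iff\<close>)
    qed
    also have "\<dots> = ennreal r * ennreal (z powr (r - 1 + 1) / (r - 1 + 1))"
      using assms that by (subst nn_integral_cmult, simp, subst nn_integral_powr_from_0) auto
    also have "\<dots> = ennreal (z powr r)"
      using assms by (simp add: ennreal_mult[symmetric])
    finally show ?thesis by simp
  qed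
  show ?thesis
  proof (cases y)
    case (real z)
    then show ?thesis using fin[of z] by (simp add: epowr_ennreal)
  next
    case top
    let ?I = "\<integral>\<^sup>+a. ennreal (r * a powr (r - 1)) * of_bool (0 < a \<and> ennreal a < y)"
    have ge: "ennreal (z powr r) \<le> ?I" if "0 \<le> z" for z
      unfolding fin[OF that] using top by (intro nn_integral_mono mult_left_mono) auto
    have "?I = top"
    proof (rule ccontr)
      assume "?I \<noteq> top"
      then obtain m where m: "?I = ennreal m" "0 \<le> m" by (cases ?I) auto
      have "ennreal (((m + 1) powr (1 / r)) powr r) \<le> ennreal m"
        using ge[of "(m + 1) powr (1 / r)"] m by simp
      then show False using assms m by (simp add: powr_powr)
    qed
    then show ?thesis using top by simp
  qed
qed

lemma nn_integral_layer_cake: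
  "y = (\<integral>\<^sup>+a. of_bool (0 < a \<and> ennreal a < y))"
proof -
  have "y = (\<integral>\<^sup>+a. ennreal (1 * a powr (1 - 1)) * of_bool (0 < a \<and> ennreal a < y))"
    using nn_integral_layer_cake_powr[of 1 y] by simp
  also have "\<dots> = (\<integral>\<^sup>+a. of_bool (0 < a \<and> ennreal a < y))"
    by (intro nn_integral_cong) auto
  finally show ?thesis .
qed

definition riesz_kernel :: "real \<Rightarrow> 'a::euclidean_space \<Rightarrow> 'a \<Rightarrow> ennreal" where
  "riesz_kernel \<alpha> x y = ennreal (norm (x - y) powr - \<alpha>)"

lemma borel_measurable_riesz_kernel [measurable]:
  assumes [measurable]: "f \<in> borel_measurable M" "g \<in> borel_measurable M"
  shows "(\<lambda>z. riesz_kernel \<alpha> (f z) (g z)) \<in> borel_measurable M"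
  unfolding riesz_kernel_def by measurable

lemma riesz_kernel_commute: "riesz_kernel \<alpha> x y = riesz_kernel \<alpha> y x"
  by (simp add: riesz_kernel_def norm_minus_commute)

text \<open>The extremal sets are balls around \<open>x\<close>. Instead of rearranging, the kernel
  is written as an integral over radii c, and the part of \<open>E\<close> within distance c of
  \<open>x\<close> is measured by the smaller of V c^n and the measure of \<open>E\<close>.\<close>

lemma nn_integral_riesz_kernel_set:
  fixes \<alpha> :: real
  assumes \<alpha>: "0 < \<alpha>" "\<alpha> < DIM('a::euclidean_space)"
  shows "\<exists>C>0. \<forall>E x. E \<in> sets borel \<longrightarrow>
    (\<integral>\<^sup>+y. indicator E y * riesz_kernel \<alpha> (x::'a) y)
      \<le> ennreal C * epowr (emeasure lborel E) (1 - \<alpha> / DIM('a))"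
proof -
  let ?n = "real DIM('a)"
  let ?V = "unit_ball_vol ?n"
  \<comment> \<open>The two summands come from the radii below and above the \<open>R\<close> chosen
    later.\<close>
  define C where "C = \<alpha> * ?V / (?n - \<alpha>) + 1"
  have V: "0 < ?V" by simp
  have C: "0 < C" using \<alpha> V by (simp add: C_def add_nonneg_pos)
  have "(\<integral>\<^sup>+y. indicator E y * riesz_kernel \<alpha> x y) \<le> ennreal C * epowr (emeasure lborel E) (1 - \<alpha> / ?n)"
    if [measurable]: "E \<in> sets borel" for E and x :: 'a
  proof -
    consider "emeasure lborel E = 0" | "emeasure lborel E = top"
      | m where "emeasure lborel E = ennreal m" "0 < m"
      by (cases "emeasure lborel E") (auto simp: order_le_less)
    then show ?thesis
    proof cases
      case 1
      then have "AE y in lborel. y \<notin> E" by (subst AE_iff_measurable[of E]) auto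
      then have "(\<integral>\<^sup>+y. indicator E y * riesz_kernel \<alpha> x y) = 0"
        by (subst nn_integral_0_iff_AE) (auto elim: eventually_mono)
      then show ?thesis by simp
    next
      case 2
      then show ?thesis using C by (simp add: ennreal_mult_top)
    next
      case (3 m)
      \<comment> \<open>Up to a constant factor a ball of this radius has the measure
        \<open>m\<close> of \<open>E\<close>; here the two bounds change roles.\<close>
      define R where "R = m powr (1 / ?n)"
      have R: "0 < R" using 3 by (simp add: R_def)
      let ?K = "\<lambda>y c. ennreal (\<alpha> * c powr (- \<alpha> - 1)) * of_bool (0 < c \<and> norm (x - y) \<le> c \<and> y \<in> E)"
      have pw: "indicator E y * riesz_kernel \<alpha> x y \<le> (\<integral>\<^sup>+c. ?K y c)" for y
      proof (cases "x = y \<or> y \<notin> E")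
        case False
        have "riesz_kernel \<alpha> x y
          = ennreal \<alpha> * (\<integral>\<^sup>+c. indicator {norm (x - y)..} c * ennreal (c powr (- \<alpha> - 1)))"
          using False \<alpha> by (subst nn_integral_powr_to_inf) (auto simp: riesz_kernel_def ennreal_mult[symmetric])
        also have "\<dots> = (\<integral>\<^sup>+c. ennreal \<alpha> * (indicator {norm (x - y)..} c * ennreal (c powr (- \<alpha> - 1))))"
          by (simp add: nn_integral_cmult)
        also have "\<dots> = (\<integral>\<^sup>+c. ?K y c)"
        proof (intro nn_integral_cong)
          fix c :: real
          have "0 < c" if "norm (x - y) \<le> c" using False that
            by (metis eq_iff_diff_eq_0 less_le_trans zero_less_norm_iff)
          then show "ennreal \<alpha> * (indicator {norm (x - y)..} c * ennreal (c powr (- \<alpha> - 1))) = ?K y c"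
            using False \<alpha> by (auto simp: indicator_def ennreal_mult)
        qed
        finally show ?thesis using False by simp
      qed (auto simp: riesz_kernel_def)
      have inner: "(\<integral>\<^sup>+y. ?K y c) \<le> ennreal (\<alpha> * ?V) * (indicator {0..R} c * ennreal (c powr (?n - \<alpha> - 1)))
          + ennreal (\<alpha> * m) * (indicator {R..} c * ennreal (c powr (- \<alpha> - 1)))" for c
      proof (cases "0 < c")
        case True
        have le: "(\<integral>\<^sup>+y. ?K y c) \<le> ennreal (\<alpha> * c powr (- \<alpha> - 1)) * emeasure lborel S"
          if "S \<in> sets borel" "\<And>y. norm (x - y) \<le> c \<Longrightarrow> y \<in> E \<Longrightarrow> y \<in> S" for S
        proof -
          have "(\<integral>\<^sup>+y. ?K y c) \<le> (\<integral>\<^sup>+y. ennreal (\<alpha> * c powr (- \<alpha> - 1)) * indicator S y)"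
            using that by (intro nn_integral_mono mult_left_mono) (auto simp: indicator_def)
          then show ?thesis using that by (simp add: nn_integral_cmult_indicator)
        qed
        show ?thesis
        proof (cases "c \<le> R")
          case cR: True
          have "c powr (- \<alpha> - 1) * c ^ DIM('a) = c powr (?n - \<alpha> - 1)"
            using True by (simp add: powr_realpow[symmetric] powr_add[symmetric] algebra_simps)
          then have "(\<integral>\<^sup>+y. ?K y c) \<le> ennreal (\<alpha> * ?V * c powr (?n - \<alpha> - 1))"
            using le[of "cball x c"] True \<alpha>
            by (simp add: emeasure_cball dist_norm ennreal_mult[symmetric] mult.left_commute mult.assoc)
          then show ?thesis
            using True cR \<alpha> by (intro add_increasing2) (auto simp: ennreal_mult[symmetric])
        next
          case False
          then show ?thesis using le[of E] True \<alpha> 3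
            by (intro add_increasing) (auto simp: ennreal_mult[symmetric] ac_simps)
        qed
      qed simp
      have "(\<integral>\<^sup>+y. indicator E y * riesz_kernel \<alpha> x y) \<le> (\<integral>\<^sup>+y. \<integral>\<^sup>+c. ?K y c)"
        by (intro nn_integral_mono pw)
      also have "\<dots> = (\<integral>\<^sup>+c. \<integral>\<^sup>+y. ?K y c)"
        by (rule nn_integral_swap) measurable
      also have "\<dots> \<le> (\<integral>\<^sup>+c. ennreal (\<alpha> * ?V) * (indicator {0..R} c * ennreal (c powr (?n - \<alpha> - 1)))
          + ennreal (\<alpha> * m) * (indicator {R..} c * ennreal (c powr (- \<alpha> - 1))))"
        by (intro nn_integral_mono inner)
      also have "\<dots> = ennreal (\<alpha> * ?V) * ennreal (R powr (?n - \<alpha>) / (?n - \<alpha>)) + ennreal (\<alpha> * m) * ennreal (R powr - \<alpha> / \<alpha>)"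
        using \<alpha> R nn_integral_powr_from_0[of "?n - \<alpha> - 1" R] nn_integral_powr_to_inf[of "- \<alpha> - 1" R]
        by (subst nn_integral_add) (auto simp: nn_integral_cmult)
      also have "\<dots> = ennreal (\<alpha> * ?V * (R powr (?n - \<alpha>) / (?n - \<alpha>)) + R powr - \<alpha> * m)"
        using \<alpha> 3 by (simp add: ennreal_mult[symmetric] ennreal_plus[symmetric] mult.commute del: ennreal_plus)
      also have "R powr (?n - \<alpha>) = m powr (1 - \<alpha> / ?n)"
        by (simp add: R_def powr_powr field_simps)
      also have "R powr - \<alpha> * m = m powr (1 - \<alpha> / ?n)"
        using 3 powr_add[of m "- \<alpha> / ?n" 1] by (simp add: R_def powr_powr field_simps)
      also have "\<alpha> * ?V * (m powr (1 - \<alpha> / ?n) / (?n - \<alpha>)) + m powr (1 - \<alpha> / ?n) = C * m powr (1 - \<alpha> / ?n)"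
        by (simp add: C_def algebra_simps)
      finally show ?thesis using 3 C by (simp add: epowr_ennreal ennreal_mult)
    qed
  qed
  then show ?thesis using C by blast
qed

section \<open>The Hardy--Littlewood--Sobolev inequality\<close>

text \<open>The distribution function |{f > a}| of positive levels, written as an integral so that
  measurability in \<open>a\<close> and exchanges of integrals come from Tonelli.\<close>

definition distr_fun :: "('a::euclidean_space \<Rightarrow> ennreal) \<Rightarrow> real \<Rightarrow> ennreal" where
  "distr_fun f a = (\<integral>\<^sup>+x. of_bool (0 < a \<and> ennreal a < f x))"

lemma borel_measurable_distr_fun [measurable]:
  assumes [measurable]: "f \<in> borel_measurable borel"
  shows "distr_fun f \<in> borel_measurable borel"
  unfolding distr_fun_def by measurable

lemma distr_fun_nonpos: "a \<le> 0 \<Longrightarrow> distr_fun f a = 0"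
  by (simp add: distr_fun_def)

lemma nn_integral_distr_fun:
  assumes [measurable]: "f \<in> borel_measurable borel" and p: "0 < p"
  shows "(\<integral>\<^sup>+a. ennreal (p * a powr (p - 1)) * distr_fun f a) = (\<integral>\<^sup>+x. epowr (f x) p)"
proof -
  have "(\<integral>\<^sup>+x. epowr (f x) p)
    = (\<integral>\<^sup>+x. \<integral>\<^sup>+a. ennreal (p * a powr (p - 1)) * of_bool (0 < a \<and> ennreal a < f x))"
    using p by (simp add: nn_integral_layer_cake_powr[symmetric])
  also have "\<dots> = (\<integral>\<^sup>+a. \<integral>\<^sup>+x. ennreal (p * a powr (p - 1)) * of_bool (0 < a \<and> ennreal a < f x))"
    by (rule nn_integral_swap) measurable
  also have "\<dots> = (\<integral>\<^sup>+a. ennreal (p * a powr (p - 1)) * distr_fun f a)"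
    unfolding distr_fun_def by (intro nn_integral_cong nn_integral_cmult) measurable
  finally show ?thesis ..
qed

text \<open>The kernel integrated over the product of two superlevel sets of measures \<open>v\<close> and \<open>w\<close> is at most
a multiple of both \<open>v w\<^sup>\<theta>\<close> and \<open>w v\<^sup>\<theta>\<close>, where \<open>\<theta> = 1 - \<alpha>/n\<close>.\<close>

lemma nn_integral_riesz_bilinear_layer:
  fixes \<alpha> :: real
  assumes \<alpha>: "0 < \<alpha>" "\<alpha> < DIM('a::euclidean_space)"
  shows "\<exists>C>0. \<forall>f \<in> borel_measurable borel. \<forall>h \<in> borel_measurable borel.
    (\<integral>\<^sup>+x. \<integral>\<^sup>+y. f x * riesz_kernel \<alpha> (x::'a) y * h y)
      \<le> (\<integral>\<^sup>+a. \<integral>\<^sup>+b. ennreal C * min (distr_fun f a * epowr (distr_fun h b) (1 - \<alpha> / DIM('a)))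
          (distr_fun h b * epowr (distr_fun f a) (1 - \<alpha> / DIM('a))))"
proof -
  let ?\<theta> = "1 - \<alpha> / DIM('a)"
  obtain C where C: "0 < C" and le: "\<And>E x. E \<in> sets borel \<Longrightarrow>
    (\<integral>\<^sup>+y. indicator E y * riesz_kernel \<alpha> (x::'a) y)
      \<le> ennreal C * epowr (emeasure lborel E) ?\<theta>"
    using nn_integral_riesz_kernel_set[OF \<alpha>] by blast
  have inner: "(\<integral>\<^sup>+y. of_bool (0 < b \<and> ennreal b < h y) * riesz_kernel \<alpha> (x::'a) y)
    \<le> ennreal C * epowr (distr_fun h b) ?\<theta>"
    if [measurable]: "h \<in> borel_measurable borel" for h b x
  proof -
    let ?E = "{y. 0 < b \<and> ennreal b < h y}"
    have E: "?E \<in> sets borel" by measurable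
    have "distr_fun h b = (\<integral>\<^sup>+y. indicator ?E y)"
      unfolding distr_fun_def by (intro nn_integral_cong) (auto simp: indicator_def)
    then have "distr_fun h b = emeasure lborel ?E"
      using E by simp
    then show ?thesis
      using le[OF E, of x] by (simp add: indicator_def[abs_def])
  qed
  have outer: "(\<integral>\<^sup>+x. \<integral>\<^sup>+y. of_bool (0 < a \<and> ennreal a < f x) * (of_bool (0 < b \<and> ennreal b < h y) * riesz_kernel \<alpha> (x::'a) y))
    \<le> ennreal C * (distr_fun f a * epowr (distr_fun h b) ?\<theta>)"
    if [measurable]: "f \<in> borel_measurable borel" "h \<in> borel_measurable borel" for f h a b
  proof -
    have "(\<integral>\<^sup>+x. \<integral>\<^sup>+y. of_bool (0 < a \<and> ennreal a < f x) * (of_bool (0 < b \<and> ennreal b < h y) * riesz_kernel \<alpha> (x::'a) y))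
      = (\<integral>\<^sup>+x. of_bool (0 < a \<and> ennreal a < f x) * (\<integral>\<^sup>+y. of_bool (0 < b \<and> ennreal b < h y) * riesz_kernel \<alpha> (x::'a) y))"
      by (intro nn_integral_cong nn_integral_cmult) measurable
    also have "\<dots> \<le> (\<integral>\<^sup>+x. of_bool (0 < a \<and> ennreal a < f x) * (ennreal C * epowr (distr_fun h b) ?\<theta>))"
      by (intro nn_integral_mono mult_left_mono inner) auto
    also have "\<dots> = ennreal C * (distr_fun f a * epowr (distr_fun h b) ?\<theta>)"
      unfolding distr_fun_def by (subst nn_integral_multc) (auto simp: ac_simps)
    finally show ?thesis .
  qed
  show ?thesis
  proof (intro exI[of _ C] conjI ballI C)
    fix f h :: "'a \<Rightarrow> ennreal"
    assume [measurable]: "f \<in> borel_measurable borel" "h \<in> borel_measurable borel"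
    define F where "F a x = (of_bool (0 < a \<and> ennreal a < f x) :: ennreal)" for a x
    define H where "H b y = (of_bool (0 < b \<and> ennreal b < h y) :: ennreal)" for b y
    define k where "k x y = riesz_kernel \<alpha> (x::'a) y" for x y
    have [measurable]: "(\<lambda>(a, x). F a x) \<in> borel_measurable (borel \<Otimes>\<^sub>M borel)"
      "(\<lambda>(a, x). H a x) \<in> borel_measurable (borel \<Otimes>\<^sub>M borel)"
      "(\<lambda>(a, x). k a x) \<in> borel_measurable (borel \<Otimes>\<^sub>M borel)"
      unfolding F_def H_def k_def by measurable
    have fF: "f x = (\<integral>\<^sup>+a. F a x)" and hH: "h x = (\<integral>\<^sup>+b. H b x)" for x
      unfolding F_def H_def by (rule nn_integral_layer_cake)+
    have "f x * k x y * h y = (\<integral>\<^sup>+a. \<integral>\<^sup>+b. F a x * (H b y * k x y))" for x y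
    proof -
      have "(\<integral>\<^sup>+a. \<integral>\<^sup>+b. F a x * (H b y * k x y))
        = (\<integral>\<^sup>+a. F a x * (\<integral>\<^sup>+b. H b y * k x y))"
        by (intro nn_integral_cong nn_integral_cmult) measurable
      also have "\<dots> = (\<integral>\<^sup>+a. F a x) * (\<integral>\<^sup>+b. H b y * k x y)"
        by (intro nn_integral_multc) measurable
      also have "(\<integral>\<^sup>+b. H b y * k x y) = h y * k x y"
        unfolding hH by (intro nn_integral_multc) measurable
      finally show ?thesis by (simp add: fF ac_simps)
    qed
    then have "(\<integral>\<^sup>+x. \<integral>\<^sup>+y. f x * k x y * h y)
      = (\<integral>\<^sup>+x. \<integral>\<^sup>+y. \<integral>\<^sup>+a. \<integral>\<^sup>+b. F a x * (H b y * k x y))"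
      by simp
    also have "\<dots> = (\<integral>\<^sup>+x. \<integral>\<^sup>+a. \<integral>\<^sup>+y. \<integral>\<^sup>+b. F a x * (H b y * k x y))"
      by (intro nn_integral_cong nn_integral_swap) measurable
    also have "\<dots> = (\<integral>\<^sup>+a. \<integral>\<^sup>+x. \<integral>\<^sup>+y. \<integral>\<^sup>+b. F a x * (H b y * k x y))"
      by (rule nn_integral_swap) measurable
    also have "\<dots> = (\<integral>\<^sup>+a. \<integral>\<^sup>+x. \<integral>\<^sup>+b. \<integral>\<^sup>+y. F a x * (H b y * k x y))"
      by (intro nn_integral_cong nn_integral_swap) measurable
    also have "\<dots> = (\<integral>\<^sup>+a. \<integral>\<^sup>+b. \<integral>\<^sup>+x. \<integral>\<^sup>+y. F a x * (H b y * k x y))"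
      by (intro nn_integral_cong nn_integral_swap) measurable
    also have "\<dots> \<le> (\<integral>\<^sup>+a. \<integral>\<^sup>+b. ennreal C * min (distr_fun f a * epowr (distr_fun h b) ?\<theta>)
          (distr_fun h b * epowr (distr_fun f a) ?\<theta>))"
    proof (intro nn_integral_mono)
      fix a b :: real
      have "(\<integral>\<^sup>+x. \<integral>\<^sup>+y. F a x * (H b y * k x y))
        \<le> ennreal C * (distr_fun f a * epowr (distr_fun h b) ?\<theta>)"
        unfolding F_def H_def k_def by (rule outer) auto
      \<comment> \<open>The second bound: integrate in \<open>x\<close> first and use the symmetry
        of the kernel.\<close>
      moreover have "(\<integral>\<^sup>+x. \<integral>\<^sup>+y. F a x * (H b y * k x y))
        = (\<integral>\<^sup>+y. \<integral>\<^sup>+x. F a x * (H b y * k x y))"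
        by (rule nn_integral_swap) measurable
      moreover have "\<dots> = (\<integral>\<^sup>+y. \<integral>\<^sup>+x. H b y * (F a x * k y x))"
        by (intro nn_integral_cong) (simp add: k_def riesz_kernel_commute ac_simps)
      moreover have "\<dots> \<le> ennreal C * (distr_fun h b * epowr (distr_fun f a) ?\<theta>)"
        unfolding F_def H_def k_def by (rule outer) auto
      ultimately show "(\<integral>\<^sup>+x. \<integral>\<^sup>+y. F a x * (H b y * k x y))
        \<le> ennreal C * min (distr_fun f a * epowr (distr_fun h b) ?\<theta>)
          (distr_fun h b * epowr (distr_fun f a) ?\<theta>)"
        by (simp add: min_def)
    qed
    finally show "(\<integral>\<^sup>+x. \<integral>\<^sup>+y. f x * riesz_kernel \<alpha> (x::'a) y * h y)
      \<le> (\<integral>\<^sup>+a. \<integral>\<^sup>+b. ennreal C * min (distr_fun f a * epowr (distr_fun h b) ?\<theta>)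
          (distr_fun h b * epowr (distr_fun f a) ?\<theta>))"
      by (simp add: k_def)
  qed
qed

text \<open>Hoelder with weights \<theta> and 1 - \<theta> against a pure power b^-s. The value
  \<open>s = (r - 1) * \<theta> / (1 - \<theta>)\<close> is forced by cancellation of the powers of
  b, and r \<theta> < 1 is exactly s < 1, the integrability of b^-s at 0.\<close>

lemma nn_integral_epowr_initial_bound:
  fixes r \<theta> A :: real
  assumes [measurable]: "w \<in> borel_measurable borel"
    and r: "1 < r" "0 < \<theta>" "\<theta> < 1" "r * \<theta> < 1" and A: "0 < A"
    and w: "(\<integral>\<^sup>+b. ennreal (r * b powr (r - 1)) * w b) \<le> 1"
  shows "(\<integral>\<^sup>+b. of_bool (0 < b \<and> b \<le> A) * epowr (w b) \<theta>)
    \<le> ennreal ((1 / (1 - (r - 1) * \<theta> / (1 - \<theta>))) powr (1 - \<theta>) * A powr (1 - r * \<theta>))"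
proof -
  define s where "s = (r - 1) * \<theta> / (1 - \<theta>)"
  have s: "0 < s" "s < 1" using r by (auto simp: s_def field_simps)
  have s\<theta>: "(1 - s) * (1 - \<theta>) = 1 - r * \<theta>" "s * (1 - \<theta>) = (r - 1) * \<theta>"
    using r by (auto simp: s_def field_simps)
  have "of_bool (0 < b \<and> b \<le> A) * epowr (w b) \<theta>
    \<le> epowr (ennreal (b powr (r - 1)) * w b) \<theta> * epowr (indicator {0..A} b * ennreal (b powr - s)) (1 - \<theta>)" for b
  proof (cases "0 < b \<and> b \<le> A")
    case True
    have "epowr (ennreal (b powr (r - 1)) * w b) \<theta> * epowr (indicator {0..A} b * ennreal (b powr - s)) (1 - \<theta>)
      = ennreal (b powr ((r - 1) * \<theta>) * b powr (- (s * (1 - \<theta>)))) * epowr (w b) \<theta>"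
      using True r by (simp add: epowr_mult epowr_ennreal powr_powr ennreal_mult ac_simps)
    also have "b powr ((r - 1) * \<theta>) * b powr (- (s * (1 - \<theta>))) = 1"
      unfolding s\<theta> using True by (simp add: powr_add[symmetric])
    finally show ?thesis using True by simp
  qed auto
  then have "(\<integral>\<^sup>+b. of_bool (0 < b \<and> b \<le> A) * epowr (w b) \<theta>)
    \<le> (\<integral>\<^sup>+b. epowr (ennreal (b powr (r - 1)) * w b) \<theta> * epowr (indicator {0..A} b * ennreal (b powr - s)) (1 - \<theta>))"
    by (intro nn_integral_mono)
  also have "\<dots> \<le> epowr (\<integral>\<^sup>+b. ennreal (b powr (r - 1)) * w b) \<theta>
      * epowr (\<integral>\<^sup>+b. indicator {0..A} b * ennreal (b powr - s)) (1 - \<theta>)"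
    using r by (intro nn_integral_Holder) auto
  also have "\<dots> \<le> epowr 1 \<theta> * epowr (ennreal (A powr (1 - s) / (1 - s))) (1 - \<theta>)"
  proof (intro mult_mono epowr_mono)
    have "(\<integral>\<^sup>+b. ennreal (b powr (r - 1)) * w b) \<le> (\<integral>\<^sup>+b. ennreal (r * b powr (r - 1)) * w b)"
      using r mult_right_mono[of 1 r] by (intro nn_integral_mono mult_right_mono ennreal_leI) auto
    then show "(\<integral>\<^sup>+b. ennreal (b powr (r - 1)) * w b) \<le> 1" using w by simp
    show "(\<integral>\<^sup>+b. indicator {0..A} b * ennreal (b powr - s)) \<le> ennreal (A powr (1 - s) / (1 - s))"
      using nn_integral_powr_from_0[of "- s" A] s A by simp
  qed (use r in auto)
  also have "\<dots> = ennreal ((A powr (1 - s) / (1 - s)) powr (1 - \<theta>))"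
    using s by (simp add: epowr_ennreal)
  also have "(A powr (1 - s) / (1 - s)) powr (1 - \<theta>) = (1 / (1 - s)) powr (1 - \<theta>) * A powr (1 - r * \<theta>)"
    using s by (simp add: powr_divide powr_powr s\<theta>)
  finally show ?thesis by (simp add: s_def)
qed

text \<open>The plane of levels \<open>(a, b)\<close> is split along \<open>b = a\<^sup>p\<^sup>/\<^sup>r\<close>; on each side the bound
with the smaller level under the power \<open>\<theta>\<close> is the good one.\<close>

theorem riesz_bilinear_bound:
  fixes \<alpha> p r :: real
  assumes \<alpha>: "0 < \<alpha>" "\<alpha> < DIM('a::euclidean_space)" and p: "1 < p" and r: "1 < r"
    and eq: "1 / p + 1 / r + \<alpha> / DIM('a) = 2"
  shows "\<exists>C\<ge>0. \<forall>f \<in> borel_measurable borel. \<forall>h \<in> borel_measurable borel.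
    (\<integral>\<^sup>+x. epowr (f x) p) \<le> 1 \<longrightarrow> (\<integral>\<^sup>+x. epowr (h x) r) \<le> 1 \<longrightarrow>
    (\<integral>\<^sup>+x. \<integral>\<^sup>+y. f x * riesz_kernel \<alpha> (x::'a) y * h y) \<le> ennreal C"
proof -
  let ?\<theta> = "1 - \<alpha> / DIM('a)"
  have \<theta>: "0 < ?\<theta>" "?\<theta> < 1" using \<alpha> by (auto simp: field_simps)
  have pr: "1 / p + 1 / r = 1 + ?\<theta>" using eq by simp
  define D where "D r = (1 / (1 - (r - 1) * ?\<theta> / (1 - ?\<theta>))) powr (1 - ?\<theta>)" for r
  have D0: "0 \<le> D r" for r by (simp add: D_def)
  obtain C where C: "0 < C" and le: "\<And>f h :: 'a \<Rightarrow> ennreal. f \<in> borel_measurable borel \<Longrightarrow> h \<in> borel_measurable borel \<Longrightarrow>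
    (\<integral>\<^sup>+x. \<integral>\<^sup>+y. f x * riesz_kernel \<alpha> (x::'a) y * h y)
      \<le> (\<integral>\<^sup>+a. \<integral>\<^sup>+b. ennreal C * min (distr_fun f a * epowr (distr_fun h b) ?\<theta>)
          (distr_fun h b * epowr (distr_fun f a) ?\<theta>))"
    using nn_integral_riesz_bilinear_layer[OF \<alpha>] by blast
  let ?J = "\<lambda>p r (h::'a \<Rightarrow> ennreal) a. \<integral>\<^sup>+b. of_bool (0 < b \<and> b \<le> a powr (p / r)) * epowr (distr_fun h b) ?\<theta>"
  \<comment> \<open>Stated for fresh \<open>p\<close> and \<open>r\<close>, because it serves a
    second time with the roles of \<open>f\<close> and \<open>h\<close> exchanged.\<close>
  have half: "(\<integral>\<^sup>+a. distr_fun f a * ?J p r h a)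
      \<le> ennreal (D r)"
    if [measurable]: "f \<in> borel_measurable borel" "h \<in> borel_measurable borel"
      and f1: "(\<integral>\<^sup>+x. epowr (f x) p) \<le> 1" and h1: "(\<integral>\<^sup>+x. epowr (h x) r) \<le> 1"
      and pr: "1 < p" "1 < r" "1 / p + 1 / r = 1 + ?\<theta>"
    for f h :: "'a \<Rightarrow> ennreal" and p r
  proof -
    have "1 / p < 1" using pr by simp
    then have "?\<theta> < 1 / r" using pr by linarith
    then have r\<theta>: "r * ?\<theta> < 1" using pr by (simp add: field_simps)
    \<comment> \<open>The relation between the exponents enters here: for
      \<open>A = a powr (p / r)\<close> the initial bound grows like a^(p-1), the weight with which
      the distribution function of \<open>f\<close> integrates to the p-th power of its
      norm.\<close>
    have "p / r * (1 - r * ?\<theta>) = p * (1 / r - ?\<theta>)" using pr by (simp add: field_simps)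
    also have "1 / r - ?\<theta> = 1 - 1 / p" using pr by simp
    also have "p * (1 - 1 / p) = p - 1" using pr by (simp add: field_simps)
    finally have ex: "p / r * (1 - r * ?\<theta>) = p - 1" .
    have "(\<integral>\<^sup>+a. distr_fun f a * ?J p r h a)
      \<le> (\<integral>\<^sup>+a. ennreal (D r) * (ennreal (p * a powr (p - 1)) * distr_fun f a))"
    proof (intro nn_integral_mono)
      fix a :: real
      show "distr_fun f a * ?J p r h a
        \<le> ennreal (D r) * (ennreal (p * a powr (p - 1)) * distr_fun f a)"
      proof (cases "0 < a")
        case True
        have "?J p r h a
          \<le> ennreal (D r * (a powr (p / r)) powr (1 - r * ?\<theta>))"
          unfolding D_def using pr r\<theta> \<theta> h1 True
          by (intro nn_integral_epowr_initial_bound) (auto simp: nn_integral_distr_fun)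
        also have "(a powr (p / r)) powr (1 - r * ?\<theta>) = a powr (p - 1)"
          unfolding powr_powr ex ..
        also have "ennreal (D r * a powr (p - 1)) \<le> ennreal (D r) * ennreal (p * a powr (p - 1))"
          using D0[of r] pr mult_right_mono[of 1 p "a powr (p - 1)"] by (subst ennreal_mult[symmetric]) (auto intro!: ennreal_leI mult_left_mono)
        finally have "distr_fun f a * ?J p r h a
          \<le> distr_fun f a * (ennreal (D r) * ennreal (p * a powr (p - 1)))"
          by (intro mult_left_mono) auto
        then show ?thesis by (simp add: ac_simps)
      qed (simp add: distr_fun_nonpos)
    qed
    also have "\<dots> = ennreal (D r) * (\<integral>\<^sup>+x. epowr (f x) p)"
      using pr by (simp add: nn_integral_cmult nn_integral_distr_fun)
    also have "\<dots> \<le> ennreal (D r) * 1" using f1 by (intro mult_left_mono) auto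
    finally show ?thesis by simp
  qed
  show ?thesis
  proof (intro exI[of _ "C * (D r + D p)"] conjI ballI impI)
    show "0 \<le> C * (D r + D p)" using C D0 by simp
    fix f h :: "'a \<Rightarrow> ennreal"
    assume [measurable]: "f \<in> borel_measurable borel" "h \<in> borel_measurable borel"
      and f1: "(\<integral>\<^sup>+x. epowr (f x) p) \<le> 1" and h1: "(\<integral>\<^sup>+x. epowr (h x) r) \<le> 1"
    let ?U = "\<lambda>a b. distr_fun f a * (of_bool (0 < b \<and> b \<le> a powr (p / r)) * epowr (distr_fun h b) ?\<theta>)"
    let ?W = "\<lambda>a b. distr_fun h b * (of_bool (0 < a \<and> a \<le> b powr (r / p)) * epowr (distr_fun f a) ?\<theta>)"
    have min_le: "ennreal C * min (distr_fun f a * epowr (distr_fun h b) ?\<theta>) (distr_fun h b * epowr (distr_fun f a) ?\<theta>)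
      \<le> ennreal C * (?U a b + ?W a b)" for a b
    proof (cases "0 < a \<and> 0 < b")
      case True
      have "b \<le> a powr (p / r) \<or> a \<le> b powr (r / p)"
      proof (rule ccontr)
        assume "\<not> (b \<le> a powr (p / r) \<or> a \<le> b powr (r / p))"
        then have 1: "a powr (p / r) < b" "b powr (r / p) < a" by auto
        have "(a powr (p / r)) powr (r / p) < b powr (r / p)"
          using 1 True p r by (intro powr_less_mono2) auto
        then show False using 1 True p r by (simp add: powr_powr)
      qed
      then show ?thesis
        using True by (intro mult_left_mono) (auto intro: min.coboundedI1 min.coboundedI2 add_increasing add_increasing2)
    next
      case False
      then show ?thesis by (auto simp: distr_fun_nonpos not_less)
    qed
    have "(\<integral>\<^sup>+x. \<integral>\<^sup>+y. f x * riesz_kernel \<alpha> (x::'a) y * h y)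
      \<le> (\<integral>\<^sup>+a. \<integral>\<^sup>+b. ennreal C * min (distr_fun f a * epowr (distr_fun h b) ?\<theta>)
          (distr_fun h b * epowr (distr_fun f a) ?\<theta>))"
      by (rule le) auto
    also have "\<dots> \<le> (\<integral>\<^sup>+a. \<integral>\<^sup>+b. ennreal C * (?U a b + ?W a b))"
      by (intro nn_integral_mono min_le)
    also have "\<dots> = (\<integral>\<^sup>+a. ennreal C * ((\<integral>\<^sup>+b. ?U a b) + (\<integral>\<^sup>+b. ?W a b)))"
      by (intro nn_integral_cong) (subst nn_integral_cmult, measurable, subst nn_integral_add, auto)
    also have "\<dots> = ennreal C * ((\<integral>\<^sup>+a. \<integral>\<^sup>+b. ?U a b) + (\<integral>\<^sup>+a. \<integral>\<^sup>+b. ?W a b))"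
      by (subst nn_integral_cmult, measurable, subst nn_integral_add, auto)
    also have "(\<integral>\<^sup>+a. \<integral>\<^sup>+b. ?W a b) = (\<integral>\<^sup>+b. \<integral>\<^sup>+a. ?W a b)"
      by (rule nn_integral_swap) measurable
    also have "\<dots> = (\<integral>\<^sup>+b. distr_fun h b * ?J r p f b)"
      by (intro nn_integral_cong nn_integral_cmult) measurable
    also have "\<dots> \<le> ennreal (D p)"
      using f1 h1 p r pr by (intro half) auto
    also have "(\<integral>\<^sup>+a. \<integral>\<^sup>+b. ?U a b)
      = (\<integral>\<^sup>+a. distr_fun f a * ?J p r h a)"
      by (intro nn_integral_cong nn_integral_cmult) measurable
    also have "\<dots> \<le> ennreal (D r)"
      using f1 h1 p r pr by (intro half) auto
    finally show "(\<integral>\<^sup>+x. \<integral>\<^sup>+y. f x * riesz_kernel \<alpha> (x::'a) y * h y)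
      \<le> ennreal (C * (D r + D p))"
      using C D0 by (simp add: add_right_mono add_left_mono mult_left_mono ennreal_mult ennreal_plus)
  qed
qed

section \<open>Linear changes of variables and mixed norms\<close>

text \<open>Uniqueness of translation invariant measures, by Fubini. The library determines the factor as a
determinant only for vectors indexed by a well-ordered type.\<close>

lemma nn_integral_lborel_linear:
  fixes L :: "'a::euclidean_space \<Rightarrow> 'a"
  assumes L: "linear L" "inj L"
  shows "\<exists>c>0. \<forall>f \<in> borel_measurable borel. \<forall>v.
    (\<integral>\<^sup>+x. f (L x + v)) = ennreal c * (\<integral>\<^sup>+x. f x)"
proof -
  obtain L' where L': "linear L'" "\<And>x. L (L' x) = x" "\<And>x. L' (L x) = x"
    using linear_injective_isomorphism[OF L] by auto
  have [measurable]: "L \<in> borel_measurable borel"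
    using L(1) by (intro borel_measurable_continuous_onI linear_continuous_on) (simp add: linear_linear)
  have L_add: "L (x + y) = L x + L y" for x y using L(1) by (rule linear_add)
  define h :: "'a \<Rightarrow> ennreal" where "h = indicator (ball 0 1)"
  define W where "W = (\<integral>\<^sup>+x. h (- L x))"
  have [measurable]: "h \<in> borel_measurable borel"
    unfolding h_def by (intro borel_measurable_indicator) simp
  have h_V: "(\<integral>\<^sup>+x. h x) = ennreal (unit_ball_vol DIM('a))"
    by (simp add: h_def emeasure_ball)
  have V0: "0 < unit_ball_vol (real DIM('a))" by simp
  then have V1: "unit_ball_vol (real DIM('a)) \<noteq> 0" by linarith
  \<comment> \<open>The double integral of f (L x + y) h y is computed in two orders. Translating x
    by L' y removes y from \<open>f\<close>; translating y by - L x moves L x from \<open>f\<close>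
    into \<open>h\<close>.\<close>
  have main: "(\<integral>\<^sup>+x. f (L x)) * ennreal (unit_ball_vol DIM('a)) = W * (\<integral>\<^sup>+x. f x)"
    if [measurable]: "f \<in> borel_measurable borel" for f
  proof -
    have "(\<integral>\<^sup>+x. f (L x)) * ennreal (unit_ball_vol DIM('a))
      = (\<integral>\<^sup>+y. (\<integral>\<^sup>+x. f (L x)) * h y)"
      by (simp add: h_V[symmetric] nn_integral_cmult)
    also have "\<dots> = (\<integral>\<^sup>+y. (\<integral>\<^sup>+x. f (L x + y) * h y))"
    proof (intro nn_integral_cong)
      fix y
      have "(\<integral>\<^sup>+x. f (L x)) = (\<integral>\<^sup>+x. f (L (x + L' y)))"
        by (rule nn_integral_lborel_translate[symmetric, where g = "\<lambda>x. f (L x)"]) measurable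
      then show "(\<integral>\<^sup>+x. f (L x)) * h y = (\<integral>\<^sup>+x. f (L x + y) * h y)"
        by (simp add: nn_integral_multc L_add L')
    qed
    also have "\<dots> = (\<integral>\<^sup>+x. (\<integral>\<^sup>+y. f (L x + y) * h y))"
      by (rule nn_integral_swap) measurable
    also have "\<dots> = (\<integral>\<^sup>+x. (\<integral>\<^sup>+y. f y * h (y - L x)))"
    proof (rule nn_integral_cong)
      fix x
      have "(\<integral>\<^sup>+y. f (y + L x) * h ((y + L x) - L x)) = (\<integral>\<^sup>+y. f y * h (y - L x))"
        by (rule nn_integral_lborel_translate[where g = "\<lambda>y. f y * h (y - L x)"]) measurable
      then show "(\<integral>\<^sup>+y. f (L x + y) * h y) = (\<integral>\<^sup>+y. f y * h (y - L x))"
        by (simp add: add.commute)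
    qed
    also have "\<dots> = (\<integral>\<^sup>+y. (\<integral>\<^sup>+x. f y * h (y - L x)))"
      by (rule nn_integral_swap) measurable
    also have "\<dots> = (\<integral>\<^sup>+y. f y * W)"
    proof (intro nn_integral_cong)
      fix y
      have "(\<integral>\<^sup>+x. h (y - L x)) = (\<integral>\<^sup>+x. h (y - L (x + L' y)))"
        by (rule nn_integral_lborel_translate[symmetric, where g = "\<lambda>x. h (y - L x)"]) measurable
      also have "\<dots> = W" by (simp add: W_def L_add L')
      finally show "(\<integral>\<^sup>+x. f y * h (y - L x)) = f y * W"
        by (simp add: nn_integral_cmult)
    qed
    also have "\<dots> = W * (\<integral>\<^sup>+y. f y)"
      by (simp add: nn_integral_multc mult.commute[of W])
    finally show ?thesis .
  qed
  have "(\<lambda>x. h (L' x)) \<in> borel_measurable borel" using L'(1)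
    by (intro measurable_compose[OF _ \<open>h \<in> borel_measurable borel\<close>] borel_measurable_continuous_onI linear_continuous_on)
      (simp add: linear_linear)
  \<comment> \<open>The test function h o L' shows that \<open>W\<close> is neither 0 nor infinite,
    since the left-hand side is finite and positive.\<close>
  from main[OF this] have VW: "ennreal (unit_ball_vol DIM('a)) * ennreal (unit_ball_vol DIM('a))
      = W * (\<integral>\<^sup>+x. h (L' x))"
    by (simp add: L' h_V)
  have "W \<noteq> 0" using VW V1 by auto
  moreover have "W \<noteq> top"
    using VW V1 by (auto simp: ennreal_top_mult ennreal_mult[symmetric] split: if_splits)
  ultimately obtain w where w: "W = ennreal w" "0 < w"
    by (cases W) (auto simp: less_le)
  define c where "c = w / unit_ball_vol (real DIM('a))"
  have c0: "0 < c" using w V0 by (simp add: c_def)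
  have "(\<integral>\<^sup>+x. f (L x + v)) = ennreal c * (\<integral>\<^sup>+x. f x)"
    if [measurable]: "f \<in> borel_measurable borel" for f v
  proof -
    have "(\<integral>\<^sup>+x. f (L x)) = (\<integral>\<^sup>+x. f (L (x + L' v)))"
      by (rule nn_integral_lborel_translate[symmetric, where g = "\<lambda>x. f (L x)"]) measurable
    then have "(\<integral>\<^sup>+x. f (L x + v)) = (\<integral>\<^sup>+x. f (L x))"
      by (simp add: L_add L')
    also have "\<dots> = (\<integral>\<^sup>+x. f (L x)) * ennreal (unit_ball_vol DIM('a)) * ennreal (1 / unit_ball_vol DIM('a))"
      using V0 V1 by (simp add: mult.assoc ennreal_mult[symmetric])
    also have "\<dots> = ennreal w * ennreal (1 / unit_ball_vol DIM('a)) * (\<integral>\<^sup>+x. f x)"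
      unfolding main[OF that] w by (simp add: ac_simps)
    also have "\<dots> = ennreal c * (\<integral>\<^sup>+x. f x)"
      using w V0 by (simp add: ennreal_mult[symmetric] c_def)
    finally show ?thesis .
  qed
  then show ?thesis using c0 by blast
qed

section \<open>Reciprocal exponents and the calculus of \<open>Lp_norm\<close>\<close>

text \<open>Turns the relation between extended exponents into one between reals, to which linear
  arithmetic applies. On positive exponents, \<infinity> included, it is faithful and reverses the
  order.\<close>

definition recip :: "ennreal \<Rightarrow> real" where
  "recip p = enn2real (1 / p)"

lemma recip_top [simp]: "recip \<infinity> = 0" "recip top = 0"
  by (simp_all add: recip_def)

lemma recip_ennreal: "0 < r \<Longrightarrow> recip (ennreal r) = 1 / r"
  using divide_ennreal[of 1 r] by (simp add: recip_def)

lemma recip_nonneg [simp]: "0 \<le> recip p"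
  by (simp add: recip_def)

lemma pos_ennreal_cases:
  fixes p :: ennreal
  assumes "0 < p"
  obtains "p = \<infinity>" | r where "p = ennreal r" "0 < r"
  using assms by (cases p) auto

lemma recip_pos: "0 < p \<Longrightarrow> p \<noteq> \<infinity> \<Longrightarrow> 0 < recip p"
  by (erule pos_ennreal_cases) (auto simp: recip_ennreal)

lemma enn2real_eq_recip: "0 < p \<Longrightarrow> enn2real p = 1 / recip p"
  by (erule pos_ennreal_cases) (auto simp: recip_ennreal)

lemma divide_eq_recip: "0 < p \<Longrightarrow> 1 / p = ennreal (recip p)"
  using divide_ennreal[of 1] by (erule_tac pos_ennreal_cases) (auto simp: recip_ennreal)

lemma recip_less_iff:
  assumes "0 < p" "0 < q"
  shows "recip p < recip q \<longleftrightarrow> q < p"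
  using assms(1)
proof (rule pos_ennreal_cases)
  assume "p = \<infinity>"
  then show ?thesis using assms(2)
    by (elim pos_ennreal_cases) (auto simp: recip_ennreal)
next
  fix r assume "p = ennreal r" "0 < r"
  then show ?thesis using assms(2)
    by (elim pos_ennreal_cases) (auto simp: recip_ennreal ennreal_less_iff field_simps)
qed

lemma recip_1 [simp]: "recip 1 = 1"
  using recip_ennreal[of 1] by simp

lemma Lp_norm_infty: "Lp_norm \<infinity> M g = esssup M g" "Lp_norm top M g = esssup M g"
  by (simp_all add: Lp_norm_def)

lemma Lp_norm_recip:
  "0 < p \<Longrightarrow> p \<noteq> \<infinity> \<Longrightarrow> Lp_norm p M g = epowr (\<integral>\<^sup>+x. epowr (g x) (1 / recip p) \<partial>M) (recip p)"
  by (simp add: Lp_norm_def enn2real_eq_recip)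

lemma Lp_norm_lebesgue:
  assumes "g \<in> borel_measurable borel" "0 < p"
  shows "Lp_norm p lebesgue g = Lp_norm p lborel g"
proof (cases "p = \<infinity>")
  case True
  have "esssup lebesgue g = esssup lborel g"
    using assms by (subst (1 2) esssup_eq_AE) (auto simp: AE_completion_iff intro: measurable_completion)
  then show ?thesis using True by (simp add: Lp_norm_infty)
next
  case False
  then show ?thesis using assms by (simp add: Lp_norm_recip nn_integral_completion)
qed

lemma Lp_norm_mono_AE:
  assumes "f \<in> borel_measurable M" "AE x in M. f x \<le> g x" "0 < p"
  shows "Lp_norm p M f \<le> Lp_norm p M g"
proof (cases "p = \<infinity>")
  case True
  then show ?thesis using assms by (simp add: Lp_norm_infty esssup_AE_mono)
next
  case False
  have "(\<integral>\<^sup>+x. epowr (f x) (1 / recip p) \<partial>M) \<le> (\<integral>\<^sup>+x. epowr (g x) (1 / recip p) \<partial>M)"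
    using assms(2) by (intro nn_integral_mono_AE) (auto elim!: eventually_mono intro: epowr_mono)
  then show ?thesis using False assms by (simp add: Lp_norm_recip epowr_mono)
qed

lemma Lp_norm_mono:
  assumes "f \<in> borel_measurable M" "\<And>x. f x \<le> g x" "0 < p"
  shows "Lp_norm p M f \<le> Lp_norm p M g"
  using assms by (intro Lp_norm_mono_AE) auto

lemma Lp_norm_cong_AE:
  assumes "f \<in> borel_measurable M" "g \<in> borel_measurable M" "AE x in M. f x = g x" "0 < p"
  shows "Lp_norm p M f = Lp_norm p M g"
  using assms by (intro antisym Lp_norm_mono_AE) (auto elim: eventually_mono)

lemma Lp_norm_cmult_le:
  assumes [measurable]: "g \<in> borel_measurable M" and "0 < p" "0 \<le> c"
  shows "Lp_norm p M (\<lambda>x. ennreal c * g x) \<le> ennreal c * Lp_norm p M g"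
proof (cases "p = \<infinity>")
  case True
  have "AE x in M. ennreal c * g x \<le> ennreal c * esssup M g"
    using esssup_AE[of g M] by (auto elim!: eventually_mono intro: mult_left_mono)
  then show ?thesis using True by (auto simp: Lp_norm_infty intro: esssup_I)
next
  case False
  then have "0 < recip p" using assms by (simp add: recip_pos)
  then show ?thesis using False assms
    by (simp add: Lp_norm_recip epowr_mult nn_integral_cmult epowr_ennreal powr_powr)
qed

lemma Lp_norm_cmult:
  assumes [measurable]: "g \<in> borel_measurable M" and "0 < p" "0 < c"
  shows "Lp_norm p M (\<lambda>x. ennreal c * g x) = ennreal c * Lp_norm p M g"
proof (rule antisym)
  show "Lp_norm p M (\<lambda>x. ennreal c * g x) \<le> ennreal c * Lp_norm p M g"
    using assms by (intro Lp_norm_cmult_le) auto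
  have "Lp_norm p M (\<lambda>x. ennreal (1 / c) * (ennreal c * g x)) \<le> ennreal (1 / c) * Lp_norm p M (\<lambda>x. ennreal c * g x)"
    using assms by (intro Lp_norm_cmult_le) auto
  moreover have "ennreal (1 / c) * (ennreal c * t) = t" for t
    using assms by (simp add: mult.assoc[symmetric] ennreal_mult[symmetric])
  ultimately have "ennreal c * Lp_norm p M g \<le> ennreal c * (ennreal (1 / c) * Lp_norm p M (\<lambda>x. ennreal c * g x))"
    by (intro mult_left_mono) auto
  also have "\<dots> = Lp_norm p M (\<lambda>x. ennreal c * g x)"
    using assms by (simp add: mult.assoc[symmetric] ennreal_mult[symmetric])
  finally show "ennreal c * Lp_norm p M g \<le> Lp_norm p M (\<lambda>x. ennreal c * g x)" .
qed

text \<open>Writing the conjugate exponent as \<open>1 / (1 - recip p)\<close> covers p =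
  \<infinity> as well, where it is 1.\<close>

lemma Lp_norm_Holder:
  assumes [measurable]: "f \<in> borel_measurable M" "g \<in> borel_measurable M" and p: "0 < p" "recip p < 1"
  shows "(\<integral>\<^sup>+x. f x * g x \<partial>M)
    \<le> Lp_norm p M f * epowr (\<integral>\<^sup>+x. epowr (g x) (1 / (1 - recip p)) \<partial>M) (1 - recip p)"
proof (cases "p = \<infinity>")
  case True
  have "(\<integral>\<^sup>+x. f x * g x \<partial>M) \<le> (\<integral>\<^sup>+x. esssup M f * g x \<partial>M)"
    using esssup_AE[of f M] by (intro nn_integral_mono_AE) (auto elim!: eventually_mono intro: mult_right_mono)
  then show ?thesis using True by (simp add: nn_integral_cmult Lp_norm_infty)
next
  case False
  then have i: "0 < recip p" using p by (simp add: recip_pos)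
  have "(\<integral>\<^sup>+x. epowr (epowr (f x) (1 / recip p)) (recip p) * epowr (epowr (g x) (1 / (1 - recip p))) (1 - recip p) \<partial>M)
    \<le> epowr (\<integral>\<^sup>+x. epowr (f x) (1 / recip p) \<partial>M) (recip p)
      * epowr (\<integral>\<^sup>+x. epowr (g x) (1 / (1 - recip p)) \<partial>M) (1 - recip p)"
    using i p by (intro nn_integral_Holder) auto
  then show ?thesis using False i p by (simp add: epowr_epowr Lp_norm_recip)
qed

text \<open>For p = \<infinity>: the essential supremum of a slice exceeds c iff the set where the
  slice exceeds c has positive measure, and by Tonelli that measure depends measurably on the
  slice.\<close>

lemma borel_measurable_Lp_norm_slice:
  fixes h :: "'a::euclidean_space \<times> 'b::euclidean_space \<Rightarrow> ennreal"
  assumes [measurable]: "h \<in> borel_measurable borel" and p: "0 < p"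
  shows "(\<lambda>y. Lp_norm p lborel (\<lambda>w. h (w, y))) \<in> borel_measurable borel"
proof (cases "p = \<infinity>")
  case True
  have "{y. c < esssup lborel (\<lambda>w. h (w, y))} \<in> sets borel" for c
  proof -
    have "c < esssup lborel (\<lambda>w. h (w, y)) \<longleftrightarrow> 0 < (\<integral>\<^sup>+w. of_bool (c < h (w, y)))" for y
    proof
      assume "c < esssup lborel (\<lambda>w. h (w, y))"
      then have "0 < emeasure lborel {w \<in> space lborel. c < h (w, y)}"
        by (rule esssup_pos_measure[rotated]) measurable
      also have "\<dots> = (\<integral>\<^sup>+w. indicator {w. c < h (w, y)} w)"
        by (subst nn_integral_indicator) auto
      also have "\<dots> = (\<integral>\<^sup>+w. of_bool (c < h (w, y)))"
        by (intro nn_integral_cong) auto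
      finally show "0 < (\<integral>\<^sup>+w. of_bool (c < h (w, y)))" .
    next
      assume *: "0 < (\<integral>\<^sup>+w. of_bool (c < h (w, y)))"
      show "c < esssup lborel (\<lambda>w. h (w, y))"
      proof (rule ccontr)
        assume "\<not> c < esssup lborel (\<lambda>w. h (w, y))"
        then have "AE w in lborel. \<not> c < h (w, y)"
          using esssup_AE[of "\<lambda>w. h (w, y)" lborel] by (auto elim!: eventually_mono simp: not_less)
        then have "(\<integral>\<^sup>+w. of_bool (c < h (w, y))) = 0"
          by (subst nn_integral_0_iff_AE) (auto elim: eventually_mono)
        then show False using * by simp
      qed
    qed
    moreover have "{y. 0 < (\<integral>\<^sup>+w. of_bool (c < h (w, y)))} \<in> sets borel" by measurable
    ultimately show ?thesis by simp
  qed
  then show ?thesis using True by (auto simp: Lp_norm_infty intro!: borel_measurableI_greater)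
next
  case False
  then show ?thesis using p unfolding Lp_norm_recip[OF p False] by measurable
qed

text \<open>Integrals are multiplied by c, hence norms by c^(1/p). For p = \<infinity> the same
  formula, applied to indicators of superlevel sets, shows that null sets are preserved, and the
  factor is 1.\<close>

lemma Lp_norm_affine:
  fixes L :: "'a::euclidean_space \<Rightarrow> 'a"
  assumes L: "linear L" "inj L" and p: "0 < p"
  shows "\<exists>K>0. \<forall>g \<in> borel_measurable borel. \<forall>v.
    Lp_norm p lborel (\<lambda>x. g (L x + v)) = ennreal K * Lp_norm p lborel g"
proof -
  have [measurable]: "L \<in> borel_measurable borel"
    using L(1) by (intro borel_measurable_continuous_onI linear_continuous_on) (simp add: linear_linear)
  obtain c where c: "0 < c" and eq: "\<And>f v. f \<in> borel_measurable borel \<Longrightarrow>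
      (\<integral>\<^sup>+x. f (L x + v)) = ennreal c * (\<integral>\<^sup>+x. f x)"
    using nn_integral_lborel_linear[OF L] by blast
  show ?thesis
  proof (cases "p = \<infinity>")
    case True
    have "esssup lborel (\<lambda>x. g (L x + v)) = esssup lborel g"
      if [measurable]: "g \<in> borel_measurable borel" for g :: "'a \<Rightarrow> ennreal" and v
    proof -
      have "(AE x in lborel. g (L x + v) \<le> z) \<longleftrightarrow> (AE x in lborel. g x \<le> z)" for z
      proof -
        have "(AE x in lborel. g (L x + v) \<le> z) \<longleftrightarrow> (\<integral>\<^sup>+x. of_bool (z < g (L x + v))) = 0"
          by (subst nn_integral_0_iff_AE) (auto simp: not_less)
        also have "\<dots> \<longleftrightarrow> (\<integral>\<^sup>+x. of_bool (z < g x)) = 0"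
          using c by (subst eq[where f = "\<lambda>x. of_bool (z < g x)"]) auto
        also have "\<dots> \<longleftrightarrow> (AE x in lborel. g x \<le> z)"
          by (subst nn_integral_0_iff_AE) (auto simp: not_less)
        finally show ?thesis .
      qed
      then show ?thesis by (subst (1 2) esssup_eq_AE) auto
    qed
    then show ?thesis using True by (intro exI[of _ 1]) (simp add: Lp_norm_infty)
  next
    case False
    then have i: "0 < recip p" using p by (simp add: recip_pos)
    show ?thesis
    proof (intro exI[of _ "c powr recip p"] conjI ballI allI)
      fix g :: "'a \<Rightarrow> ennreal" and v
      assume [measurable]: "g \<in> borel_measurable borel"
      have "(\<integral>\<^sup>+x. epowr (g (L x + v)) (1 / recip p)) = ennreal c * (\<integral>\<^sup>+x. epowr (g x) (1 / recip p))"
        by (rule eq[where f = "\<lambda>x. epowr (g x) (1 / recip p)"]) measurable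
      then show "Lp_norm p lborel (\<lambda>x. g (L x + v)) = ennreal (c powr recip p) * Lp_norm p lborel g"
        using c i p False by (simp add: Lp_norm_recip epowr_mult epowr_ennreal)
    qed (use c in simp)
  qed
qed

section \<open>Riesz potentials in mixed norms\<close>

text \<open>By duality: s and t / (t - 1) satisfy the exponent relation of
  \<open>riesz_bilinear_bound\<close>.\<close>

lemma riesz_norm_bound:
  fixes \<alpha> s t :: real
  assumes \<alpha>: "0 < \<alpha>" "\<alpha> < DIM('a::euclidean_space)" and st: "1 < s" "s < t"
    and eq: "1 / s = 1 / t + (1 - \<alpha> / DIM('a))"
  shows "\<exists>C\<ge>0. \<forall>f \<in> borel_measurable borel. (\<integral>\<^sup>+x. epowr (f x) s) \<le> 1 \<longrightarrow>
    (\<integral>\<^sup>+y. epowr (\<integral>\<^sup>+x. f x * riesz_kernel \<alpha> (x::'a) y) t) \<le> ennreal C"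
proof -
  have t: "1 < t / (t - 1)" using st by simp
  have "1 / (t / (t - 1)) = 1 - 1 / t" using st by (simp add: field_simps)
  then have eq': "1 / s + 1 / (t / (t - 1)) + \<alpha> / DIM('a) = 2" using eq by simp
  obtain C where C: "0 \<le> C" and le: "\<And>f h :: 'a \<Rightarrow> ennreal. f \<in> borel_measurable borel \<Longrightarrow> h \<in> borel_measurable borel \<Longrightarrow>
    (\<integral>\<^sup>+x. epowr (f x) s) \<le> 1 \<Longrightarrow> (\<integral>\<^sup>+x. epowr (h x) (t / (t - 1))) \<le> 1 \<Longrightarrow>
    (\<integral>\<^sup>+x. \<integral>\<^sup>+y. f x * riesz_kernel \<alpha> (x::'a) y * h y) \<le> ennreal C"
    using riesz_bilinear_bound[OF \<alpha> st(1) t eq'] by blast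
  show ?thesis
  proof (intro exI[of _ "C powr t"] conjI ballI impI)
    fix f :: "'a \<Rightarrow> ennreal"
    assume [measurable]: "f \<in> borel_measurable borel" and f1: "(\<integral>\<^sup>+x. epowr (f x) s) \<le> 1"
    let ?G = "\<lambda>y. \<integral>\<^sup>+x. f x * riesz_kernel \<alpha> (x::'a) y"
    have "(\<integral>\<^sup>+y. epowr (?G y) t) \<le> epowr (ennreal C) t"
    proof (rule nn_integral_Lq_dual)
      show "?G \<in> borel_measurable lborel" by measurable
      show "1 < t" using st by simp
      fix \<phi> :: "'a \<Rightarrow> ennreal"
      assume "\<phi> \<in> borel_measurable lborel" and \<phi>1: "(\<integral>\<^sup>+x. epowr (\<phi> x) (t / (t - 1))) \<le> 1"
      then have [measurable]: "\<phi> \<in> borel_measurable borel" by simp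
      have "(\<integral>\<^sup>+y. ?G y * \<phi> y)
        = (\<integral>\<^sup>+y. \<integral>\<^sup>+x. f x * riesz_kernel \<alpha> (x::'a) y * \<phi> y)"
        by (intro nn_integral_cong nn_integral_multc[symmetric]) measurable
      also have "\<dots> = (\<integral>\<^sup>+x. \<integral>\<^sup>+y. f x * riesz_kernel \<alpha> (x::'a) y * \<phi> y)"
        by (rule nn_integral_swap) measurable
      also have "\<dots> \<le> ennreal C" using f1 \<phi>1 by (intro le) auto
      finally show "(\<integral>\<^sup>+y. ?G y * \<phi> y) \<le> ennreal C" .
    qed
    then show "(\<integral>\<^sup>+y. epowr (?G y) t) \<le> ennreal (C powr t)"
      using C by (simp add: epowr_ennreal)
  qed simp
qed

lemma mixed_riesz_bound:
  fixes p1 p2 q :: ennreal and lam :: real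
  assumes lam: "0 < lam" "lam < DIM('a::euclidean_space)"
    and p: "1 < p2" "p2 < q" "q < p1"
    and eq: "recip p1 + recip p2 = recip q + (1 - lam / DIM('a))"
  shows "\<exists>C\<ge>0. \<forall>h \<in> borel_measurable borel.
    Lp_norm q lborel (\<lambda>w. \<integral>\<^sup>+y. h (w, y) * riesz_kernel lam (w::'a) y)
      \<le> ennreal C * Lp_norm p2 lborel (\<lambda>y. Lp_norm p1 lborel (\<lambda>w. h (w, y)))"
proof -
  define i1 where "i1 = recip p1"
  define i2 where "i2 = recip p2"
  define iq where "iq = recip q"
  have pos: "0 < p2" "0 < q" "0 < p1"
    by (use p in \<open>auto intro: less_trans zero_less_one\<close>)
  have fin: "p2 \<noteq> \<infinity>" "q \<noteq> \<infinity>" using p by auto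
  have i2: "i2 < 1" using recip_less_iff[of p2 1] p pos by (simp add: i2_def)
  have iq: "0 < iq" "iq < i2" "i1 < iq" using recip_less_iff p pos fin
    by (auto simp: i2_def i1_def iq_def recip_pos)
  have i1: "0 \<le> i1" by (simp add: i1_def)
  \<comment> \<open>With primes for conjugate exponents: \<open>a\<close> = p1', \<open>s\<close> =
    q'/p1', \<open>t\<close> = p2'/p1'.\<close>
  define a where "a = 1 / (1 - i1)"
  have a: "1 \<le> a" using i1 iq i2 by (simp add: a_def)
  define s where "s = (1 - i1) / (1 - iq)"
  define t where "t = (1 - i1) / (1 - i2)"
  have st: "1 < s" "s < t"
    unfolding s_def t_def using i1 iq i2 by (simp, intro divide_strict_left_mono mult_pos_pos) auto
  let ?n = "real DIM('a)"
  have lamn: "lam / ?n = iq - i1 - i2 + 1"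
    using eq by (simp add: i1_def i2_def iq_def)
  have \<alpha>: "0 < lam * a" "lam * a < ?n"
  proof -
    show "0 < lam * a" using lam a by simp
    \<comment> \<open>The kernel raised to the power p1' remains locally integrable because p2 <
      q.\<close>
    have "lam / ?n < 1 - i1" using lamn iq by simp
    then show "lam * a < ?n" using i1 iq i2 by (simp add: a_def field_simps)
  qed
  have "1 / s = 1 / t + (1 - lam * a / ?n)"
  proof -
    have "lam * a / ?n = (iq - i1 - i2 + 1) / (1 - i1)"
      by (simp add: lamn[symmetric] a_def)
    then show ?thesis using i1 iq i2 by (simp add: s_def t_def field_simps)
  qed
  then obtain C where C: "0 \<le> C" and le: "\<And>f. f \<in> borel_measurable borel \<Longrightarrow> (\<integral>\<^sup>+x. epowr (f x) s) \<le> 1 \<Longrightarrow>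
    (\<integral>\<^sup>+y. epowr (\<integral>\<^sup>+x. f x * riesz_kernel (lam * a) (x::'a) y) t) \<le> ennreal C"
    using riesz_norm_bound[OF \<alpha> st] by blast
  show ?thesis
  proof (intro exI[of _ "C powr (1 - i2)"] conjI ballI)
    fix h :: "'a \<times> 'a \<Rightarrow> ennreal"
    assume [measurable]: "h \<in> borel_measurable borel"
    let ?G = "\<lambda>w. \<integral>\<^sup>+y. h (w, y) * riesz_kernel lam (w::'a) y"
    let ?g = "\<lambda>y. Lp_norm p1 lborel (\<lambda>w. h (w, y))"
    let ?K = "ennreal (C powr (1 - i2)) * Lp_norm p2 lborel ?g"
    have [measurable]: "?g \<in> borel_measurable borel"
      using pos by (intro borel_measurable_Lp_norm_slice) auto
    have "(\<integral>\<^sup>+w. epowr (?G w) (1 / iq)) \<le> epowr ?K (1 / iq)"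
    proof (rule nn_integral_Lq_dual)
      show "?G \<in> borel_measurable lborel" by measurable
      show "1 < 1 / iq" using iq i2 by simp
      fix \<phi> :: "'a \<Rightarrow> ennreal"
      assume "\<phi> \<in> borel_measurable lborel" and \<phi>1: "(\<integral>\<^sup>+x. epowr (\<phi> x) (1 / iq / (1 / iq - 1))) \<le> 1"
      then have [measurable]: "\<phi> \<in> borel_measurable borel" by simp
      define I where "I y = (\<integral>\<^sup>+w. epowr (\<phi> w) a * riesz_kernel (lam * a) (w::'a) y)" for y
      have [measurable]: "I \<in> borel_measurable borel" unfolding I_def by measurable
      \<comment> \<open>Both sides are q', so the normalisation of \<phi> says that \<phi>^a lies in
        the unit ball of \<open>L^s\<close>.\<close>
      have "a * s = 1 / iq / (1 / iq - 1)"
        using i1 iq i2 by (simp add: a_def s_def field_simps)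
      then have I_t: "(\<integral>\<^sup>+y. epowr (I y) t) \<le> ennreal C"
        unfolding I_def using \<phi>1 by (intro le) (auto simp: epowr_epowr)
      have "(\<integral>\<^sup>+w. ?G w * \<phi> w)
        = (\<integral>\<^sup>+w. \<integral>\<^sup>+y. h (w, y) * (\<phi> w * riesz_kernel lam (w::'a) y))"
        by (subst nn_integral_multc[symmetric]) (auto simp: ac_simps)
      also have "\<dots> = (\<integral>\<^sup>+y. \<integral>\<^sup>+w. h (w, y) * (\<phi> w * riesz_kernel lam (w::'a) y))"
        by (rule nn_integral_swap) measurable
      also have "\<dots> \<le> (\<integral>\<^sup>+y. ?g y * epowr (I y) (1 - i1))"
      proof (intro nn_integral_mono)
        fix y
        have "(\<integral>\<^sup>+w. h (w, y) * (\<phi> w * riesz_kernel lam (w::'a) y))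
          \<le> ?g y * epowr (\<integral>\<^sup>+w. epowr (\<phi> w * riesz_kernel lam w y) (1 / (1 - recip p1))) (1 - recip p1)"
          using pos iq i2 by (intro Lp_norm_Holder) (auto simp: i1_def)
        also have "(\<lambda>w. epowr (\<phi> w * riesz_kernel lam w y) (1 / (1 - recip p1)))
          = (\<lambda>w. epowr (\<phi> w) a * riesz_kernel (lam * a) (w::'a) y)"
          unfolding i1_def[symmetric] a_def[symmetric] using a
          by (simp add: epowr_mult epowr_ennreal powr_powr riesz_kernel_def)
        finally show "(\<integral>\<^sup>+w. h (w, y) * (\<phi> w * riesz_kernel lam (w::'a) y))
          \<le> ?g y * epowr (I y) (1 - i1)" by (simp add: I_def i1_def)
      qed
      also have "\<dots> \<le> Lp_norm p2 lborel ?g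
          * epowr (\<integral>\<^sup>+y. epowr (epowr (I y) (1 - i1)) (1 / (1 - recip p2))) (1 - recip p2)"
        using pos i2 by (intro Lp_norm_Holder) (auto simp: i2_def)
      also have "\<dots> = Lp_norm p2 lborel ?g * epowr (\<integral>\<^sup>+y. epowr (I y) t) (1 - i2)"
        by (simp add: epowr_epowr i2_def[symmetric] t_def)
      also have "\<dots> \<le> Lp_norm p2 lborel ?g * epowr (ennreal C) (1 - i2)"
        using I_t i2 by (intro mult_left_mono epowr_mono) auto
      also have "\<dots> = ?K" using C by (simp add: epowr_ennreal mult.commute)
      finally show "(\<integral>\<^sup>+w. ?G w * \<phi> w) \<le> ?K" .
    qed
    then have "epowr (\<integral>\<^sup>+w. epowr (?G w) (1 / iq)) iq \<le> ?K"
      using iq by (subst epowr_le_iff) auto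
    then show "Lp_norm q lborel ?G \<le> ?K"
      using pos fin by (simp add: Lp_norm_recip iq_def)
  qed simp
qed

section \<open>Reduction to nonnegative functions\<close>

definition block_map ::
    "real^'n^'n \<Rightarrow> real^'n^'n \<Rightarrow> real^'n^'n \<Rightarrow> real^'n^'n \<Rightarrow>
     (real^'n) \<times> (real^'n) \<Rightarrow> (real^'n) \<times> (real^'n)" where
  "block_map A11 A12 A21 A22 z =
     (A11 *v fst z + A12 *v snd z, A21 *v fst z + A22 *v snd z)"

lemma linear_block_map: "linear (block_map A11 A12 A21 A22)"
  by (rule linearI)
    (simp_all add: block_map_def matrix_vector_right_distrib matrix_vector_mult_scaleR scaleR_right_distrib add_ac)

lemma
  fixes A11 A12 A21 A22 :: "real^'n^'n" and w :: "real^('n + 'n)"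
  shows block_matrix_mult_Inl: "(block_matrix A11 A12 A21 A22 *v w) $ Inl k =
    (A11 *v (\<chi> l. w $ Inl l) + A12 *v (\<chi> l. w $ Inr l)) $ k"
  and block_matrix_mult_Inr:
  "(block_matrix A11 A12 A21 A22 *v w) $ Inr k =
    (A21 *v (\<chi> l. w $ Inl l) + A22 *v (\<chi> l. w $ Inr l)) $ k"
proof -
  have split: "sum f UNIV = (\<Sum>l\<in>UNIV. f (Inl l)) + (\<Sum>l\<in>UNIV. f (Inr l))" for f :: "'n + 'n \<Rightarrow> real"
    unfolding UNIV_Plus_UNIV[symmetric] by (subst sum.Plus) auto
  show "(block_matrix A11 A12 A21 A22 *v w) $ Inl k =
      (A11 *v (\<chi> l. w $ Inl l) + A12 *v (\<chi> l. w $ Inr l)) $ k"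
    and "(block_matrix A11 A12 A21 A22 *v w) $ Inr k =
      (A21 *v (\<chi> l. w $ Inl l) + A22 *v (\<chi> l. w $ Inr l)) $ k"
    by (simp_all add: matrix_vector_mult_def split) (simp_all add: block_matrix_def)
qed

text \<open>The matrix acts on vectors indexed by a sum type, the operator on pairs; the bijection
  \<open>J\<close> between the two conjugates one map into the other.\<close>

lemma invertible_block_matrix_iff:
  fixes A11 A12 A21 A22 :: "real^'n^'n"
  shows "invertible (block_matrix A11 A12 A21 A22) \<longleftrightarrow> inj (block_map A11 A12 A21 A22)"
proof -
  let ?M = "block_matrix A11 A12 A21 A22" and ?L = "block_map A11 A12 A21 A22"
  define J where "J w = ((\<chi> l. w $ Inl l), (\<chi> l. w $ Inr l))" for w :: "real^('n + 'n)"
  define J' where "J' z = (\<chi> i. case i of Inl k \<Rightarrow> fst z $ k | Inr k \<Rightarrow> snd z $ k)"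
    for z :: "(real^'n) \<times> (real^'n)"
  have JJ': "J (J' z) = z" for z by (simp add: J_def J'_def)
  have J'J: "J' (J w) = w" for w
    by (auto simp: J_def J'_def vec_eq_iff split: sum.split)
  have J_M: "J (?M *v w) = ?L (J w)" for w
    by (simp add: J_def block_map_def block_matrix_mult_Inl block_matrix_mult_Inr vec_eq_iff)
  have "?M *v w = J' (?L (J w))" for w
    using J'J[of "?M *v w"] by (simp add: J_M)
  then have eq: "(*v) ?M = J' \<circ> ?L \<circ> J"
    by (simp add: fun_eq_iff)
  have eq2: "?L = J \<circ> (*v) ?M \<circ> J'"
    by (simp add: fun_eq_iff J_M JJ')
  have "inj J" by (rule inj_on_inverseI[of _ J']) (rule J'J)
  moreover have "inj J'" by (rule inj_on_inverseI[of _ J]) (rule JJ')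
  ultimately have "inj ((*v) ?M) \<longleftrightarrow> inj ?L"
    using inj_compose[of J "(*v) ?M"] inj_compose[of "J \<circ> (*v) ?M" J']
      inj_compose[of J' "?L"] inj_compose[of "J' \<circ> ?L" J]
    unfolding eq[symmetric] eq2[symmetric] by blast
  then show ?thesis
    by (simp add: invertible_left_inverse matrix_left_invertible_injective)
qed

lemma invertible_iff_inj: "invertible (M :: real^'n^'n) \<longleftrightarrow> inj ((*v) M)"
  by (simp add: invertible_left_inverse matrix_left_invertible_injective)

lemma borel_measurable_matrix_mult [measurable]:
  "(\<lambda>x. (M :: real^'n^'m) *v x) \<in> borel_measurable borel"
  by (intro borel_measurable_continuous_onI linear_continuous_on)
    (simp add: linear_linear matrix_vector_mul_linear)

lemma borel_measurable_block_map [measurable]: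
  "block_map A11 A12 A21 A22 \<in> borel_measurable borel"
  by (intro borel_measurable_continuous_onI linear_continuous_on)
    (simp add: linear_linear linear_block_map)

text \<open>At \<open>x\<^sub>1 = 0\<close> both \<open>0 powr - lam\<close> and the division by zero in the integrand of the operator
give \<open>0\<close>.\<close>

definition pos_T ::
    "real \<Rightarrow> real^'n^'n \<Rightarrow> real^'n^'n \<Rightarrow> real^'n^'n \<Rightarrow> real^'n^'n \<Rightarrow>
     ((real^'n) \<times> (real^'n) \<Rightarrow> real) \<Rightarrow> real^'n \<Rightarrow> ennreal" where
  "pos_T lam A11 A12 A21 A22 F x2 =
     (\<integral>\<^sup>+x1. ennreal (F (block_map A11 A12 A21 A22 (x1, x2)) * norm x1 powr - lam))"

definition pos_mixed_norm ::
    "ennreal \<Rightarrow> ennreal \<Rightarrow> ((real^'n) \<times> (real^'n) \<Rightarrow> real) \<Rightarrow> ennreal" where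
  "pos_mixed_norm p1 p2 F =
     Lp_norm p2 lborel (\<lambda>x2. Lp_norm p1 lborel (\<lambda>x1. ennreal (F (x1, x2))))"

text \<open>An inequality in [0,\<infinity>] over nonnegative Borel functions: every slice is
  measurable and every integral exists, so the existence clauses of \<open>T_bounded\<close> are
  absorbed into the value \<infinity>.\<close>

definition pos_bounded ::
    "ennreal \<Rightarrow> ennreal \<Rightarrow> ennreal \<Rightarrow> real \<Rightarrow>
     real^'n^'n \<Rightarrow> real^'n^'n \<Rightarrow> real^'n^'n \<Rightarrow> real^'n^'n \<Rightarrow> bool" where
  "pos_bounded p1 p2 q lam A11 A12 A21 A22 \<longleftrightarrow>
     (\<exists>C>0. \<forall>F \<in> borel_measurable borel. (\<forall>z. 0 \<le> F z) \<longrightarrow>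
        Lp_norm q lborel (pos_T lam A11 A12 A21 A22 F) \<le> ennreal C * pos_mixed_norm p1 p2 F)"

lemma borel_measurable_pos_T [measurable]:
  assumes [measurable]: "F \<in> borel_measurable borel"
  shows "pos_T lam A11 A12 A21 A22 F \<in> borel_measurable borel"
  unfolding pos_T_def[abs_def] by measurable

lemma mixed_norm_eq_pos_mixed_norm:
  assumes [measurable]: "f \<in> borel_measurable borel" and "0 < p1" "0 < p2"
  shows "mixed_norm p1 p2 f = pos_mixed_norm p1 p2 (\<lambda>z. norm (f z))"
proof -
  have "Lp_norm p1 lebesgue (\<lambda>x1. ennreal (norm (f (x1, x2)))) = Lp_norm p1 lborel (\<lambda>x1. ennreal (norm (f (x1, x2))))" for x2
    using assms by (intro Lp_norm_lebesgue) auto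
  then show ?thesis
    unfolding mixed_norm_def pos_mixed_norm_def
    using assms by (simp, intro Lp_norm_lebesgue borel_measurable_Lp_norm_slice[where h = "\<lambda>z. ennreal (norm (f z))"]) auto
qed

lemma norm_T_integrand:
  "norm (T_integrand lam A11 A12 A21 A22 f x2 x1)
    = norm (f (block_map A11 A12 A21 A22 (x1, x2))) * norm x1 powr - lam"
  by (simp add: T_integrand_def block_map_def norm_mult norm_inverse powr_minus divide_inverse)

lemma pos_bounded_if_T_bounded:
  fixes A11 A12 A21 A22 :: "real^'n^'n"
  assumes "T_bounded p1 p2 q lam A11 A12 A21 A22" and p: "0 < p1" "0 < p2" "0 < q"
  shows "pos_bounded p1 p2 q lam A11 A12 A21 A22"
proof -
  let ?I = "T_integrand lam A11 A12 A21 A22"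
  let ?O = "T_op lam A11 A12 A21 A22"
  let ?T = "pos_T lam A11 A12 A21 A22"
  obtain C where C: "0 \<le> C" and bd: "\<And>f. f \<in> mixed_Lp p1 p2 \<Longrightarrow>
        (AE x2 in lebesgue. integrable lebesgue (?I f x2)) \<and>
        ?O f \<in> borel_measurable lebesgue \<and>
        Lp_norm q lebesgue (\<lambda>x2. ennreal (norm (?O f x2)))
          \<le> ennreal C * mixed_norm p1 p2 f"
    using assms(1) unfolding T_bounded_def by blast
  show ?thesis
    unfolding pos_bounded_def
  \<comment> \<open>A strictly positive constant makes the right-hand side infinite whenever the
    mixed norm is.\<close>
  proof (intro exI[of _ "C + 1"] conjI ballI impI)
    show "0 < C + 1" using C by simp
    fix F :: "(real^'n) \<times> (real^'n) \<Rightarrow> real"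
    assume [measurable]: "F \<in> borel_measurable borel" and F0: "\<forall>z. 0 \<le> F z"
    have F0': "0 \<le> F z" for z using F0 by blast
    let ?f = "\<lambda>z. complex_of_real (F z)"
    have mn: "mixed_norm p1 p2 ?f = pos_mixed_norm p1 p2 F"
    proof -
      have "(\<lambda>z. norm (?f z)) = F" using F0 by (simp add: fun_eq_iff abs_of_nonneg)
      then show ?thesis using p by (subst mixed_norm_eq_pos_mixed_norm) auto
    qed
    show "Lp_norm q lborel (?T F) \<le> ennreal (C + 1) * pos_mixed_norm p1 p2 F"
    proof (cases "pos_mixed_norm p1 p2 F = top")
      case True
      then show ?thesis using C by (simp add: ennreal_mult_top)
    next
      case False
      have "?f \<in> borel_measurable lebesgue"
        by (intro measurable_completion) simp
      then have "?f \<in> mixed_Lp p1 p2"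
        using False mn by (simp add: mixed_Lp_def less_top)
      note b = bd[OF this]
      have "AE x2 in lebesgue. ?T F x2 = ennreal (norm (?O ?f x2))"
        using conjunct1[OF b]
      proof eventually_elim
        case (elim x2)
        let ?r = "\<lambda>x1. F (block_map A11 A12 A21 A22 (x1, x2)) * norm x1 powr - lam"
        have eq: "?I ?f x2 = (\<lambda>x1. complex_of_real (?r x1))"
          by (simp add: T_integrand_def block_map_def powr_minus divide_inverse fun_eq_iff)
        have int: "integrable lebesgue ?r"
          using elim unfolding eq complex_of_real_integrable_eq .
        have "?O ?f x2 = complex_of_real (integral\<^sup>L lebesgue ?r)"
          unfolding T_op_def eq by (rule integral_complex_of_real)
        moreover have "ennreal (integral\<^sup>L lebesgue ?r) = (\<integral>\<^sup>+x1. ennreal (?r x1) \<partial>lebesgue)"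
          using int by (intro nn_integral_eq_integral[symmetric]) (auto simp: F0')
        moreover have "0 \<le> integral\<^sup>L lebesgue ?r"
          by (intro integral_nonneg_AE) (auto simp: F0')
        ultimately show ?case
          by (simp add: pos_T_def nn_integral_completion)
      qed
      moreover have "?T F \<in> borel_measurable lebesgue"
        by (intro measurable_completion) simp
      moreover have [measurable]: "?O ?f \<in> borel_measurable lebesgue"
        using b by blast
      ultimately have "Lp_norm q lebesgue (?T F)
          = Lp_norm q lebesgue (\<lambda>x2. ennreal (norm (?O ?f x2)))"
        using p by (intro Lp_norm_cong_AE) auto
      also have "\<dots> \<le> ennreal C * pos_mixed_norm p1 p2 F" using b mn by simp
      also have "\<dots> \<le> ennreal (C + 1) * pos_mixed_norm p1 p2 F"
        by (intro mult_right_mono ennreal_leI) auto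
      finally show ?thesis using p by (simp add: Lp_norm_lebesgue)
    qed
  qed
qed

section \<open>Null sets and the passage from Lebesgue to Borel functions\<close>

lemma AE_slices:
  fixes P :: "'a::euclidean_space \<times> 'b::euclidean_space \<Rightarrow> bool"
  assumes "AE z in lborel. P z"
  shows "AE y in lborel. AE x in lborel. P (x, y)"
proof -
  obtain N where N: "N \<in> null_sets lborel" "{z. \<not> P z} \<subseteq> N"
    using assms unfolding eventually_ae_filter by auto
  have [measurable]: "N \<in> sets borel" using N(1) by auto
  have "(\<integral>\<^sup>+y. \<integral>\<^sup>+x. indicator N (x, y)) = (\<integral>\<^sup>+z. indicator N z \<partial>(lborel \<Otimes>\<^sub>M lborel))"
    by (rule lborel_pair.nn_integral_snd) (simp add: lborel_prod)
  also have "\<dots> = 0" using N(1) by (simp add: lborel_prod null_sets_def)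
  finally have "AE y in lborel. (\<integral>\<^sup>+x. indicator N (x, y)) = 0"
    by (subst (asm) nn_integral_0_iff_AE) auto
  then show ?thesis
  proof eventually_elim
    case (elim y)
    then have "AE x in lborel. indicator N (x, y) = (0::ennreal)"
      by (subst (asm) nn_integral_0_iff_AE) auto
    then show ?case
      by eventually_elim (use N(2) in \<open>auto simp: indicator_def split: if_splits\<close>)
  qed
qed

text \<open>Permits changing \<open>f\<close> on a null set inside the operator, which samples
  \<open>f\<close> only on the range of the block map; for a singular map that range would itself be
  null.\<close>

lemma AE_lborel_linear:
  fixes L :: "'a::euclidean_space \<Rightarrow> 'a"
  assumes L: "linear L" "inj L" and "AE z in lborel. P z"
  shows "AE z in lborel. P (L z)"
proof -
  obtain N where N: "N \<in> null_sets lborel" "{z. \<not> P z} \<subseteq> N"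
    using assms(3) unfolding eventually_ae_filter by auto
  have [measurable]: "N \<in> sets borel" using N(1) by auto
  have [measurable]: "L \<in> borel_measurable borel"
    using L(1) by (intro borel_measurable_continuous_onI linear_continuous_on) (simp add: linear_linear)
  obtain c where eq: "\<And>f v. f \<in> borel_measurable borel \<Longrightarrow>
      (\<integral>\<^sup>+x. f (L x + v)) = ennreal c * (\<integral>\<^sup>+x. f x)"
    using nn_integral_lborel_linear[OF L] by blast
  have "(\<integral>\<^sup>+z. indicator N (L z)) = 0"
    using eq[of "indicator N" 0] N(1) by (simp add: null_sets_def)
  then have "AE z in lborel. indicator N (L z) = (0::ennreal)"
    by (subst (asm) nn_integral_0_iff_AE) auto
  then show ?thesis
    by eventually_elim (use N(2) in \<open>auto simp: indicator_def split: if_splits\<close>)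
qed

lemma lebesgue_ex_borel_complex:
  fixes f :: "'a::euclidean_space \<Rightarrow> complex"
  assumes [measurable]: "f \<in> borel_measurable lebesgue"
  shows "\<exists>g \<in> borel_measurable borel. AE z in lborel. f z = g z"
proof -
  have "(\<lambda>z. Re (f z)) \<in> borel_measurable lebesgue" "(\<lambda>z. Im (f z)) \<in> borel_measurable lebesgue"
    by measurable
  note * = this
  obtain g1 where [measurable]: "g1 \<in> borel_measurable lborel" and eq1: "AE z in lborel. Re (f z) = g1 z"
    using completion_ex_borel_measurable_real[OF *(1)] by blast
  obtain g2 where [measurable]: "g2 \<in> borel_measurable lborel" and eq2: "AE z in lborel. Im (f z) = g2 z"
    using completion_ex_borel_measurable_real[OF *(2)] by blast
  show ?thesis
  proof
    show "(\<lambda>z. Complex (g1 z) (g2 z)) \<in> borel_measurable borel"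
      unfolding borel_measurable_complex_iff by simp
    show "AE z in lborel. f z = Complex (g1 z) (g2 z)"
      using eq1 eq2 by eventually_elim (simp add: complex_eq_iff)
  qed
qed

lemma measurable_lebesgue_cong_AE:
  fixes f g :: "'a::euclidean_space \<Rightarrow> 'b::topological_space"
  assumes "g \<in> borel_measurable lebesgue" "AE x in lebesgue. f x = g x"
  shows "f \<in> borel_measurable lebesgue"
proof (rule measurableI)
  fix S :: "'b set" assume S: "S \<in> sets borel"
  have A: "g -` S \<in> sets lebesgue" using measurable_sets[OF assms(1) S] by simp
  have "AE x in lebesgue. x \<in> g -` S \<longleftrightarrow> x \<in> f -` S"
    using assms(2) by eventually_elim auto
  then have "f -` S \<in> sets lebesgue"
    by (rule completion.in_sets_AE[OF _ A]) simp
  then show "f -` S \<inter> space lebesgue \<in> sets lebesgue" by simp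
qed simp

text \<open>The positive bound, applied to the absolute value of a Borel representative, gives both
  the almost everywhere existence of the integral and the norm estimate.\<close>

lemma T_bounded_if_pos_bounded:
  fixes A11 A12 A21 A22 :: "real^'n^'n"
  assumes pb: "pos_bounded p1 p2 q lam A11 A12 A21 A22" and p: "0 < p1" "0 < p2" "0 < q" "q \<noteq> \<infinity>"
    and inj: "inj (block_map A11 A12 A21 A22)"
  shows "T_bounded p1 p2 q lam A11 A12 A21 A22"
proof -
  obtain C where C: "0 < C" and bd: "\<And>F. F \<in> borel_measurable borel \<Longrightarrow> (\<forall>z. 0 \<le> F z) \<Longrightarrow>
      Lp_norm q lborel (pos_T lam A11 A12 A21 A22 F) \<le> ennreal C * pos_mixed_norm p1 p2 F"
    using pb unfolding pos_bounded_def by blast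
  let ?T = "T_op lam A11 A12 A21 A22" and ?I = "T_integrand lam A11 A12 A21 A22"
  let ?m = "\<lambda>f x2. Lp_norm p1 lebesgue (\<lambda>x1. ennreal (norm (f (x1, x2) :: complex)))"
  have "(AE x2 in lebesgue. integrable lebesgue (?I f x2)) \<and> ?T f \<in> borel_measurable lebesgue \<and>
        Lp_norm q lebesgue (\<lambda>x2. ennreal (norm (?T f x2))) \<le> ennreal C * mixed_norm p1 p2 f"
    if f: "f \<in> mixed_Lp p1 p2" for f
  proof -
    have f_meas: "f \<in> borel_measurable lebesgue" and f_fin: "mixed_norm p1 p2 f < \<infinity>"
      using f by (auto simp: mixed_Lp_def)
    obtain g where [measurable]: "g \<in> borel_measurable borel" and fg: "AE z in lborel. f z = g z"
      using lebesgue_ex_borel_complex[OF f_meas] by blast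
    let ?F = "\<lambda>z. norm (g z)"
    have inner_AE: "AE x2 in lborel.
      ?m f x2 = ?m g x2"
      using AE_slices[OF fg]
    proof eventually_elim
      case (elim x2)
      then have *: "AE x1 in lebesgue. ennreal (norm (f (x1, x2))) = ennreal (norm (g (x1, x2)))"
        by (subst AE_completion_iff) (auto elim: eventually_mono)
      have m: "(\<lambda>x1. ennreal (norm (g (x1, x2)))) \<in> borel_measurable lebesgue"
        by (intro measurable_completion) simp
      show ?case
        using * p by (intro Lp_norm_cong_AE measurable_lebesgue_cong_AE[OF m *] m) auto
    qed
    have m: "?m g \<in> borel_measurable lebesgue"
    proof -
      let ?n = "\<lambda>x2. Lp_norm p1 lborel (\<lambda>x1. ennreal (norm (g (x1, x2))))"
      have "?n \<in> borel_measurable borel"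
        using p by (intro borel_measurable_Lp_norm_slice[where h = "\<lambda>z. ennreal (norm (g z))"]) auto
      then have "?n \<in> borel_measurable lebesgue"
        by (intro measurable_completion) simp
      then show ?thesis using p by (subst Lp_norm_lebesgue) auto
    qed
    have inner_AE': "AE x2 in lebesgue.
      ?m f x2 = ?m g x2"
      using inner_AE by (subst AE_completion_iff)
    have mn: "mixed_norm p1 p2 f = pos_mixed_norm p1 p2 ?F"
    proof -
      have "mixed_norm p1 p2 f = mixed_norm p1 p2 g"
        unfolding mixed_norm_def
        using inner_AE' p by (intro Lp_norm_cong_AE measurable_lebesgue_cong_AE[OF m inner_AE'] m) auto
      then show ?thesis using p by (simp add: mixed_norm_eq_pos_mixed_norm)
    qed
    let ?N = "pos_T lam A11 A12 A21 A22 ?F"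
    have N_le: "Lp_norm q lborel ?N \<le> ennreal C * mixed_norm p1 p2 f"
      unfolding mn by (rule bd) auto
    also have "\<dots> < top" using f_fin by (simp add: ennreal_mult_less_top)
    \<comment> \<open>As q is finite, a finite norm forces the positive integral to be finite almost
      everywhere, which is absolute convergence of the defining integral.\<close>
    finally have "(\<integral>\<^sup>+x2. epowr (?N x2) (1 / recip q)) < top"
      using p by (simp add: Lp_norm_recip)
    then have "AE x2 in lborel. epowr (?N x2) (1 / recip q) \<noteq> \<infinity>"
      by (intro nn_integral_PInf_AE) (auto simp: less_top)
    then have N_fin: "AE x2 in lborel. ?N x2 < top"
      by eventually_elim (simp add: less_top)
    have I_meas: "?I g x2 \<in> borel_measurable lborel" for x2
      unfolding T_integrand_def[abs_def] by measurable
    have I_int: "integrable lborel (?I g x2)" if "?N x2 < top" for x2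
      using that I_meas by (intro integrableI_bounded) (simp_all add: norm_T_integrand pos_T_def)
    have "AE z in lborel. f (block_map A11 A12 A21 A22 z) = g (block_map A11 A12 A21 A22 z)"
      by (rule AE_lborel_linear[OF linear_block_map inj fg])
    note slice_eq = AE_slices[OF this]
    have main: "AE x2 in lborel. integrable lebesgue (?I f x2) \<and> ?T f x2 = ?T g x2"
      using slice_eq N_fin
    proof eventually_elim
      case (elim x2)
      have eq: "AE x1 in lebesgue. ?I f x2 x1 = ?I g x2 x1"
        using elim(1) by (subst AE_completion_iff) (auto simp: T_integrand_def block_map_def elim: eventually_mono)
      have mg: "?I g x2 \<in> borel_measurable lebesgue" using I_meas by (intro measurable_completion)
      note mf = measurable_lebesgue_cong_AE[OF mg eq]
      have "integrable lebesgue (?I g x2)"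
        using I_int[OF elim(2)] I_meas by (subst integrable_completion) auto
      then show ?case
        using eq mf mg unfolding T_op_def
        by (auto intro: integral_cong_AE simp: integrable_cong_AE[OF mf mg eq])
    qed
    then have main': "AE x2 in lebesgue. integrable lebesgue (?I f x2) \<and> ?T f x2 = ?T g x2"
      by (subst AE_completion_iff)
    have Tg: "?T g x2 = (\<integral>x1. ?I g x2 x1 \<partial>lborel)" for x2
      unfolding T_op_def using I_meas by (intro integral_completion)
    have [measurable]: "?T g \<in> borel_measurable borel"
      unfolding Tg[abs_def] T_integrand_def[abs_def] by measurable
    then have Tg_leb: "?T g \<in> borel_measurable lebesgue"
      by (intro measurable_completion) simp
    have Tf: "?T f \<in> borel_measurable lebesgue"
      using main' by (intro measurable_lebesgue_cong_AE[OF Tg_leb]) (auto elim: eventually_mono)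
    have "Lp_norm q lebesgue (\<lambda>x2. ennreal (norm (?T f x2))) = Lp_norm q lebesgue (\<lambda>x2. ennreal (norm (?T g x2)))"
      using main' Tf Tg_leb p by (intro Lp_norm_cong_AE) (auto elim: eventually_mono)
    also have "\<dots> = Lp_norm q lborel (\<lambda>x2. ennreal (norm (?T g x2)))"
      using p by (intro Lp_norm_lebesgue) auto
    also have "\<dots> \<le> Lp_norm q lborel ?N"
    proof (rule Lp_norm_mono)
      fix x2
      show "ennreal (norm (?T g x2)) \<le> ?N x2"
      proof (cases "integrable lborel (?I g x2)")
        case True
        then show ?thesis
          using integral_norm_bound_ennreal[OF True] by (simp add: Tg pos_T_def norm_T_integrand)
      next
        case False
        then show ?thesis by (simp add: Tg not_integrable_integral_eq)
      qed
    qed (use p in auto)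
    also note N_le
    finally show ?thesis using main' Tf by (auto elim: eventually_mono)
  qed
  then show ?thesis unfolding T_bounded_def using C by (intro exI[of _ C]) auto
qed

lemma pos_bounded_sufficient:
  fixes A11 A12 A21 A22 :: "real^'n^'n" and lam :: real
  assumes lam: "0 < lam" "lam < CARD('n)"
    and p: "1 < p2" "p2 < q" "q < p1"
    and eq: "recip p1 + recip p2 = recip q + (1 - lam / CARD('n))"
    and inj: "inj (block_map A11 A12 A21 A22)" and A21: "invertible A21" and A22: "invertible A22"
  shows "pos_bounded p1 p2 q lam A11 A12 A21 A22"
proof -
  let ?L = "block_map A11 A12 A21 A22"
  let ?T = "pos_T lam A11 A12 A21 A22"
  have pos: "0 < p2" "0 < q" "0 < p1"
    by (use p in \<open>auto intro: less_trans zero_less_one\<close>)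
  obtain C where C: "0 \<le> C" and bd: "\<And>h. h \<in> borel_measurable borel \<Longrightarrow>
    Lp_norm q lborel (\<lambda>w. \<integral>\<^sup>+y. h (w, y) * riesz_kernel lam (w::real^'n) y)
      \<le> ennreal C * Lp_norm p2 lborel (\<lambda>y. Lp_norm p1 lborel (\<lambda>w. h (w, y)))"
    using mixed_riesz_bound[where 'a = "real^'n", of lam p2 q p1] lam p eq by auto
  obtain A21' where A21': "A21 ** A21' = mat 1" "A21' ** A21 = mat 1"
    using A21 unfolding invertible_def by blast
  \<comment> \<open>After x1 = E (y - x2) the arguments of \<open>F\<close> are B x2 + A11 E y and
    A22 y. The second is free of x2, and \<open>B\<close>, the Schur complement of A21, is the
    coefficient of x2 in the first.\<close>
  define E where "E = A21' ** A22"
  define B where "B = A12 - A11 ** E"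
  have A21E: "A21 *v (E *v x) = A22 *v x" for x
    by (simp add: E_def matrix_vector_mul_assoc matrix_mul_assoc A21')
  have E_inj: "inj ((*v) E)"
  proof (rule injI)
    fix x y assume "E *v x = E *v y"
    then have "A22 *v x = A22 *v y" by (metis A21E)
    then show "x = y" using A22 by (simp add: invertible_iff_inj inj_eq)
  qed
  have B_eq: "B *v x = A12 *v x - A11 *v (E *v x)" for x
    by (simp add: B_def matrix_vector_mult_diff_rdistrib matrix_vector_mul_assoc)
  have B_inj: "inj ((*v) B)"
  proof -
    have "x = 0" if "B *v x = 0" for x
    proof -
      \<comment> \<open>In general this vector is sent to (B x, 0), so \<open>B\<close> inherits
        injectivity from the block map.\<close>
      have "?L (- (E *v x), x) = 0"
        using that B_eq[of x]
        by (simp add: block_map_def A21E linear_neg[OF matrix_vector_mul_linear] zero_prod_def)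
      also have "0 = ?L 0" by (simp add: block_map_def zero_prod_def)
      finally show ?thesis using inj by (auto simp: inj_eq zero_prod_def)
    qed
    then show ?thesis
      using linear_injective_0[OF matrix_vector_mul_linear[of B]] by auto
  qed
  have linE: "linear ((*v) E)" and linB: "linear ((*v) B)" and lin22: "linear ((*v) A22)"
    by (rule matrix_vector_mul_linear)+
  obtain c where c: "0 < c" and ceq: "\<And>f v. f \<in> borel_measurable borel \<Longrightarrow>
      (\<integral>\<^sup>+x. f (E *v x + v)) = ennreal c * (\<integral>\<^sup>+x. f x)"
    using nn_integral_lborel_linear[OF linE E_inj] by blast
  obtain e where e: "0 < e" "\<And>x. e * norm x \<le> norm (E *v x)"
    using linear_inj_bounded_below_pos[OF linE E_inj] by metis
  obtain K1 where K1: "0 < K1" and K1_eq: "\<And>g v. g \<in> borel_measurable borel \<Longrightarrow>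
      Lp_norm p1 lborel (\<lambda>x. g (B *v x + v)) = ennreal K1 * Lp_norm p1 lborel g"
    using Lp_norm_affine[OF linB B_inj pos(3)] by blast
  have A22_inj: "inj ((*v) A22)" using A22 by (simp add: invertible_iff_inj)
  obtain K2 where K2: "0 < K2" and K2_eq: "\<And>g v. g \<in> borel_measurable borel \<Longrightarrow>
      Lp_norm p2 lborel (\<lambda>x. g (A22 *v x + v)) = ennreal K2 * Lp_norm p2 lborel g"
    using Lp_norm_affine[OF lin22 A22_inj pos(1)] by blast
  \<comment> \<open>The factor \<open>1 / c\<close> comes from the change of variables,
    \<open>e powr - lam\<close> from comparing |E (y - x2)| with |y - x2|.\<close>
  define D where "D = e powr - lam / c"
  have D: "0 < D" using c e by (simp add: D_def)
  show ?thesis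
    unfolding pos_bounded_def
  proof (intro exI[of _ "D * (C + 1) * K1 * K2"] conjI ballI impI)
    show "0 < D * (C + 1) * K1 * K2" using D C K1 K2 by simp
    fix F :: "(real^'n) \<times> (real^'n) \<Rightarrow> real"
    assume [measurable]: "F \<in> borel_measurable borel" and F0: "\<forall>z. 0 \<le> F z"
    have F0': "0 \<le> F z" for z using F0 by blast
    define h where "h z = ennreal (F (B *v fst z + A11 *v (E *v snd z), A22 *v snd z))" for z
    have "(\<lambda>z. (B *v fst z + A11 *v (E *v snd z), A22 *v snd z)) \<in> borel_measurable (borel :: ((real^'n) \<times> (real^'n)) measure)"
      unfolding borel_prod[symmetric] by measurable
    then have [measurable]: "h \<in> borel_measurable borel" unfolding h_def by measurable
    have pw: "?T F x2
      \<le> ennreal D * (\<integral>\<^sup>+y. h (x2, y) * riesz_kernel lam x2 y)" for x2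
    proof -
      let ?G = "\<lambda>x1. ennreal (F (?L (x1, x2)) * norm x1 powr - lam)"
      have G_eq: "(\<integral>\<^sup>+y. ?G (E *v y + (- (E *v x2)))) = ennreal c * ?T F x2"
        unfolding pos_T_def by (rule ceq[where f = ?G]) measurable
      have inv: "E *v y + (- (E *v x2)) = E *v (y - x2)" for y
        by (simp add: matrix_vector_mult_diff_distrib)
      have "?L (E *v (y - x2), x2) = (B *v x2 + A11 *v (E *v y), A22 *v y)" for y
        by (simp add: block_map_def matrix_vector_mult_diff_distrib A21E B_eq)
      then have Fh: "ennreal (F (?L (E *v (y - x2), x2))) = h (x2, y)" for y
        by (simp add: h_def)
      have "?T F x2 = ennreal (1 / c) * (\<integral>\<^sup>+y. ?G (E *v y + (- (E *v x2))))"
        unfolding G_eq using c by (simp add: mult.assoc[symmetric] ennreal_mult[symmetric])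
      also have "\<dots> \<le> ennreal (1 / c) * (\<integral>\<^sup>+y. ennreal (e powr - lam) * (h (x2, y) * riesz_kernel lam x2 y))"
      proof (intro mult_left_mono nn_integral_mono)
        fix y
        have "norm (E *v (y - x2)) powr - lam \<le> e powr - lam * norm (x2 - y) powr - lam"
        proof (cases "y = x2")
          case False
          then have "norm (E *v (y - x2)) powr - lam \<le> (e * norm (y - x2)) powr - lam"
            using e lam by (intro powr_mono2') auto
          then show ?thesis using e by (simp add: powr_mult norm_minus_commute)
        qed simp
        then have "h (x2, y) * ennreal (norm (E *v (y - x2)) powr - lam) \<le> h (x2, y) * ennreal (e powr - lam * norm (x2 - y) powr - lam)"
          by (intro mult_left_mono ennreal_leI) auto
        then show "?G (E *v y + (- (E *v x2))) \<le> ennreal (e powr - lam) * (h (x2, y) * riesz_kernel lam x2 y)"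
          unfolding inv by (simp add: riesz_kernel_def ennreal_mult Fh F0' ac_simps)
      qed simp
      also have "\<dots> = ennreal D * (\<integral>\<^sup>+y. h (x2, y) * riesz_kernel lam x2 y)"
      proof -
        have "ennreal (1 / c) * (ennreal (e powr - lam) * I) = ennreal D * I" for I
          using c by (simp add: mult.assoc[symmetric] ennreal_mult[symmetric] D_def)
        then show ?thesis by (subst nn_integral_cmult) auto
      qed
      finally show ?thesis .
    qed
    show "Lp_norm q lborel (?T F) \<le> ennreal (D * (C + 1) * K1 * K2) * pos_mixed_norm p1 p2 F"
    proof -
      define m where "m y = Lp_norm p1 lborel (\<lambda>u. ennreal (F (u, y)))" for y
      have [measurable]: "m \<in> borel_measurable borel"
        unfolding m_def using pos by (intro borel_measurable_Lp_norm_slice[where h = "\<lambda>z. ennreal (F z)"]) auto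
      have "Lp_norm q lborel (?T F)
        \<le> Lp_norm q lborel (\<lambda>x2. ennreal D * (\<integral>\<^sup>+y. h (x2, y) * riesz_kernel lam x2 y))"
        using pos by (intro Lp_norm_mono pw) auto
      also have "\<dots> = ennreal D * Lp_norm q lborel (\<lambda>x2. \<integral>\<^sup>+y. h (x2, y) * riesz_kernel lam x2 y)"
        using D pos by (intro Lp_norm_cmult) auto
      also have "\<dots> \<le> ennreal D * (ennreal C * Lp_norm p2 lborel (\<lambda>y. Lp_norm p1 lborel (\<lambda>w. h (w, y))))"
        by (intro mult_left_mono bd) auto
      also have "(\<lambda>y. Lp_norm p1 lborel (\<lambda>w. h (w, y))) = (\<lambda>y. ennreal K1 * m (A22 *v y + 0))"
        using K1_eq[of "\<lambda>u. ennreal (F (u, A22 *v y))" "A11 *v (E *v y)" for y]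
        by (simp add: h_def m_def)
      also have "Lp_norm p2 lborel \<dots> = ennreal K1 * (ennreal K2 * Lp_norm p2 lborel m)"
        using K1 pos by (subst Lp_norm_cmult) (auto simp: K2_eq[of m 0, simplified])
      also have "ennreal D * (ennreal C * (ennreal K1 * (ennreal K2 * Lp_norm p2 lborel m)))
        = ennreal (D * C * K1 * K2) * pos_mixed_norm p1 p2 F"
        unfolding pos_mixed_norm_def m_def[symmetric]
        using D C K1 K2 by (simp add: mult.assoc[symmetric] ennreal_mult[symmetric])
      also have "\<dots> \<le> ennreal (D * (C + 1) * K1 * K2) * pos_mixed_norm p1 p2 F"
        using D C K1 K2 by (intro mult_right_mono ennreal_leI) (auto intro!: mult_right_mono mult_left_mono)
      finally show ?thesis .
    qed
  qed
qed

section \<open>Measure estimates for slabs\<close>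

text \<open>How the slab, chain and logarithmic tests end: an inequality along arbitrarily large
  parameters suffices to compare exponents.\<close>

lemma powr_le_powr_imp_le:
  fixes x y C :: real
  assumes "\<And>M. \<exists>h\<ge>M. h powr x \<le> C * h powr y"
  shows "x \<le> y"
proof (rule ccontr)
  assume "\<not> x \<le> y"
  then have d: "0 < x - y" by simp
  define M where "M = max 1 ((\<bar>C\<bar> + 1) powr (1 / (x - y)))"
  obtain h where h: "M \<le> h" "h powr x \<le> C * h powr y" using assms by blast
  have h0: "0 < h" using h(1) by (simp add: M_def)
  have "\<bar>C\<bar> + 1 = ((\<bar>C\<bar> + 1) powr (1 / (x - y))) powr (x - y)"
    using d by (simp add: powr_powr)
  also have "\<dots> \<le> h powr (x - y)"
    using d h(1) by (intro powr_mono2) (auto simp: M_def)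
  also have "\<dots> = h powr x / h powr y" by (rule powr_diff)
  also have "\<dots> \<le> C" using h h0 by (simp add: field_simps)
  finally show False by simp
qed

lemma scaled_powr_le_imp_le:
  fixes x y g k C :: real
  assumes "0 < g" "0 < k"
    and le: "\<And>N::nat. 1 \<le> N \<Longrightarrow> (g * real N) powr x \<le> C * (k * real N) powr y"
  shows "x \<le> y"
proof (rule powr_le_powr_imp_le)
  fix M :: real
  obtain N :: nat where N: "max 1 M \<le> real N" using real_arch_simple by blast
  have "(g * real N) powr x \<le> C * (k * real N) powr y" using N by (intro le) simp
  then have "real N powr x \<le> C * k powr y / g powr x * real N powr y"
    using assms(1,2) by (simp add: powr_mult field_simps)
  then show "\<exists>h\<ge>M. h powr x \<le> C * k powr y / g powr x * h powr y" using N by auto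
qed

lemma inverse_scaled_powr_le_imp_le:
  fixes x y k K C :: real
  assumes "0 < k" "0 < K"
    and le: "\<And>N::nat. 1 \<le> N \<Longrightarrow> (k / real N) powr x \<le> C * (K / real N) powr y"
  shows "y \<le> x"
proof -
  have eq: "(K / real N) powr i = (1 / K * real N) powr - i" if "0 < K" "1 \<le> N" for K i N
    using that by (simp add: powr_minus_divide powr_divide powr_mult)
  have "- x \<le> - y"
  proof (rule scaled_powr_le_imp_le[of "1 / k" "1 / K"])
    fix N :: nat assume N: "1 \<le> N"
    show "(1 / k * real N) powr - x \<le> C * (1 / K * real N) powr - y"
      unfolding eq[OF assms(1) N, symmetric] eq[OF assms(2) N, symmetric] by (rule le[OF N])
  qed (use assms in auto)
  then show ?thesis by simp
qed

lemma one_le_abs_diff_of_nat: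
  assumes "i \<noteq> j"
  shows "1 \<le> \<bar>real i - real j\<bar>"
proof (cases "i < j")
  case True
  then have "real (Suc i) \<le> real j" by (intro of_nat_mono) simp
  then show ?thesis by simp
next
  case False
  then have "real (Suc j) \<le> real i" using assms by (intro of_nat_mono) simp
  then show ?thesis by simp
qed

lemma linear_not_inj_imp_annihilator:
  fixes f :: "'a::euclidean_space \<Rightarrow> 'a"
  assumes "linear f" "\<not> inj f"
  shows "\<exists>m. m \<noteq> 0 \<and> (\<forall>x. m \<bullet> f x = 0)"
proof -
  have "\<not> surj f" using assms linear_surjective_imp_injective by blast
  moreover have "span (range f) = range f"
    by (rule span_eq_iff[THEN iffD2, OF linear_subspace_image[OF assms(1) subspace_UNIV]])
  ultimately have "span (range f) \<noteq> UNIV" by metis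
  then obtain m where "m \<noteq> 0" "\<forall>x\<in>span (range f). m \<bullet> x = 0"
    using span_not_UNIV_orthogonal by blast
  then show ?thesis by (meson rangeI span_base)
qed

text \<open>Disjointness in pointwise form; integrated, it bounds the total measure of disjoint
  translates by the measure of a set containing them.\<close>

lemma sum_of_bool_le_of_bool:
  assumes "finite I" "\<And>i j. i \<in> I \<Longrightarrow> j \<in> I \<Longrightarrow> P i \<Longrightarrow> P j \<Longrightarrow> i = j"
    and "\<And>i. i \<in> I \<Longrightarrow> P i \<Longrightarrow> Q"
  shows "(\<Sum>i\<in>I. of_bool (P i)) \<le> (of_bool Q :: ennreal)"
proof (cases "\<exists>i\<in>I. P i")
  case True
  then obtain i where i: "i \<in> I" "P i" by blast
  have "(\<Sum>j\<in>I. of_bool (P j)) = (\<Sum>j\<in>{i}. of_bool (P j) :: ennreal)"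
    using assms i by (intro sum.mono_neutral_right) auto
  then show ?thesis using i assms(3) by simp
qed auto

lemma nn_integral_sum_translates:
  fixes v :: "'a::euclidean_space"
  assumes [measurable]: "S \<in> sets borel"
  shows "(\<integral>\<^sup>+x. (\<Sum>k\<in>I. of_bool (x - f k *\<^sub>R v \<in> S))) = of_nat (card I) * emeasure lborel S"
proof -
  have "(\<integral>\<^sup>+x. of_bool (x - f k *\<^sub>R v \<in> S)) = emeasure lborel S" for k
  proof -
    have "(\<integral>\<^sup>+x. of_bool (x + - (f k *\<^sub>R v) \<in> S)) = (\<integral>\<^sup>+x. of_bool (x \<in> S))"
      by (rule nn_integral_lborel_translate[where g = "\<lambda>x. of_bool (x \<in> S)"]) measurable
    also have "\<dots> = (\<integral>\<^sup>+x. indicator S x)"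
      by (intro nn_integral_cong) (auto simp: indicator_def)
    finally show ?thesis by simp
  qed
  then show ?thesis by (subst nn_integral_sum) auto
qed

definition slab :: "'a::euclidean_space \<Rightarrow> real \<Rightarrow> real \<Rightarrow> nat \<Rightarrow> 'a set" where
  "slab m r c N = {x. norm x \<le> r \<and> \<bar>m \<bullet> x - c\<bar> \<le> 1 / real N}"

lemma sets_slab [measurable]: "slab m r c N \<in> sets borel"
  unfolding slab_def by measurable

text \<open>Packing: \<open>N\<close> disjoint translates of the slab fit into a fixed ball.\<close>

lemma slab_measure_upper:
  fixes m :: "'a::euclidean_space"
  assumes m: "m \<noteq> 0" and R: "0 \<le> R"
  shows "\<exists>K>0. \<forall>N\<ge>1. \<forall>c. emeasure lborel (slab m R c N) \<le> ennreal (K / real N)"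
proof -
  define e where "e = m /\<^sub>R (m \<bullet> m)"
  have me: "m \<bullet> e = 1" using m by (simp add: e_def)
  let ?B = "cball (0::'a) (R + 3 * norm e)"
  obtain K where K: "emeasure lborel ?B = ennreal K" "0 \<le> K"
    using emeasure_lborel_cball_finite[of "0::'a" "R + 3 * norm e"] by (cases "emeasure lborel ?B") auto
  have "emeasure lborel (slab m R c N) \<le> ennreal ((K + 1) / real N)" if N: "1 \<le> N" for N c
  proof -
    let ?S = "slab m R c N"
    \<comment> \<open>Steps of 3 / N exceed the thickness 2 / N, so translates along
      \<open>e\<close> are disjoint, while all shifts stay below 3 |e|.\<close>
    let ?f = "\<lambda>k. 3 * real k / real N"
    have "of_nat N * emeasure lborel ?S = (\<integral>\<^sup>+x. (\<Sum>k<N. of_bool (x - ?f k *\<^sub>R e \<in> ?S)))"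
      by (subst nn_integral_sum_translates) auto
    also have "\<dots> \<le> (\<integral>\<^sup>+x. of_bool (x \<in> ?B))"
    proof (intro nn_integral_mono sum_of_bool_le_of_bool)
      fix x i j
      assume "x - ?f i *\<^sub>R e \<in> ?S" "x - ?f j *\<^sub>R e \<in> ?S"
      then have "\<bar>m \<bullet> x - ?f i - c\<bar> \<le> 1 / real N" "\<bar>m \<bullet> x - ?f j - c\<bar> \<le> 1 / real N"
        by (auto simp: slab_def inner_diff_right me)
      then have "\<bar>?f i - ?f j\<bar> \<le> 2 / real N" by linarith
      also have "?f i - ?f j = 3 * (real i - real j) / real N" by (simp add: diff_divide_distrib algebra_simps)
      finally have "3 * \<bar>real i - real j\<bar> \<le> 2"
        using N by (simp add: abs_mult field_simps)
      then show "i = j" using one_le_abs_diff_of_nat[of i j] by fastforce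
    next
      fix x i assume i: "i \<in> {..<N}" and "x - ?f i *\<^sub>R e \<in> ?S"
      then have "norm (x - ?f i *\<^sub>R e) \<le> R" by (simp add: slab_def)
      moreover have "norm (?f i *\<^sub>R e) \<le> 3 * norm e"
        using i by (auto simp: field_simps intro!: mult_right_mono)
      ultimately have "norm x \<le> R + 3 * norm e"
        using norm_triangle_sub[of x "?f i *\<^sub>R e"] by linarith
      then show "x \<in> ?B" by simp
    qed simp
    also have "\<dots> = (\<integral>\<^sup>+x. indicator ?B x)"
      by (intro nn_integral_cong) (auto simp: indicator_def)
    also have "\<dots> = ennreal K" using K by simp
    finally have le: "of_nat N * emeasure lborel ?S \<le> ennreal K" .
    have "emeasure lborel ?S = ennreal (1 / real N) * (of_nat N * emeasure lborel ?S)"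
      using N by (simp add: mult.assoc[symmetric] ennreal_of_nat_eq_real_of_nat ennreal_mult[symmetric])
    also have "\<dots> \<le> ennreal (1 / real N) * ennreal K" using le by (intro mult_left_mono) auto
    also have "\<dots> \<le> ennreal ((K + 1) / real N)"
      using K N by (subst ennreal_mult[symmetric]) (auto intro!: ennreal_leI simp: field_simps)
    finally show ?thesis .
  qed
  then show ?thesis using K by (intro exI[of _ "K + 1"]) auto
qed

text \<open>Pigeonhole: a multiple of \<open>N\<close> parallel slabs cover the unit ball.\<close>

lemma slab_measure_lower:
  fixes w :: "'a::euclidean_space"
  assumes w: "w \<noteq> 0"
  shows "\<exists>K>0. \<exists>c. \<forall>N\<ge>1. ennreal (K / real N) \<le> emeasure lborel (slab w 1 (c N) N)"
proof -
  define V where "V = unit_ball_vol (real DIM('a))"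
  define P where "P = nat \<lceil>norm w\<rceil>"
  have P: "norm w \<le> real P" "0 < real P" using w by (auto simp: P_def real_nat_ceiling_ge)
  have V: "0 < V" by (simp add: V_def)
  have "\<exists>c. ennreal (V / (2 * P) / real N) \<le> emeasure lborel (slab w 1 c N)" if N: "1 \<le> N" for N
  proof (rule ccontr)
    \<comment> \<open>On the unit ball w \<bullet> x ranges within [-P, P], which P * N intervals of
      length 2 / N with these midpoints cover. Slabs all smaller than claimed would leave the ball
      at most half its volume.\<close>
    let ?c = "\<lambda>k. real (2 * k + 1) / real N - real P"
    let ?S = "\<lambda>c. slab w 1 c N"
    have "ball 0 1 \<subseteq> (\<Union>k<P * N. ?S (?c k))"
    proof
      fix x :: 'a assume "x \<in> ball 0 1"
      then have x: "norm x < 1" by simp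
      have "\<bar>w \<bullet> x\<bar> < real P"
        using Cauchy_Schwarz_ineq2[of w x] mult_strict_left_mono[OF x, of "norm w"] w P(1)
        by (smt (verit) mult_cancel_left2 mult.right_neutral zero_less_norm_iff)
      then have t: "0 < w \<bullet> x + real P" "w \<bullet> x + real P < 2 * real P" by auto
      define k where "k = nat \<lfloor>(w \<bullet> x + real P) * real N / 2\<rfloor>"
      have "0 \<le> (w \<bullet> x + real P) * real N / 2" using t by simp
      then have k: "real k \<le> (w \<bullet> x + real P) * real N / 2" "(w \<bullet> x + real P) * real N / 2 < real k + 1"
        unfolding k_def by linarith+
      have "(w \<bullet> x + real P) * real N / 2 < real P * real N"
        using mult_strict_right_mono[OF t(2), of "real N"] N by simp
      then have "k < P * N" using k(1) by (simp flip: of_nat_mult)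
      moreover have "w \<bullet> x - ?c k = ((w \<bullet> x + real P) * real N - real (2 * k + 1)) / real N"
        using N by (simp add: field_simps)
      then have "\<bar>w \<bullet> x - ?c k\<bar> = \<bar>(w \<bullet> x + real P) * real N - real (2 * k + 1)\<bar> / real N"
        by (simp only: abs_divide abs_of_nat)
      then have "\<bar>w \<bullet> x - ?c k\<bar> \<le> 1 / real N"
        using k by (simp add: divide_right_mono)
      ultimately show "x \<in> (\<Union>k<P * N. ?S (?c k))" using x by (auto simp: slab_def)
    qed
    then have "emeasure lborel (ball (0::'a) 1) \<le> (\<Sum>k<P * N. emeasure lborel (?S (?c k)))"
      by (intro order_trans[OF emeasure_mono emeasure_subadditive_finite]) auto
    also assume "\<not> ?thesis"
    then have "(\<Sum>k<P * N. emeasure lborel (?S (?c k))) \<le> (\<Sum>k<P * N. ennreal (V / (2 * P) / real N))"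
      by (intro sum_mono) (simp add: not_le less_imp_le)
    also have "\<dots> = ennreal (V / 2)"
      using P N V by (simp add: ennreal_of_nat_eq_real_of_nat ennreal_mult[symmetric])
    finally show False using V by (simp add: emeasure_ball V_def)
  qed
  then have "\<exists>c. \<forall>N\<ge>1. ennreal (V / (2 * P) / real N) \<le> emeasure lborel (slab w 1 (c N) N)"
    by (intro choice allI) blast
  then show ?thesis using V P by (intro exI[of _ "V / (2 * P)"]) auto
qed

section \<open>Norms of indicators\<close>

text \<open>For p = \<infinity> the bound is \<open>m powr 0\<close>, which is 1 because
  \<open>m\<close> is positive (\<open>0 powr 0\<close> is 0).\<close>

lemma Lp_norm_indicator_upper:
  assumes [measurable]: "E \<in> sets M" and p: "0 < p" and m: "emeasure M E \<le> ennreal m" "0 < m"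
  shows "Lp_norm p M (indicator E) \<le> ennreal (m powr recip p)"
proof (cases "p = \<infinity>")
  case True
  have "esssup M (indicator E :: _ \<Rightarrow> ennreal) \<le> 1"
    by (intro esssup_I) (auto simp: indicator_def)
  then show ?thesis using True m by (simp add: Lp_norm_infty)
next
  case False
  have "epowr (indicator E x) (1 / recip p) = indicator E x" for x
    by (simp add: indicator_def)
  then show ?thesis
    using False p m epowr_mono[OF m(1), of "recip p"]
    by (simp add: Lp_norm_recip epowr_ennreal)
qed

lemma Lp_norm_indicator_lower:
  assumes [measurable]: "E \<in> sets M" and p: "0 < p" and m: "ennreal m \<le> emeasure M E" "0 < m"
  shows "ennreal (m powr recip p) \<le> Lp_norm p M (indicator E)"
proof (cases "p = \<infinity>")
  case True
  have "1 \<le> esssup M (indicator E :: _ \<Rightarrow> ennreal)"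
  proof (rule ccontr)
    assume "\<not> 1 \<le> esssup M (indicator E :: _ \<Rightarrow> ennreal)"
    then have "AE x in M. x \<notin> E"
      using esssup_AE[of "indicator E :: _ \<Rightarrow> ennreal" M] by (auto elim!: eventually_mono simp: indicator_def)
    then have "emeasure M E = 0"
      using AE_iff_measurable[of E M "\<lambda>x. x \<notin> E"] sets.sets_into_space[OF assms(1)] by auto
    then show False using m by simp
  qed
  then show ?thesis using True m by (simp add: Lp_norm_infty)
next
  case False
  have "epowr (indicator E x) (1 / recip p) = indicator E x" for x
    by (simp add: indicator_def)
  then show ?thesis
    using False p m epowr_mono[OF m(1), of "recip p"]
    by (simp add: Lp_norm_recip epowr_ennreal)
qed

lemma Lp_norm_zero: "0 < p \<Longrightarrow> Lp_norm p M (\<lambda>x. 0) = 0"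
  using Lp_norm_cmult_le[of "\<lambda>x. 0" M p 0] by simp

lemma pos_mixed_norm_indicator_le:
  fixes S :: "((real^'n) \<times> (real^'n)) set"
  assumes [measurable]: "S \<in> sets borel" "Y \<in> sets borel" and p: "0 < p1" "0 < p2"
    and a: "\<And>y. emeasure lborel {u. (u, y) \<in> S} \<le> ennreal a" "0 < a"
    and Y: "\<And>z. z \<in> S \<Longrightarrow> snd z \<in> Y" "emeasure lborel Y \<le> ennreal b" "0 < b"
  shows "pos_mixed_norm p1 p2 (indicat_real S) \<le> ennreal (a powr recip p1 * b powr recip p2)"
proof -
  have inner: "Lp_norm p1 lborel (\<lambda>u. ennreal (indicat_real S (u, y))) \<le> ennreal (a powr recip p1) * indicator Y y" for y
  proof (cases "y \<in> Y")
    case True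
    have [measurable]: "{u. (u, y) \<in> S} \<in> sets lborel" by measurable
    have "(\<lambda>u. ennreal (indicat_real S (u, y))) = indicator {u. (u, y) \<in> S}"
      by (auto simp: indicator_def)
    then show ?thesis using True a p Lp_norm_indicator_upper[of "{u. (u, y) \<in> S}" lborel p1 a] by simp
  next
    case False
    then have "(\<lambda>u. ennreal (indicat_real S (u, y))) = (\<lambda>u. 0)"
      using Y(1) by (force simp: indicator_def)
    then show ?thesis using p by (simp add: Lp_norm_zero)
  qed
  have [measurable]: "(\<lambda>y. Lp_norm p1 lborel (\<lambda>u. ennreal (indicat_real S (u, y)))) \<in> borel_measurable borel"
    using p by (intro borel_measurable_Lp_norm_slice[where h = "\<lambda>z. ennreal (indicat_real S z)"]) auto
  have "pos_mixed_norm p1 p2 (indicat_real S) \<le> Lp_norm p2 lborel (\<lambda>y. ennreal (a powr recip p1) * indicator Y y)"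
    unfolding pos_mixed_norm_def
    using p inner by (intro Lp_norm_mono) auto
  also have "\<dots> \<le> ennreal (a powr recip p1) * Lp_norm p2 lborel (indicator Y)"
    using p by (intro Lp_norm_cmult_le) auto
  also have "\<dots> \<le> ennreal (a powr recip p1) * ennreal (b powr recip p2)"
    using p Y by (intro mult_left_mono Lp_norm_indicator_upper) auto
  finally show ?thesis by (simp add: ennreal_mult)
qed

section \<open>Necessity\<close>

lemma pred_in_balls [measurable (raw)]:
  fixes f :: "'a \<Rightarrow> 'b::euclidean_space"
  assumes [measurable]: "f \<in> borel_measurable M"
  shows "Measurable.pred M (\<lambda>x. f x \<in> ball c r)" and "Measurable.pred M (\<lambda>x. f x \<in> cball c r)"
  unfolding mem_ball mem_cball by measurable

lemma unit_ball_vol_neq_0 [simp]: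
  assumes "0 \<le> n"
  shows "unit_ball_vol n \<noteq> 0" "\<not> unit_ball_vol n \<le> 0"
  using unit_ball_vol_pos[OF assms] by linarith+

section \<open>Critical powers on annuli\<close>

definition ring_set :: "real \<Rightarrow> real \<Rightarrow> 'a::euclidean_space set" where
  "ring_set a b = {x. a \<le> norm x \<and> norm x < b}"

lemma borel_ring_set [measurable]: "ring_set a b \<in> sets borel"
  unfolding ring_set_def by measurable

definition ring_power :: "real \<Rightarrow> real \<Rightarrow> real \<Rightarrow> 'a::euclidean_space \<Rightarrow> real" where
  "ring_power \<beta> a b x = indicat_real (ring_set a b) x * norm x powr - \<beta>"

lemma borel_measurable_ring_power [measurable]: "ring_power \<beta> a b \<in> borel_measurable borel"
  unfolding ring_power_def[abs_def] by measurable

lemma ring_power_nonneg [simp]: "0 \<le> ring_power \<beta> a b x"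
  by (simp add: ring_power_def)

lemma ring_power_mult: "ring_power \<beta> a b x * norm x powr - \<gamma> = ring_power (\<beta> + \<gamma>) a b x"
  by (simp add: ring_power_def powr_add[symmetric])

text \<open>The logarithmically divergent integral of |x|^-n, truncated to an annulus. Its value is
  the large parameter h of the endpoint tests.\<close>

definition ring_integral :: "'a::euclidean_space itself \<Rightarrow> real \<Rightarrow> real \<Rightarrow> ennreal" where
  "ring_integral _ a b = (\<integral>\<^sup>+x. ennreal (ring_power DIM('a) a b (x::'a)))"

lemma emeasure_ring_set:
  assumes "0 \<le> a" "a \<le> b"
  shows "emeasure lborel (ring_set a b :: 'a::euclidean_space set)
    = ennreal (unit_ball_vol DIM('a) * (b ^ DIM('a) - a ^ DIM('a)))"
proof -
  have "ring_set a b = ball (0::'a) b - ball 0 a"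
    by (auto simp: ring_set_def)
  then have "emeasure lborel (ring_set a b :: 'a set) = emeasure lborel (ball (0::'a) b) - emeasure lborel (ball (0::'a) a)"
  proof (simp only:, intro emeasure_Diff)
    show "emeasure lborel (ball (0::'a) a) \<noteq> \<infinity>"
      using emeasure_lborel_ball_finite[of "0::'a" a] by (metis less_irrefl)
    show "ball (0::'a) a \<subseteq> ball 0 b" using assms by (intro subset_ball)
  qed auto
  also have "\<dots> = ennreal (unit_ball_vol DIM('a) * b ^ DIM('a) - unit_ball_vol DIM('a) * a ^ DIM('a))"
    using assms by (simp add: emeasure_ball ennreal_minus)
  finally show ?thesis by (simp add: right_diff_distrib)
qed

text \<open>Scale invariance: the minimum (2a)^-n of the integrand times the volume V (2^n - 1) a^n
  of the dyadic annulus does not depend on a.\<close>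

lemma ring_integral_step:
  assumes a: "0 < a"
  shows "ennreal (unit_ball_vol DIM('a) * (1 - 1 / 2 ^ DIM('a))) \<le> ring_integral TYPE('a::euclidean_space) a (2 * a)"
proof -
  let ?n = "real DIM('a)"
  have "ennreal (unit_ball_vol DIM('a) * (1 - 1 / 2 ^ DIM('a)))
    = ennreal ((2 * a) powr - ?n) * emeasure lborel (ring_set a (2 * a) :: 'a set)"
    using a by (simp add: emeasure_ring_set ennreal_mult[symmetric] powr_minus powr_realpow power_mult_distrib field_simps)
  also have "\<dots> = (\<integral>\<^sup>+x. ennreal ((2 * a) powr - ?n) * indicator (ring_set a (2 * a) :: 'a set) x)"
    by (rule nn_integral_cmult_indicator[symmetric]) simp
  also have "\<dots> \<le> ring_integral TYPE('a) a (2 * a)"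
    unfolding ring_integral_def ring_power_def
  proof (intro nn_integral_mono)
    fix x :: 'a
    show "ennreal ((2 * a) powr - ?n) * indicator (ring_set a (2 * a)) x
      \<le> ennreal (indicat_real (ring_set a (2 * a)) x * norm x powr - ?n)"
      using a by (auto simp: indicator_def ring_set_def intro!: ennreal_leI powr_mono2')
  qed
  finally show ?thesis .
qed

lemma ring_integral_superadd:
  assumes "a \<le> b" "b \<le> c"
  shows "ring_integral TYPE('a::euclidean_space) a b + ring_integral TYPE('a) b c \<le> ring_integral TYPE('a) a c"
  unfolding ring_integral_def
  using assms by (subst nn_integral_add[symmetric])
    (auto intro!: nn_integral_mono simp: ring_power_def ring_set_def indicator_def)

lemma ring_integral_lower:
  assumes a: "0 < a"
  shows "ennreal (unit_ball_vol DIM('a) * (1 - 1 / 2 ^ DIM('a)) * real J)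
    \<le> ring_integral TYPE('a::euclidean_space) a (2 ^ J * a)"
proof (induction J)
  case (Suc J)
  let ?c = "unit_ball_vol DIM('a) * (1 - 1 / 2 ^ DIM('a))"
  have "ennreal (c * real (Suc J)) = ennreal (c * real J) + ennreal c" if "0 \<le> c" for c
    using that by (subst ennreal_plus[symmetric]) (auto simp: algebra_simps simp del: ennreal_plus)
  moreover have "0 \<le> ?c" by simp
  ultimately have "ennreal (?c * real (Suc J)) = ennreal (?c * real J) + ennreal ?c" by blast
  also have "\<dots> \<le> ring_integral TYPE('a) a (2 ^ J * a) + ring_integral TYPE('a) (2 ^ J * a) (2 * (2 ^ J * a))"
    using a by (intro add_mono Suc.IH ring_integral_step) auto
  also have "\<dots> \<le> ring_integral TYPE('a) a (2 ^ Suc J * a)"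
    using a ring_integral_superadd[of a "2 ^ J * a" "2 * (2 ^ J * a)", where 'a = 'a] by (simp add: mult.assoc)
  finally show ?case .
qed simp

lemma ring_integral_finite:
  assumes a: "0 < a"
  shows "ring_integral TYPE('a::euclidean_space) a b < top"
proof -
  have "ring_integral TYPE('a) a b \<le> (\<integral>\<^sup>+x. ennreal (a powr - real DIM('a)) * indicator (ball (0::'a) b) x)"
    unfolding ring_integral_def ring_power_def using a
    by (intro nn_integral_mono) (auto simp: indicator_def ring_set_def intro!: ennreal_leI powr_mono2')
  also have "\<dots> = ennreal (a powr - real DIM('a)) * emeasure lborel (ball (0::'a) b)"
    by (rule nn_integral_cmult_indicator) simp
  also have "\<dots> < top" using emeasure_lborel_ball_finite[of "0::'a" b] by (simp add: ennreal_mult_less_top)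
  finally show ?thesis .
qed

text \<open>The inner radius may depend on J, so that the annuli can grow outwards from radius 1 or
  shrink towards 0 inside the unit ball.\<close>

lemma ring_integral_large:
  "\<exists>J h. 0 < h \<and> M \<le> h \<and> (a::nat \<Rightarrow> real) J > 0 \<and> ring_integral TYPE('a::euclidean_space) (a J) (2 ^ J * a J) = ennreal h"
  if a: "\<And>J. 0 < a J"
proof -
  let ?c = "unit_ball_vol (real DIM('a)) * (1 - 1 / 2 ^ DIM('a))"
  have c: "0 < ?c" by (intro mult_pos_pos) (auto simp: field_simps)
  obtain J :: nat where J: "max M 1 / ?c \<le> real J" using real_arch_simple by blast
  have "x \<le> d * y" if "x / d \<le> y" "0 < d" for x d y :: real
    using that by (simp add: field_simps)
  from this[OF J c] have cJ: "max M 1 \<le> ?c * real J" .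
  obtain h where h: "ring_integral TYPE('a) (a J) (2 ^ J * a J) = ennreal h" "0 \<le> h"
    using ring_integral_finite[OF a[of J], where 'a = 'a and b = "2 ^ J * a J"]
    by (cases "ring_integral TYPE('a) (a J) (2 ^ J * a J)") auto
  have "ennreal (?c * real J) \<le> ennreal h"
    using ring_integral_lower[OF a[of J], where 'a = 'a and J = J] h by simp
  then have "?c * real J \<le> h" using h by simp
  then have "max M 1 \<le> h" using cJ by linarith
  then show ?thesis using h a[of J] by (intro exI[of _ J] exI[of _ h]) auto
qed

text \<open>The p-th power of |x|^(-n/p) is the critical |x|^-n, so the norm grows only like
  h^(1/p).\<close>

lemma Lp_norm_ring_power:
  fixes a b :: real
  assumes p: "0 < p" "p \<noteq> \<infinity>" and h: "ring_integral TYPE('a::euclidean_space) a b = ennreal h" "0 < h"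
  shows "Lp_norm p lborel (\<lambda>x::'a. ennreal (ring_power (DIM('a) * recip p) a b x)) = ennreal (h powr recip p)"
proof -
  have i: "0 < recip p" using p by (simp add: recip_pos)
  have eq1: "epowr (ennreal (ring_power (DIM('a) * recip p) a b x)) (1 / recip p) = ennreal (ring_power DIM('a) a b x)" for x :: 'a
    using i by (simp add: ring_power_def epowr_ennreal indicator_def powr_powr)
  have eq2: "(\<integral>\<^sup>+x. ennreal (ring_power DIM('a) a b (x::'a))) = ennreal h"
    using h by (simp add: ring_integral_def)
  show ?thesis
    unfolding Lp_norm_recip[OF p] eq1 eq2 using h by (simp add: epowr_ennreal)
qed

lemma Lp_norm_ring_power_le:
  fixes a b :: real
  assumes p: "0 < p" and h: "ring_integral TYPE('a::euclidean_space) a b = ennreal h" "0 < h"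
  shows "Lp_norm p lborel (\<lambda>x::'a. ennreal (ring_power (DIM('a) * recip p) a b x)) \<le> ennreal (h powr recip p)"
proof (cases "p = \<infinity>")
  case True
  have "esssup lborel (\<lambda>x::'a. ennreal (ring_power 0 a b x)) \<le> 1"
    by (intro esssup_I) (auto simp: ring_power_def indicator_def)
  then show ?thesis using True h by (simp add: Lp_norm_infty)
next
  case False
  then show ?thesis using Lp_norm_ring_power[OF p False h] by simp
qed

lemma nn_integral_kernel_ball_lower:
  assumes "0 \<le> lam"
  shows "ennreal (unit_ball_vol DIM('a)) \<le> (\<integral>\<^sup>+x. ennreal (indicat_real (ball 0 1) x * norm (x::'a::euclidean_space) powr - lam))"
proof -
  have "ennreal (unit_ball_vol DIM('a)) = (\<integral>\<^sup>+x. indicator (ball (0::'a) 1) x)"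
    by (simp add: emeasure_ball)
  also have "\<dots> \<le> (\<integral>\<^sup>+x. ennreal (indicat_real (ball 0 1) x * norm (x::'a) powr - lam))"
  proof (rule nn_integral_mono_AE)
    have "AE x in lborel. x \<noteq> (0::'a)" by (rule AE_lborel_singleton)
    then show "AE x in lborel. indicator (ball (0::'a) 1) x \<le> ennreal (indicat_real (ball 0 1) x * norm (x::'a) powr - lam)"
    proof eventually_elim
      case (elim x)
      have "1 \<le> norm x powr - lam" if "norm x < 1"
        using powr_mono2'[of "- lam" "norm x" 1] that elim assms by simp
      then show ?case by (simp add: indicator_def)
    qed
  qed
  finally show ?thesis .
qed

lemma pos_bounded_imp_inj:
  fixes A11 A12 A21 A22 :: "real^'n^'n"
  assumes pb: "pos_bounded p1 p2 q lam A11 A12 A21 A22" and p: "0 < p1" "0 < p2" "0 < q" and lam: "0 < lam"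
  shows "inj (block_map A11 A12 A21 A22)"
proof (rule ccontr)
  let ?T = "pos_T lam A11 A12 A21 A22"
  assume "\<not> inj (block_map A11 A12 A21 A22)"
  then obtain m where m: "m \<noteq> 0" "\<And>z. m \<bullet> block_map A11 A12 A21 A22 z = 0"
    using linear_not_inj_imp_annihilator[OF linear_block_map] by blast
  obtain C where bd: "\<And>F. F \<in> borel_measurable borel \<Longrightarrow> (\<forall>z. 0 \<le> F z) \<Longrightarrow>
      Lp_norm q lborel (?T F) \<le> ennreal C * pos_mixed_norm p1 p2 F"
    using pb unfolding pos_bounded_def by blast
  define S where "S = {z. m \<bullet> z = 0}"
  have [measurable]: "S \<in> sets borel" unfolding S_def by measurable
  have "negligible S" unfolding S_def using m by (intro negligible_hyperplane) auto
  then have "S \<in> null_sets lborel"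
    by (simp add: negligible_iff_null_sets null_sets_completion_iff)
  then have "AE z in lborel. z \<notin> S" by (rule AE_not_in)
  then have "AE y in lborel. AE x in lborel. (x, y) \<notin> S" by (rule AE_slices)
  then have ae: "AE y in lborel. Lp_norm p1 lborel (\<lambda>x. ennreal (indicat_real S (x, y))) = 0"
  proof eventually_elim
    case (elim y)
    have "Lp_norm p1 lborel (\<lambda>x. ennreal (indicat_real S (x, y))) = Lp_norm p1 lborel (\<lambda>x::real^'n. 0)"
      using elim p by (intro Lp_norm_cong_AE) (auto elim: eventually_mono)
    then show ?case using p by (simp add: Lp_norm_zero)
  qed
  have [measurable]: "(\<lambda>y. Lp_norm p1 lborel (\<lambda>u. ennreal (indicat_real S (u, y)))) \<in> borel_measurable borel"
    using p by (intro borel_measurable_Lp_norm_slice[where h = "\<lambda>z. ennreal (indicat_real S z)"]) auto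
  have "pos_mixed_norm p1 p2 (indicat_real S) = Lp_norm p2 lborel (\<lambda>y::real^'n. 0)"
    unfolding pos_mixed_norm_def
    using ae p by (intro Lp_norm_cong_AE) auto
  then have "pos_mixed_norm p1 p2 (indicat_real S) = 0" using p by (simp add: Lp_norm_zero)
  then have le: "Lp_norm q lborel (?T (indicat_real S)) \<le> 0"
    using bd[of "indicat_real S"] by simp
  let ?V = "unit_ball_vol (real DIM(real^'n))"
  have V: "0 < ?V" by simp
  have T_lower: "ennreal ?V * indicator (ball 0 1) x2 \<le> ?T (indicat_real S) x2" for x2
  proof -
    have "ennreal ?V \<le> (\<integral>\<^sup>+x. ennreal (indicat_real (ball 0 1) x * norm (x::real^'n) powr - lam))"
      using lam by (intro nn_integral_kernel_ball_lower) simp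
    also have "\<dots> \<le> ?T (indicat_real S) x2"
      unfolding pos_T_def using m by (intro nn_integral_mono ennreal_leI) (auto simp: S_def indicator_def)
    finally show ?thesis by (auto simp: indicator_def)
  qed
  have "ennreal ?V * ennreal (?V powr recip q) \<le> ennreal ?V * Lp_norm q lborel (indicator (ball (0::real^'n) 1))"
    using p V by (intro mult_left_mono Lp_norm_indicator_lower) (auto simp: emeasure_ball)
  also have "\<dots> = Lp_norm q lborel (\<lambda>x2. ennreal ?V * indicator (ball (0::real^'n) 1) x2)"
    using p V by (intro Lp_norm_cmult[symmetric]) auto
  also have "\<dots> \<le> Lp_norm q lborel (?T (indicat_real S))"
    using p by (intro Lp_norm_mono T_lower) auto
  also note le
  finally have "?V * ?V powr recip q \<le> 0" using V by (simp add: ennreal_mult[symmetric])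
  then show False using V by (simp add: mult_le_0_iff)
qed

lemma ring_integral_large_near_0:
  "\<exists>a>0. \<exists>h>0. M \<le> h \<and> ring_integral TYPE('a::euclidean_space) a 1 = ennreal h"
proof -
  obtain J h where "0 < h" "M \<le> h" "ring_integral TYPE('a) (1 / 2 ^ J) (2 ^ J * (1 / 2 ^ J)) = ennreal h"
    using ring_integral_large[of "\<lambda>J. 1 / 2 ^ J" M, where 'a = "'a"] by auto
  then show ?thesis by (intro exI[of _ "1 / 2 ^ J"] conjI exI[of _ h]) auto
qed

lemma emeasure_cball_pos:
  assumes "0 < \<rho>"
  shows "\<exists>a>0. \<forall>x. emeasure lborel (cball (x::'a::euclidean_space) \<rho>) = ennreal a"
  using assms by (intro exI[of _ "unit_ball_vol DIM('a) * \<rho> ^ DIM('a)"]) (auto simp: emeasure_cball)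

lemma emeasure_chain_lower:
  fixes v :: "'a::euclidean_space"
  assumes v: "2 < norm v"
  shows "ennreal (unit_ball_vol DIM('a) * real N) \<le> emeasure lborel (\<Union>j<N. ball (real j *\<^sub>R v) 1)"
proof -
  have "ennreal (unit_ball_vol DIM('a) * real N)
    = of_nat (card {..<N}) * emeasure lborel (ball (0::'a) 1)"
    by (simp add: emeasure_ball ennreal_of_nat_eq_real_of_nat ennreal_mult[symmetric] mult.commute)
  also have "\<dots> = (\<integral>\<^sup>+x. (\<Sum>j<N. of_bool (x - real j *\<^sub>R v \<in> ball 0 1)))"
    by (rule nn_integral_sum_translates[symmetric]) simp
  also have "\<dots> \<le> (\<integral>\<^sup>+x. of_bool (x \<in> (\<Union>j<N. ball (real j *\<^sub>R v) 1)))"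
  proof (intro nn_integral_mono sum_of_bool_le_of_bool)
    fix x i j
    assume "x - real i *\<^sub>R v \<in> ball 0 1" "x - real j *\<^sub>R v \<in> ball 0 1"
    then have "norm (x - real i *\<^sub>R v) < 1" "norm (x - real j *\<^sub>R v) < 1" by auto
    then have "norm ((x - real j *\<^sub>R v) - (x - real i *\<^sub>R v)) < 2"
      using norm_triangle_ineq4[of "x - real j *\<^sub>R v" "x - real i *\<^sub>R v"] by linarith
    also have "(x - real j *\<^sub>R v) - (x - real i *\<^sub>R v) = (real i - real j) *\<^sub>R v"
      by (simp add: algebra_simps)
    finally have "\<bar>real i - real j\<bar> * norm v < 2" by simp
    show "i = j"
    proof (rule ccontr)
      assume "i \<noteq> j"
      then have "1 \<le> \<bar>real i - real j\<bar>" by (rule one_le_abs_diff_of_nat)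
      then have "1 * norm v \<le> \<bar>real i - real j\<bar> * norm v" by (intro mult_right_mono) auto
      then show False using \<open>\<bar>real i - real j\<bar> * norm v < 2\<close> v by linarith
    qed
  next
    fix x i assume "i \<in> {..<N}" "x - real i *\<^sub>R v \<in> ball 0 1"
    then show "x \<in> (\<Union>j<N. ball (real j *\<^sub>R v) 1)"
      by (auto simp: dist_norm norm_minus_commute intro!: bexI[of _ i])
  qed simp
  also have "\<dots> = (\<integral>\<^sup>+x. indicator (\<Union>j<N. ball (real j *\<^sub>R v) 1) x)"
    by (intro nn_integral_cong) (auto simp: indicator_def)
  also have "\<dots> = emeasure lborel (\<Union>j<N. ball (real j *\<^sub>R v) 1)"
    by (rule nn_integral_indicator) auto
  finally show ?thesis .
qed

lemma emeasure_chain_upper: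
  fixes v :: "'a::euclidean_space"
  assumes "\<And>x. emeasure lborel (cball (x::'a) \<rho>) = ennreal a"
  shows "emeasure lborel (\<Union>j<N. cball (real j *\<^sub>R v) \<rho>) \<le> ennreal (a * real N)"
proof -
  have "emeasure lborel (\<Union>j<N. cball (real j *\<^sub>R v) \<rho>) \<le> (\<Sum>j<N. emeasure lborel (cball (real j *\<^sub>R v) \<rho>))"
    by (intro emeasure_subadditive_finite) auto
  also have "\<dots> = of_nat N * ennreal a" by (simp add: assms)
  also have "\<dots> \<le> ennreal (a * real N)"
    by (cases "0 \<le> a") (auto simp: ennreal_of_nat_eq_real_of_nat ennreal_mult[symmetric] mult.commute ennreal_neg)
  finally show ?thesis .
qed

lemma borel_measurable_fst_euclidean [measurable]:
  "(fst :: 'a::euclidean_space \<times> 'b::euclidean_space \<Rightarrow> 'a) \<in> borel_measurable borel"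
  by (intro borel_measurable_continuous_onI continuous_intros)

lemma borel_measurable_snd_euclidean [measurable]:
  "(snd :: 'a::euclidean_space \<times> 'b::euclidean_space \<Rightarrow> 'b) \<in> borel_measurable borel"
  by (intro borel_measurable_continuous_onI continuous_intros)

text \<open>Used to bound the kernel |x1|^-lam from below by a power of max(|y|, |x2|), where y =
  A21 x1 + A22 x2.\<close>

lemma norm_le_shear:
  fixes A21 A22 :: "real^'n^'n"
  assumes A21: "inj ((*v) A21)"
  shows "\<exists>\<kappa>>0. \<forall>x1 x2. norm x1 \<le> \<kappa> * (norm (A21 *v x1 + A22 *v x2) + norm x2)"
proof -
  obtain e where e: "0 < e" "\<And>x. e * norm x \<le> norm (A21 *v x)"
    using linear_inj_bounded_below_pos[OF matrix_vector_mul_linear A21] by metis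
  obtain B where B: "0 < B" "\<And>x. norm (A22 *v x) \<le> B * norm x"
    using linear_bounded_pos[OF matrix_vector_mul_linear[of A22]] by blast
  have "norm x1 \<le> (1 + B) / e * (norm (A21 *v x1 + A22 *v x2) + norm x2)" for x1 x2
  proof -
    have "e * norm x1 \<le> norm ((A21 *v x1 + A22 *v x2) - A22 *v x2)" using e(2)[of x1] by simp
    also have "\<dots> \<le> norm (A21 *v x1 + A22 *v x2) + B * norm x2"
      using norm_triangle_ineq4[of "A21 *v x1 + A22 *v x2" "A22 *v x2"] B(2)[of x2] by linarith
    also have "\<dots> \<le> (1 + B) * (norm (A21 *v x1 + A22 *v x2) + norm x2)"
      using B(1) by (simp add: algebra_simps)
    finally show ?thesis using e(1) by (simp add: field_simps)
  qed
  then show ?thesis using e B by (intro exI[of _ "(1 + B) / e"]) auto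
qed

section \<open>Consequences of boundedness when the block map is injective\<close>

locale bounded_block =
  fixes A11 A12 A21 A22 :: "real^'n^'n" and p1 p2 q :: ennreal and lam C V :: real
  assumes lam: "0 < lam" "lam < real CARD('n)"
    and p: "0 < p1" "0 < p2" "0 < q"
    and scaling: "recip p1 + recip p2 = recip q + (1 - lam / real CARD('n))"
    and C: "0 < C"
    and bound: "\<And>F. F \<in> borel_measurable borel \<Longrightarrow> (\<And>z. 0 \<le> F z) \<Longrightarrow>
      Lp_norm q lborel (pos_T lam A11 A12 A21 A22 F) \<le> ennreal C * pos_mixed_norm p1 p2 F"
    and inj: "inj (block_map A11 A12 A21 A22)"
    and V_eq: "V = unit_ball_vol (real CARD('n))"
begin

lemma V [simp]: "0 < V" "0 \<le> V" "V \<noteq> 0"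
  by (simp_all add: V_eq)

lemma emeasure_unit_ball: "emeasure lborel (ball (x::real^'n) 1) = ennreal V"
  by (simp add: emeasure_ball V_eq)

lemma indicat_real_ball: "(\<lambda>x. ennreal (indicat_real (ball 0 1) x)) = indicator (ball (0::real^'n) 1)"
  by (auto simp: indicator_def)

abbreviation "T \<equiv> pos_T lam A11 A12 A21 A22"
abbreviation "L \<equiv> block_map A11 A12 A21 A22"
definition "Li = inv L"

lemma Li_L [simp]: "Li (L z) = z"
  using inj by (simp add: Li_def)

lemma L_Li [simp]: "L (Li z) = z"
  using linear_injective_imp_surjective[OF linear_block_map inj] by (simp add: Li_def surj_f_inv_f)

lemma linear_Li: "linear Li"
  unfolding Li_def by (rule inj_linear_imp_inv_linear[OF linear_block_map inj])

lemma Li_split: "Li (u, y) = Li (u, 0) + Li (0, y)"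
  using linear_add[OF linear_Li, of "(u, 0)" "(0, y)"] by simp

lemma borel_measurable_Li [measurable]: "Li \<in> borel_measurable borel"
  by (intro borel_measurable_continuous_onI linear_continuous_on) (simp add: linear_linear linear_Li)

lemma borel_measurable_fst_Li [measurable]: "(\<lambda>z. fst (Li z)) \<in> borel_measurable borel"
  by (intro borel_measurable_continuous_onI continuous_on_fst linear_continuous_on)
    (simp add: linear_linear linear_Li)

lemma borel_measurable_snd_Li [measurable]: "(\<lambda>z. snd (Li z)) \<in> borel_measurable borel"
  by (intro borel_measurable_continuous_onI continuous_on_snd linear_continuous_on)
    (simp add: linear_linear linear_Li)

lemma linear_P: "linear (\<lambda>u. fst (Li (u, 0)))"
  and linear_Q: "linear (\<lambda>u. snd (Li (u, 0)))"
  using linear_add[OF linear_Li, of "(_, 0)" "(_, 0)"] linear_scale[OF linear_Li, of _ "(_, 0)"]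
  by (auto intro!: linearI)

text \<open>For fixed y the map from u to x2 is then an affine isomorphism, so a function of x2 can
  be measured in u up to a constant.\<close>

lemma inj_Q: "inj ((*v) A21) \<Longrightarrow> inj (\<lambda>u. snd (Li (u, 0)))"
proof -
  assume A21: "inj ((*v) A21)"
  have "u = 0" if "snd (Li (u, 0)) = 0" for u
  proof -
    let ?x = "fst (Li (u, 0))"
    have *: "L (?x, 0) = (u, 0)" using L_Li[of "(u, 0)"] that by (metis prod.collapse)
    then have "A21 *v ?x = 0" by (simp add: block_map_def)
    then have "?x = 0" using A21 linear_injective_0[OF matrix_vector_mul_linear[of A21]] by blast
    then show ?thesis using * by (simp add: block_map_def)
  qed
  then show ?thesis using linear_injective_0[OF linear_Q] by blast
qed

text \<open>The counterpart for x1: for fixed y, u determines x1 and conversely.\<close>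

lemma inj_P: "inj ((*v) A22) \<Longrightarrow> inj (\<lambda>u. fst (Li (u, 0)))"
proof -
  assume A22: "inj ((*v) A22)"
  have "u = 0" if "fst (Li (u, 0)) = 0" for u
  proof -
    let ?x = "snd (Li (u, 0))"
    have *: "L (0, ?x) = (u, 0)" using L_Li[of "(u, 0)"] that by (metis prod.collapse)
    then have "A22 *v ?x = 0" by (simp add: block_map_def)
    then have "?x = 0" using A22 linear_injective_0[OF matrix_vector_mul_linear[of A22]] by blast
    then show ?thesis using * by (simp add: block_map_def)
  qed
  then show ?thesis using linear_injective_0[OF linear_P] by blast
qed

text \<open>On a product in the source coordinates the operator is explicit: it returns \<psi> times
  the integral of \<phi> against the kernel. All difficulty sits in the mixed norm on the
  right.\<close>

lemma product_test:
  assumes [measurable]: "\<phi> \<in> borel_measurable borel" "\<psi> \<in> borel_measurable borel"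
    and nn: "\<And>x. 0 \<le> \<phi> x" "\<And>x. 0 \<le> \<psi> x"
    and c: "0 < c" "ennreal c \<le> (\<integral>\<^sup>+x. ennreal (\<phi> x * norm x powr - lam))"
  shows "ennreal c * Lp_norm q lborel (\<lambda>x. ennreal (\<psi> x))
      \<le> ennreal C * pos_mixed_norm p1 p2 (\<lambda>z. \<phi> (fst (Li z)) * \<psi> (snd (Li z)))"
proof -
  let ?F = "\<lambda>z. \<phi> (fst (Li z)) * \<psi> (snd (Li z))"
  have "T ?F x2
    = ennreal (\<psi> x2) * (\<integral>\<^sup>+x. ennreal (\<phi> x * norm x powr - lam))" for x2
  proof -
    have "T ?F x2 = (\<integral>\<^sup>+x. ennreal (\<psi> x2) * ennreal (\<phi> x * norm x powr - lam))"
      unfolding pos_T_def using nn by (intro nn_integral_cong) (simp add: ennreal_mult[symmetric] ac_simps)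
    then show ?thesis by (simp add: nn_integral_cmult)
  qed
  then have T: "ennreal c * ennreal (\<psi> x2) \<le> T ?F x2" for x2
    using mult_left_mono[OF c(2), of "ennreal (\<psi> x2)"] by (simp add: mult.commute)
  have "ennreal c * Lp_norm q lborel (\<lambda>x. ennreal (\<psi> x)) = Lp_norm q lborel (\<lambda>x. ennreal c * ennreal (\<psi> x))"
    using c p by (intro Lp_norm_cmult[symmetric]) auto
  also have "\<dots> \<le> Lp_norm q lborel (T ?F)"
    using p by (intro Lp_norm_mono T) auto
  also have "\<dots> \<le> ennreal C * pos_mixed_norm p1 p2 ?F"
    using nn by (intro bound) auto
  finally show ?thesis .
qed

text \<open>The support of the test function \<open>\<phi>(x\<^sub>1) \<psi>(x\<^sub>2)\<close>, where \<open>\<phi>\<close> and \<open>\<psi>\<close> are the indicators of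
the unit ball and of \<open>G\<close>.\<close>

definition "tube G = {z. norm (fst (Li z)) < 1 \<and> snd (Li z) \<in> G}"

text \<open>The slab and chain tests differ only in whether the slice bound \<open>a\<close> or the
  projection bound \<open>b\<close> follows the size \<open>g\<close> of \<open>G\<close>.
  \<open>V\<close> in the denominator is the lower bound for the kernel integrated over the unit
  ball.\<close>

lemma tube_test:
  assumes [measurable]: "G \<in> sets borel" "Y \<in> sets borel"
    and g: "0 < g" "ennreal g \<le> emeasure lborel G"
    and a: "0 < a" "\<And>y. emeasure lborel {u. (u, y) \<in> tube G} \<le> ennreal a"
    and Y: "\<And>z. z \<in> tube G \<Longrightarrow> snd z \<in> Y"
    and b: "0 < b" "emeasure lborel Y \<le> ennreal b"
  shows "g powr recip q \<le> C / V * (a powr recip p1 * b powr recip p2)"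
proof -
  have tube_eq: "(\<lambda>z. indicat_real (ball 0 1) (fst (Li z)) * indicat_real G (snd (Li z))) = indicat_real (tube G)"
    by (auto simp: tube_def indicator_def fun_eq_iff)
  have tube_meas: "tube G \<in> sets borel" unfolding tube_def by measurable
  have "(\<lambda>x. ennreal (indicat_real G x)) = indicator G" by (auto simp: indicator_def)
  then have "ennreal V * ennreal (g powr recip q) \<le> ennreal V * Lp_norm q lborel (\<lambda>x. ennreal (indicat_real G x))"
    using g p by (simp only:) (intro mult_left_mono Lp_norm_indicator_lower, auto)
  also have "\<dots> \<le> ennreal C * pos_mixed_norm p1 p2 (\<lambda>z. indicat_real (ball 0 1) (fst (Li z)) * indicat_real G (snd (Li z)))"
    using lam nn_integral_kernel_ball_lower[of lam, where 'a = "real^'n"] by (intro product_test) (auto simp: V_eq)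
  also have "\<dots> \<le> ennreal C * ennreal (a powr recip p1 * b powr recip p2)"
    unfolding tube_eq using a Y b p tube_meas by (intro mult_left_mono pos_mixed_norm_indicator_le[where Y = Y]) auto
  finally have "V * g powr recip q \<le> C * (a powr recip p1 * b powr recip p2)"
    using C by (simp add: ennreal_mult[symmetric])
  then show ?thesis by (simp add: field_simps)
qed

lemma unit_tube_bounded:
  "\<exists>\<rho> a. 0 < \<rho> \<and> 0 < a \<and> (\<forall>x. emeasure lborel (cball (x::real^'n) \<rho>) = ennreal a) \<and>
    (\<forall>z\<in>tube (cball 0 1). norm (fst z) \<le> \<rho> \<and> norm (snd z) \<le> \<rho>)"
proof -
  obtain B where B: "0 < B" "\<And>z. norm (L z) \<le> B * norm z"
    using linear_bounded_pos[OF linear_block_map] by blast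
  have "norm (fst z) \<le> 2 * B \<and> norm (snd z) \<le> 2 * B" if "z \<in> tube (cball 0 1)" for z
  proof -
    have "norm (Li z) \<le> norm (fst (Li z)) + norm (snd (Li z))"
      by (metis norm_Pair_le prod.collapse)
    also have "\<dots> \<le> 2" using that by (auto simp: tube_def)
    finally have "B * norm (Li z) \<le> B * 2" using B by simp
    then have "norm z \<le> 2 * B" using B(2)[of "Li z"] by simp
    moreover have "norm (fst z) \<le> norm z" "norm (snd z) \<le> norm z"
      by (metis norm_fst_le norm_snd_le prod.collapse)+
    ultimately show ?thesis by linarith
  qed
  moreover have "0 < 2 * B" using B by simp
  ultimately show ?thesis using emeasure_cball_pos[of "2 * B", where 'a = "real^'n"] by blast
qed

section \<open>Slab and chain tests\<close>

text \<open>A normal m to the range of A21 gives m \<bullet> y = w \<bullet> x2. A slab in x2 across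
  w is therefore thin in the projection to y, while its slices in u are merely bounded.\<close>

lemma thin_y:
  assumes "\<not> inj ((*v) A21)"
  shows "recip p2 \<le> recip q"
proof -
  obtain m where m: "m \<noteq> 0" "\<And>x. m \<bullet> (A21 *v x) = 0"
    using linear_not_inj_imp_annihilator[OF matrix_vector_mul_linear assms] by blast
  define w where "w = adjoint ((*v) A22) m"
  have w: "w \<bullet> x = m \<bullet> (A22 *v x)" for x
    unfolding w_def by (rule adjoint_clauses(2)[OF matrix_vector_mul_linear])
  have m_snd: "m \<bullet> snd z = w \<bullet> snd (Li z)" for z
  proof -
    have "snd z = A21 *v fst (Li z) + A22 *v snd (Li z)"
      using arg_cong[OF L_Li[of z], of snd] by (simp add: block_map_def)
    then show ?thesis using m by (simp add: inner_add_right w)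
  qed
  have w0: "w \<noteq> 0"
  proof
    assume "w = 0"
    \<comment> \<open>The identity holds for every z, so y = m can be inserted.\<close>
    then have "m \<bullet> snd ((0::real^'n), m) = 0" unfolding m_snd by simp
    then show False using m by simp
  qed
  obtain k c where k: "0 < k" and lower: "\<And>N. 1 \<le> N \<Longrightarrow> ennreal (k / real N) \<le> emeasure lborel (slab w 1 (c N) N)"
    using slab_measure_lower[OF w0] by blast
  obtain \<rho> a where \<rho>: "0 < \<rho>" "\<And>z. z \<in> tube (cball 0 1) \<Longrightarrow> norm (fst z) \<le> \<rho> \<and> norm (snd z) \<le> \<rho>"
    and a: "0 < a" "\<And>x. emeasure lborel (cball (x::real^'n) \<rho>) = ennreal a"
    using unit_tube_bounded by blast
  obtain K where K: "0 < K" and upper: "\<And>N c. 1 \<le> N \<Longrightarrow> emeasure lborel (slab m \<rho> c N) \<le> ennreal (K / real N)"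
    using slab_measure_upper[OF m(1), of \<rho>] \<rho> by auto
  have tube: "norm (fst z) \<le> \<rho> \<and> norm (snd z) \<le> \<rho> \<and> \<bar>w \<bullet> snd (Li z) - c N\<bar> \<le> 1 / real N"
    if "z \<in> tube (slab w 1 (c N) N)" for N z
    using \<rho>(2)[of z] that by (auto simp: tube_def slab_def)
  show ?thesis
  proof (rule inverse_scaled_powr_le_imp_le[OF k K])
    fix N :: nat assume N: "1 \<le> N"
    have "(k / real N) powr recip q \<le> C / V * (a powr recip p1 * (K / real N) powr recip p2)"
    proof (rule tube_test)
      show "ennreal (k / real N) \<le> emeasure lborel (slab w 1 (c N) N)" by (rule lower[OF N])
      fix y
      have "{u. (u, y) \<in> tube (slab w 1 (c N) N)} \<subseteq> cball 0 \<rho>" using tube by force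
      then show "emeasure lborel {u. (u, y) \<in> tube (slab w 1 (c N) N)} \<le> ennreal a"
        unfolding a(2)[of 0, symmetric] by (intro emeasure_mono) auto
    next
      fix z assume "z \<in> tube (slab w 1 (c N) N)"
      then show "snd z \<in> slab m \<rho> (c N) N"
        using tube[of z N] by (simp add: slab_def m_snd)
    next
      show "emeasure lborel (slab m \<rho> (c N) N) \<le> ennreal (K / real N)" by (rule upper[OF N])
    qed (use a k K N in auto)
    then show "(k / real N) powr recip q \<le> C / V * a powr recip p1 * (K / real N) powr recip p2"
      by (simp only: mult.assoc)
  qed
qed

text \<open>For fixed y, x2 depends affinely on u with linear part Q u =
  \<open>snd (Li (u, 0))\<close>. A slab across w = Q e then cuts out slabs in u across the adjoint
  image m of w, which is nonzero as m \<bullet> e = |w|^2.\<close>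

lemma thin_u:
  assumes e: "snd (Li (e, 0)) \<noteq> 0"
  shows "recip p1 \<le> recip q"
proof -
  define w where "w = snd (Li (e, 0))"
  define m where "m = adjoint (\<lambda>u. snd (Li (u, 0))) w"
  have m: "m \<bullet> u = w \<bullet> snd (Li (u, 0))" for u
    unfolding m_def by (rule adjoint_clauses(2)[OF linear_Q])
  have w0: "w \<noteq> 0" using e by (simp add: w_def)
  have "m \<bullet> e \<noteq> 0" unfolding m using w0 by (simp add: w_def)
  then have m0: "m \<noteq> 0" by auto
  obtain k c where k: "0 < k" and lower: "\<And>N. 1 \<le> N \<Longrightarrow> ennreal (k / real N) \<le> emeasure lborel (slab w 1 (c N) N)"
    using slab_measure_lower[OF w0] by blast
  obtain \<rho> a where \<rho>: "0 < \<rho>" "\<And>z. z \<in> tube (cball 0 1) \<Longrightarrow> norm (fst z) \<le> \<rho> \<and> norm (snd z) \<le> \<rho>"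
    and a: "0 < a" "\<And>x. emeasure lborel (cball (x::real^'n) \<rho>) = ennreal a"
    using unit_tube_bounded by blast
  obtain K where K: "0 < K" and upper: "\<And>N c. 1 \<le> N \<Longrightarrow> emeasure lborel (slab m \<rho> c N) \<le> ennreal (K / real N)"
    using slab_measure_upper[OF m0, of \<rho>] \<rho> by auto
  have tube: "norm (fst z) \<le> \<rho> \<and> norm (snd z) \<le> \<rho> \<and> \<bar>w \<bullet> snd (Li z) - c N\<bar> \<le> 1 / real N"
    if "z \<in> tube (slab w 1 (c N) N)" for N z
    using \<rho>(2)[of z] that by (auto simp: tube_def slab_def)
  show ?thesis
  proof (rule inverse_scaled_powr_le_imp_le[OF k K])
    fix N :: nat assume N: "1 \<le> N"
    have "(k / real N) powr recip q \<le> C / V * ((K / real N) powr recip p1 * a powr recip p2)"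
    proof (rule tube_test)
      show "ennreal (k / real N) \<le> emeasure lborel (slab w 1 (c N) N)" by (rule lower[OF N])
      show "cball (0::real^'n) \<rho> \<in> sets borel" by simp
      fix y
      \<comment> \<open>The fixed y only shifts the centre of the slab; the upper bound for slabs is
        uniform in it.\<close>
      let ?c = "c N - w \<bullet> snd (Li (0, y))"
      have "(u, y) \<in> tube (slab w 1 (c N) N) \<Longrightarrow> u \<in> slab m \<rho> ?c N" for u
        using tube[of "(u, y)" N] by (simp add: slab_def m Li_split[of u y] inner_add_right algebra_simps)
      then have "emeasure lborel {u. (u, y) \<in> tube (slab w 1 (c N) N)} \<le> emeasure lborel (slab m \<rho> ?c N)"
        by (intro emeasure_mono) auto
      also have "\<dots> \<le> ennreal (K / real N)" by (rule upper[OF N])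
      finally show "emeasure lborel {u. (u, y) \<in> tube (slab w 1 (c N) N)} \<le> ennreal (K / real N)" .
    next
      fix z assume "z \<in> tube (slab w 1 (c N) N)"
      then show "snd z \<in> cball 0 \<rho>" using tube[of z N] by simp
    qed (use a k K N in auto)
    then show "(k / real N) powr recip q \<le> C / V * a powr recip p2 * (K / real N) powr recip p1"
      by (simp only: ac_simps)
  qed
qed

text \<open>A tube over unit balls centred at j w is mapped into translates by j L (0, w) of one
  bounded set, hence runs along A12 w in u and along A22 w in y.\<close>

lemma long_chain:
  assumes v: "v \<noteq> 0"
  obtains w a \<rho> where "0 < a" "2 < norm w" "A22 *v v \<noteq> 0 \<longrightarrow> 2 * \<rho> < norm (A22 *v w)" "A22 *v v = 0 \<longrightarrow> A22 *v w = 0"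
    "\<forall>x. emeasure lborel (cball (x::real^'n) \<rho>) = ennreal a"
    "\<forall>N. \<forall>z\<in>tube (\<Union>j<N. ball (real j *\<^sub>R w) 1). \<exists>j<N.
      fst z \<in> cball (real j *\<^sub>R (A12 *v w)) \<rho> \<and> snd z \<in> cball (real j *\<^sub>R (A22 *v w)) \<rho>"
proof -
  obtain \<rho> a where \<rho>: "0 < \<rho>" "\<And>z. z \<in> tube (cball 0 1) \<Longrightarrow> norm (fst z) \<le> \<rho> \<and> norm (snd z) \<le> \<rho>"
    and a: "0 < a" "\<And>x. emeasure lborel (cball (x::real^'n) \<rho>) = ennreal a"
    using unit_tube_bounded by blast
  \<comment> \<open>The first term makes the unit balls disjoint, the second separates the
    projections of radius \<rho> in y. If A22 v = 0, the second is a division by zero with value 0,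
    so the first decides.\<close>
  define t where "t = max (3 / norm v) ((2 * \<rho> + 1) / norm (A22 *v v))"
  have t0: "0 < t" using v by (simp add: t_def less_max_iff_disj)
  have "3 / norm v * norm v \<le> t * norm v" by (intro mult_right_mono) (auto simp: t_def)
  then have tv: "2 < norm (t *\<^sub>R v)" using v t0 by simp
  have "(2 * \<rho> + 1) / norm (A22 *v v) * norm (A22 *v v) \<le> t * norm (A22 *v v)"
    by (intro mult_right_mono) (auto simp: t_def)
  then have tw: "2 * \<rho> < norm (A22 *v (t *\<^sub>R v))" if "A22 *v v \<noteq> 0"
    using that t0 by (simp add: matrix_vector_mult_scaleR)
  let ?w = "t *\<^sub>R v"
  have chain: "\<exists>j<N. fst z \<in> cball (real j *\<^sub>R (A12 *v ?w)) \<rho> \<and> snd z \<in> cball (real j *\<^sub>R (A22 *v ?w)) \<rho>"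
    if z: "z \<in> tube (\<Union>j<N. ball (real j *\<^sub>R ?w) 1)" for N z
  proof -
    obtain j where j: "j < N" "snd (Li z) \<in> ball (real j *\<^sub>R ?w) 1"
      using z by (auto simp: tube_def)
    let ?s = "(0::real^'n, real j *\<^sub>R ?w)"
    have Ls: "L ?s = (real j *\<^sub>R (A12 *v ?w), real j *\<^sub>R (A22 *v ?w))"
      by (simp add: block_map_def matrix_vector_mult_scaleR)
    have "Li (z - L ?s) = Li z - ?s"
      using linear_diff[OF linear_Li, of z "L ?s"] by simp
    then have "z - L ?s \<in> tube (cball 0 1)"
      using z j by (auto simp: tube_def dist_norm norm_minus_commute)
    moreover have "z - L ?s = (fst z - real j *\<^sub>R (A12 *v ?w), snd z - real j *\<^sub>R (A22 *v ?w))"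
      by (simp only: Ls) (simp add: prod_eq_iff)
    ultimately show ?thesis using \<rho>(2)[of "z - L ?s"] j(1)
      by (intro exI[of _ j]) (auto simp only: fst_conv snd_conv mem_cball dist_norm norm_minus_commute)
  qed
  show ?thesis by (rule that[OF a(1) tv]) (use tw a(2) chain in \<open>auto simp: matrix_vector_mult_scaleR\<close>)
qed

text \<open>The pieces separate in y, so each y meets at most one of them: slices stay bounded while
  the projection grows like N.\<close>

lemma long_y:
  assumes v: "A22 *v v \<noteq> 0"
  shows "recip q \<le> recip p2"
proof -
  have v0: "v \<noteq> 0" using v by auto
  obtain w a \<rho> where a0: "0 < a" and w: "2 < norm w" and tw': "A22 *v v \<noteq> 0 \<longrightarrow> 2 * \<rho> < norm (A22 *v w)"
    and "A22 *v v = 0 \<longrightarrow> A22 *v w = 0"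
    and a': "\<forall>x. emeasure lborel (cball (x::real^'n) \<rho>) = ennreal a"
    and chain': "\<forall>N. \<forall>z\<in>tube (\<Union>j<N. ball (real j *\<^sub>R w) 1). \<exists>j<N.
      fst z \<in> cball (real j *\<^sub>R (A12 *v w)) \<rho> \<and> snd z \<in> cball (real j *\<^sub>R (A22 *v w)) \<rho>"
    by (rule long_chain[OF v0])
  note a = a'[rule_format] and chain = chain'[THEN spec, THEN bspec] and tw = tw'[rule_format]
  show ?thesis
  proof (rule scaled_powr_le_imp_le[OF V(1) a0])
    fix N :: nat assume N: "1 \<le> N"
    let ?G = "\<Union>j<N. ball (real j *\<^sub>R w) 1"
    let ?Y = "\<Union>j<N. cball (real j *\<^sub>R (A22 *v w)) \<rho>"
    have "(V * real N) powr recip q \<le> C / V * (a powr recip p1 * (a * real N) powr recip p2)"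
    proof (rule tube_test[where G = ?G and Y = ?Y])
      fix y
      show "emeasure lborel {u. (u, y) \<in> tube ?G} \<le> ennreal a"
      proof (cases "{u. (u, y) \<in> tube ?G} = {}")
        case False
        then obtain u0 where u0: "(u0, y) \<in> tube ?G" by blast
        obtain j0 where j0: "j0 < N" "y \<in> cball (real j0 *\<^sub>R (A22 *v w)) \<rho>"
          using chain[OF u0] unfolding snd_conv by blast
        have "{u. (u, y) \<in> tube ?G} \<subseteq> cball (real j0 *\<^sub>R (A12 *v w)) \<rho>"
        proof
          fix u assume "u \<in> {u. (u, y) \<in> tube ?G}"
          then have u: "(u, y) \<in> tube ?G" by blast
          obtain j where j: "u \<in> cball (real j *\<^sub>R (A12 *v w)) \<rho>" "y \<in> cball (real j *\<^sub>R (A22 *v w)) \<rho>"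
            using chain[OF u] unfolding fst_conv snd_conv by blast
          have "j = j0"
          proof (rule ccontr)
            assume "j \<noteq> j0"
            then have "1 \<le> \<bar>real j - real j0\<bar>" by (rule one_le_abs_diff_of_nat)
            then have "1 * norm (A22 *v w) \<le> \<bar>real j - real j0\<bar> * norm (A22 *v w)" by (intro mult_right_mono) auto
            also have "\<dots> = norm (real j *\<^sub>R (A22 *v w) - real j0 *\<^sub>R (A22 *v w))"
              by (simp add: scaleR_diff_left[symmetric])
            also have "\<dots> \<le> 2 * \<rho>"
              using j(2) j0(2) dist_triangle2[of "real j *\<^sub>R (A22 *v w)" "real j0 *\<^sub>R (A22 *v w)" y]
              by (simp add: dist_norm)
            finally show False using tw[OF v] by simp
          qed
          then show "u \<in> cball (real j0 *\<^sub>R (A12 *v w)) \<rho>" using j by simp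
        qed
        then have "emeasure lborel {u. (u, y) \<in> tube ?G} \<le> emeasure lborel (cball (real j0 *\<^sub>R (A12 *v w)) \<rho>)"
          by (intro emeasure_mono) auto
        then show ?thesis by (simp only: a)
      qed simp
    next
      fix z assume "z \<in> tube ?G"
      from chain[OF this] show "snd z \<in> ?Y" by blast
    next
      show "emeasure lborel ?Y \<le> ennreal (a * real N)" by (intro emeasure_chain_upper a)
      show "ennreal (V * real N) \<le> emeasure lborel ?G"
        using emeasure_chain_lower[OF w, of N] by (simp add: V_eq)
      show "?G \<in> sets borel" "?Y \<in> sets borel" by auto
    qed (use N a0 in auto)
    then show "(V * real N) powr recip q \<le> C / V * a powr recip p1 * (a * real N) powr recip p2"
      by (simp only: mult.assoc)
  qed
qed

text \<open>The chain does not move in y, so the projection stays in one ball and only the slices in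
  u can grow, at most like N.\<close>

lemma long_u:
  assumes v: "A22 *v v = 0" "v \<noteq> 0"
  shows "recip q \<le> recip p1"
proof -
  obtain w a \<rho> where a0: "0 < a" and w: "2 < norm w" and "A22 *v v \<noteq> 0 \<longrightarrow> 2 * \<rho> < norm (A22 *v w)"
    and A22w: "A22 *v v = 0 \<longrightarrow> A22 *v w = 0"
    and a': "\<forall>x. emeasure lborel (cball (x::real^'n) \<rho>) = ennreal a"
    and chain': "\<forall>N. \<forall>z\<in>tube (\<Union>j<N. ball (real j *\<^sub>R w) 1). \<exists>j<N.
      fst z \<in> cball (real j *\<^sub>R (A12 *v w)) \<rho> \<and> snd z \<in> cball (real j *\<^sub>R (A22 *v w)) \<rho>"
    by (rule long_chain[OF v(2)])
  note a = a'[rule_format] and chain = chain'[THEN spec, THEN bspec]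
  show ?thesis
  proof (rule scaled_powr_le_imp_le[OF V(1) a0])
    fix N :: nat assume N: "1 \<le> N"
    let ?G = "\<Union>j<N. ball (real j *\<^sub>R w) 1"
    have "(V * real N) powr recip q \<le> C / V * ((a * real N) powr recip p1 * a powr recip p2)"
    proof (rule tube_test[where G = ?G and Y = "cball 0 \<rho>"])
      fix y
      have "{u. (u, y) \<in> tube ?G} \<subseteq> (\<Union>j<N. cball (real j *\<^sub>R (A12 *v w)) \<rho>)"
      proof
        fix u assume "u \<in> {u. (u, y) \<in> tube ?G}"
        then have u: "(u, y) \<in> tube ?G" by blast
        show "u \<in> (\<Union>j<N. cball (real j *\<^sub>R (A12 *v w)) \<rho>)"
          using chain[OF u] unfolding fst_conv by blast
      qed
      then have "emeasure lborel {u. (u, y) \<in> tube ?G} \<le> emeasure lborel (\<Union>j<N. cball (real j *\<^sub>R (A12 *v w)) \<rho>)"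
        by (intro emeasure_mono) auto
      also have "\<dots> \<le> ennreal (a * real N)" by (intro emeasure_chain_upper a)
      finally show "emeasure lborel {u. (u, y) \<in> tube ?G} \<le> ennreal (a * real N)" .
    next
      fix z assume "z \<in> tube ?G"
      from chain[OF this] show "snd z \<in> cball 0 \<rho>" unfolding A22w[rule_format, OF v(1)] by auto
    next
      show "ennreal (V * real N) \<le> emeasure lborel ?G"
        using emeasure_chain_lower[OF w, of N] by (simp add: V_eq)
      show "?G \<in> sets borel" by auto
    qed (use N a0 a in auto)
    then show "(V * real N) powr recip q \<le> C / V * a powr recip p2 * (a * real N) powr recip p1"
      by (simp only: ac_simps)
  qed
qed

section \<open>Logarithmic tests\<close>

text \<open>Boundedness tested on \<eta>(y) g(x2) with y = A21 x1 + A22 x2. The weight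
  \<open>max (norm y) (norm x) powr - lam\<close> is what remains of the kernel |x1|^-lam.\<close>

definition "shear_bound K \<longleftrightarrow> 0 < K \<and>
  (\<forall>\<eta> \<in> borel_measurable (borel :: (real^'n) measure). \<forall>g \<in> borel_measurable (borel :: (real^'n) measure). \<forall>\<gamma>\<ge>0. \<forall>h\<ge>0.
    (\<forall>x. 0 \<le> \<eta> x) \<longrightarrow> (\<forall>x. 0 \<le> g x) \<longrightarrow>
    Lp_norm p1 lborel (\<lambda>x. ennreal (g x)) \<le> ennreal \<gamma> \<longrightarrow> Lp_norm p2 lborel (\<lambda>y. ennreal (\<eta> y)) \<le> ennreal h \<longrightarrow>
    Lp_norm q lborel (\<lambda>x. ennreal (g x) * (\<integral>\<^sup>+y. ennreal (\<eta> y * max (norm y) (norm x) powr - lam)))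
      \<le> ennreal (K * \<gamma> * h))"

text \<open>Invertibility of A21 enters three times: for fixed y, u corresponds to x2, which factors
  the mixed norm; for fixed x2, x1 corresponds to y, which gives the integral; and |x1| is bounded
  by |y| + |x2|.\<close>

lemma shear_test:
  assumes A21: "inj ((*v) A21)"
  shows "\<exists>K. shear_bound K"
proof -
  obtain B where B: "0 < B" and B_eq: "\<And>G v. G \<in> borel_measurable borel \<Longrightarrow>
      Lp_norm p1 lborel (\<lambda>u. G (snd (Li (u, 0)) + v)) = ennreal B * Lp_norm p1 lborel G"
    using Lp_norm_affine[OF linear_Q inj_Q[OF A21] p(1)] by blast
  obtain \<kappa> where \<kappa>: "0 < \<kappa>" "\<And>x1 x2. norm x1 \<le> \<kappa> * (norm (A21 *v x1 + A22 *v x2) + norm x2)"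
    using norm_le_shear[OF A21] by blast
  obtain c where c: "0 < c" and ceq: "\<And>f v. f \<in> borel_measurable borel \<Longrightarrow>
      (\<integral>\<^sup>+x. f (A21 *v x + v)) = ennreal c * (\<integral>\<^sup>+x. f x)"
    using nn_integral_lborel_linear[OF matrix_vector_mul_linear A21] by blast
  \<comment> \<open>\<open>c\<close> belongs to the substitution of y for x1, and 2 \<kappa> to |x1|
    \<le> 2 \<kappa> max(|y|, |x2|).\<close>
  define D where "D = (2 * \<kappa>) powr - lam * c"
  have D: "0 < D" using \<kappa> c by (simp add: D_def)
  show ?thesis
    unfolding shear_bound_def
  proof (intro exI[of _ "C * B / D"] conjI ballI allI impI)
    show "0 < C * B / D" using C B D by simp
    fix \<eta> g :: "real^'n \<Rightarrow> real" and \<gamma> h :: real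
    assume [measurable]: "\<eta> \<in> borel_measurable borel" "g \<in> borel_measurable borel"
      and nn': "\<forall>x. 0 \<le> \<eta> x" "\<forall>x. 0 \<le> g x" and \<gamma>h: "0 \<le> \<gamma>" "0 \<le> h"
      and g: "Lp_norm p1 lborel (\<lambda>x. ennreal (g x)) \<le> ennreal \<gamma>"
      and \<eta>: "Lp_norm p2 lborel (\<lambda>y. ennreal (\<eta> y)) \<le> ennreal h"
    have nn: "0 \<le> \<eta> x" "0 \<le> g x" for x using nn' by auto
    define F where "F z = \<eta> (snd z) * g (snd (Li z))" for z
    have [measurable]: "F \<in> borel_measurable borel" unfolding F_def by measurable
    let ?J = "\<lambda>x. \<integral>\<^sup>+y. ennreal (\<eta> y * max (norm y) (norm x) powr - lam)"
    have lower: "ennreal D * (ennreal (g x2) * ?J x2) \<le> T F x2" for x2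
    proof -
      let ?y = "\<lambda>x1. A21 *v x1 + A22 *v x2"
      let ?M = "\<lambda>y. max (norm y) (norm x2)"
      have "ennreal D * (ennreal (g x2) * ?J x2) = ennreal ((2 * \<kappa>) powr - lam * g x2) * (ennreal c * ?J x2)"
        using c nn by (simp add: D_def ennreal_mult ac_simps)
      also have "ennreal c * ?J x2 = (\<integral>\<^sup>+x1. ennreal (\<eta> (?y x1) * ?M (?y x1) powr - lam))"
        by (rule ceq[symmetric, where f = "\<lambda>y. ennreal (\<eta> y * ?M y powr - lam)"]) measurable
      also have "ennreal ((2 * \<kappa>) powr - lam * g x2) * \<dots>
        = (\<integral>\<^sup>+x1. ennreal ((2 * \<kappa>) powr - lam * g x2) * ennreal (\<eta> (?y x1) * ?M (?y x1) powr - lam))"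
        by (rule nn_integral_cmult[symmetric]) measurable
      also have "\<dots> \<le> T F x2"
        unfolding pos_T_def
      proof (rule nn_integral_mono_AE)
        have "AE x1 in lborel. x1 \<noteq> (0::real^'n)" by (rule AE_lborel_singleton)
        then show "AE x1 in lborel. ennreal ((2 * \<kappa>) powr - lam * g x2) * ennreal (\<eta> (?y x1) * ?M (?y x1) powr - lam)
          \<le> ennreal (F (L (x1, x2)) * norm x1 powr - lam)"
        proof eventually_elim
          case (elim x1)
          have "snd (L (x1, x2)) = ?y x1" by (simp add: block_map_def)
          then have F: "F (L (x1, x2)) = \<eta> (?y x1) * g x2" by (simp add: F_def)
          have "\<kappa> * (norm (?y x1) + norm x2) \<le> \<kappa> * (2 * ?M (?y x1))"
            using \<kappa>(1) by (intro mult_left_mono) auto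
          then have "norm x1 \<le> 2 * \<kappa> * ?M (?y x1)" using \<kappa>(2)[of x1 x2] by (simp add: ac_simps)
          then have "(2 * \<kappa> * ?M (?y x1)) powr - lam \<le> norm x1 powr - lam"
            using elim lam by (intro powr_mono2') auto
          moreover have "0 \<le> ?M (?y x1)" by (simp add: le_max_iff_disj)
          ultimately have "(2 * \<kappa>) powr - lam * ?M (?y x1) powr - lam \<le> norm x1 powr - lam"
            using \<kappa>(1) by (simp add: powr_mult)
          then have "(\<eta> (?y x1) * g x2) * ((2 * \<kappa>) powr - lam * ?M (?y x1) powr - lam)
            \<le> (\<eta> (?y x1) * g x2) * norm x1 powr - lam"
            using nn by (intro mult_left_mono) auto
          then show ?case unfolding F using nn
            by (subst ennreal_mult[symmetric]) (auto simp: ac_simps intro!: ennreal_leI)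
        qed
      qed
      finally show ?thesis .
    qed
    have inner: "Lp_norm p1 lborel (\<lambda>u. ennreal (F (u, y))) \<le> ennreal (B * \<gamma>) * ennreal (\<eta> y)" for y
    proof -
      have "F (u, y) = \<eta> y * g (snd (Li (u, 0)) + snd (Li (0, y)))" for u
        by (simp add: F_def Li_split[of u y])
      then have eq: "(\<lambda>u. ennreal (F (u, y))) = (\<lambda>u. ennreal (\<eta> y) * ennreal (g (snd (Li (u, 0)) + snd (Li (0, y)))))"
        using nn by (simp add: ennreal_mult)
      have "Lp_norm p1 lborel (\<lambda>u. ennreal (F (u, y))) \<le> ennreal (\<eta> y) * Lp_norm p1 lborel (\<lambda>u. ennreal (g (snd (Li (u, 0)) + snd (Li (0, y)))))"
        unfolding eq using nn p by (intro Lp_norm_cmult_le) auto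
      also have "\<dots> = ennreal (\<eta> y) * (ennreal B * Lp_norm p1 lborel (\<lambda>x. ennreal (g x)))"
        by (subst B_eq[of "\<lambda>x. ennreal (g x)"]) auto
      also have "\<dots> \<le> ennreal (\<eta> y) * (ennreal B * ennreal \<gamma>)"
        using g by (intro mult_left_mono) auto
      finally show ?thesis using B \<gamma>h by (simp add: ennreal_mult ac_simps)
    qed
    have m: "(\<lambda>y. Lp_norm p1 lborel (\<lambda>u. ennreal (F (u, y)))) \<in> borel_measurable borel"
      using p by (intro borel_measurable_Lp_norm_slice[where h = "\<lambda>z. ennreal (F z)"]) auto
    have "pos_mixed_norm p1 p2 F \<le> Lp_norm p2 lborel (\<lambda>y. ennreal (B * \<gamma>) * ennreal (\<eta> y))"
      unfolding pos_mixed_norm_def using m inner p by (intro Lp_norm_mono) auto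
    also have "\<dots> \<le> ennreal (B * \<gamma>) * Lp_norm p2 lborel (\<lambda>y. ennreal (\<eta> y))"
      using B \<gamma>h p by (intro Lp_norm_cmult_le) auto
    also have "\<dots> \<le> ennreal (B * \<gamma>) * ennreal h" using \<eta> by (intro mult_left_mono) auto
    finally have mixed: "pos_mixed_norm p1 p2 F \<le> ennreal (B * \<gamma>) * ennreal h" .
    have "ennreal D * Lp_norm q lborel (\<lambda>x. ennreal (g x) * ?J x) = Lp_norm q lborel (\<lambda>x. ennreal D * (ennreal (g x) * ?J x))"
      using D p by (intro Lp_norm_cmult[symmetric]) auto
    also have "\<dots> \<le> Lp_norm q lborel (T F)"
      using p by (intro Lp_norm_mono lower) auto
    also have "\<dots> \<le> ennreal C * pos_mixed_norm p1 p2 F"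
      using nn by (intro bound) (auto simp: F_def)
    also have "\<dots> \<le> ennreal C * (ennreal (B * \<gamma>) * ennreal h)" using mixed by (intro mult_left_mono) auto
    finally have "ennreal (1 / D) * (ennreal D * Lp_norm q lborel (\<lambda>x. ennreal (g x) * ?J x))
      \<le> ennreal (1 / D) * (ennreal C * (ennreal (B * \<gamma>) * ennreal h))"
      by (intro mult_left_mono) auto
    then show "Lp_norm q lborel (\<lambda>x. ennreal (g x) * ?J x) \<le> ennreal (C * B / D * \<gamma> * h)"
      using C B D \<gamma>h by (simp add: mult.assoc[symmetric] ennreal_mult[symmetric])
  qed
qed

text \<open>When p1 = q, scaling gives n/p2 + lam = n. With g the indicator of the unit ball and
  \<eta> = |y|^(-n/p2) on annuli outside it, the maximum is |y| and the integral is the critical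
  one: h is bounded by a multiple of h^(1/p2).\<close>

lemma log_shear:
  assumes A21: "inj ((*v) A21)" and eq: "recip p1 = recip q"
  shows "1 \<le> recip p2"
proof -
  let ?n = "real CARD('n)"
  have n: "?n * recip p2 + lam = ?n"
    using scaling eq lam by (simp add: field_simps)
  obtain K where "shear_bound K" using shear_test[OF A21] by blast
  note K = this[unfolded shear_bound_def, THEN conjunct1]
    and bd = this[unfolded shear_bound_def, THEN conjunct2, rule_format]
  show ?thesis
  proof (rule powr_le_powr_imp_le)
    fix M :: real
    obtain J h where h: "0 < h" "M \<le> h" and H: "ring_integral TYPE(real^'n) 1 (2 ^ J) = ennreal h"
      using ring_integral_large[of "\<lambda>_. 1" M, where 'a = "real^'n"] by auto
    define \<eta> where "\<eta> = (ring_power (?n * recip p2) 1 (2 ^ J) :: real^'n \<Rightarrow> real)"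
    let ?g = "indicat_real (ball (0::real^'n) 1)"
    have J: "ennreal (?g x) * (\<integral>\<^sup>+y. ennreal (\<eta> y * max (norm y) (norm x) powr - lam))
      = ennreal h * indicator (ball 0 1) x" for x
    proof (cases "norm x < 1")
      case True
      have "\<eta> y * max (norm y) (norm x) powr - lam = ring_power (?n) 1 (2 ^ J) y" for y
      proof (cases "y \<in> ring_set 1 (2 ^ J)")
        case y: True
        then have "max (norm y) (norm x) = norm y" using True by (simp add: ring_set_def max_def)
        then show ?thesis by (simp add: \<eta>_def ring_power_mult n)
      qed (simp add: \<eta>_def ring_power_def)
      then show ?thesis using True H by (simp add: ring_integral_def)
    qed simp
    have "ennreal h * ennreal (V powr recip q) \<le> ennreal h * Lp_norm q lborel (indicator (ball (0::real^'n) 1))"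
      using p by (intro mult_left_mono Lp_norm_indicator_lower) (auto simp: emeasure_unit_ball)
    also have "\<dots> = Lp_norm q lborel (\<lambda>x. ennreal h * indicator (ball (0::real^'n) 1) x)"
      using p h by (intro Lp_norm_cmult[symmetric]) auto
    also have "\<dots> \<le> ennreal (K * V powr recip p1 * h powr recip p2)"
      unfolding J[symmetric]
    proof (intro bd)
      show "Lp_norm p1 lborel (\<lambda>x. ennreal (?g x)) \<le> ennreal (V powr recip p1)"
        unfolding indicat_real_ball using p by (intro Lp_norm_indicator_upper) (auto simp: emeasure_unit_ball)
      show "Lp_norm p2 lborel (\<lambda>y. ennreal (\<eta> y)) \<le> ennreal (h powr recip p2)"
        using p h Lp_norm_ring_power_le[OF p(2) H h(1)] by (simp add: \<eta>_def)
    qed (auto simp: \<eta>_def)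
    finally have "h * V powr recip q \<le> K * V powr recip p1 * h powr recip p2"
      using K h by (simp add: ennreal_mult[symmetric])
    then have "h powr 1 \<le> K * V powr recip p1 / V powr recip q * h powr recip p2"
      using h by (simp add: field_simps)
    then show "\<exists>h\<ge>M. h powr 1 \<le> K * V powr recip p1 / V powr recip q * h powr recip p2"
      using h by blast
  qed
qed

text \<open>The mirror image: \<eta> is the indicator of the unit ball and g = |x|^(-n/p1) on an
  outer annulus. When p2 = 1 the kernel turns g into |x|^(-n/q), and h^(1/q) is compared with
  h^(1/p1).\<close>

lemma endpoint_p2:
  assumes A21: "inj ((*v) A21)" and eq: "recip p2 = 1"
  shows "recip q \<le> recip p1"
proof -
  let ?n = "real CARD('n)"
  have n: "?n * recip p1 + lam = ?n * recip q"
    using scaling eq lam by (simp add: field_simps)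
  have "recip q \<noteq> 0"
  proof
    assume "recip q = 0"
    then have "?n * recip p1 + lam = 0" using n by simp
    moreover have "0 \<le> ?n * recip p1" by simp
    ultimately show False using lam(1) by linarith
  qed
  then have q: "q \<noteq> \<infinity>" by auto
  obtain K where "shear_bound K" using shear_test[OF A21] by blast
  note K = this[unfolded shear_bound_def, THEN conjunct1]
    and bd = this[unfolded shear_bound_def, THEN conjunct2, rule_format]
  show ?thesis
  proof (rule powr_le_powr_imp_le)
    fix M :: real
    obtain J h where h: "0 < h" "M \<le> h" and H: "ring_integral TYPE(real^'n) 1 (2 ^ J) = ennreal h"
      using ring_integral_large[of "\<lambda>_. 1" M, where 'a = "real^'n"] by auto
    define g where "g = (ring_power (?n * recip p1) 1 (2 ^ J) :: real^'n \<Rightarrow> real)"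
    let ?\<eta> = "indicat_real (ball (0::real^'n) 1)"
    have J: "ennreal (g x) * (\<integral>\<^sup>+y. ennreal (?\<eta> y * max (norm y) (norm x) powr - lam))
      = ennreal V * ennreal (ring_power (?n * recip q) 1 (2 ^ J) x)" for x
    proof (cases "x \<in> ring_set 1 (2 ^ J)")
      case True
      have "ennreal (?\<eta> y * max (norm y) (norm x) powr - lam) = ennreal (norm x powr - lam) * indicator (ball 0 1) y" for y
        using True by (auto simp: ring_set_def indicator_def max_def)
      then have "(\<integral>\<^sup>+y. ennreal (?\<eta> y * max (norm y) (norm x) powr - lam)) = ennreal (norm x powr - lam) * ennreal V"
        by (simp add: nn_integral_cmult_indicator emeasure_unit_ball)
      moreover have "ennreal (g x) * ennreal (norm x powr - lam) = ennreal (ring_power (?n * recip q) 1 (2 ^ J) x)"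
        by (simp add: g_def ennreal_mult[symmetric] ring_power_mult n)
      ultimately show ?thesis by (metis mult.assoc mult.commute)
    qed (simp add: ring_power_def g_def)
    have "ennreal V * ennreal (h powr recip q) = ennreal V * Lp_norm q lborel (\<lambda>x::real^'n. ennreal (ring_power (?n * recip q) 1 (2 ^ J) x))"
      using Lp_norm_ring_power[OF p(3) q H h(1)] by simp
    also have "\<dots> = Lp_norm q lborel (\<lambda>x::real^'n. ennreal V * ennreal (ring_power (?n * recip q) 1 (2 ^ J) x))"
      using p by (intro Lp_norm_cmult[symmetric]) auto
    also have "\<dots> \<le> ennreal (K * h powr recip p1 * V powr recip p2)"
      unfolding J[symmetric]
    proof (intro bd)
      show "Lp_norm p2 lborel (\<lambda>x. ennreal (?\<eta> x)) \<le> ennreal (V powr recip p2)"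
        unfolding indicat_real_ball using p by (intro Lp_norm_indicator_upper) (auto simp: emeasure_unit_ball)
      show "Lp_norm p1 lborel (\<lambda>y. ennreal (g y)) \<le> ennreal (h powr recip p1)"
        using p h Lp_norm_ring_power_le[OF p(1) H h(1)] by (simp add: g_def)
    qed (auto simp: g_def)
    finally have "V * h powr recip q \<le> K * h powr recip p1 * V powr recip p2"
      using K h by (simp add: ennreal_mult[symmetric])
    then have "h powr recip q \<le> K * V powr recip p2 / V * h powr recip p1"
      by (simp add: field_simps)
    then show "\<exists>h\<ge>M. h powr recip q \<le> K * V powr recip p2 / V * h powr recip p1"
      using h by blast
  qed
qed

lemma log_product_test:
  assumes n: "real CARD('n) * recip p1 + lam = real CARD('n)"
    and H: "ring_integral TYPE(real^'n) a b = ennreal h" and h: "0 < h"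
  shows "ennreal (V powr recip q / C * h) \<le> pos_mixed_norm p1 p2
      (\<lambda>z. ring_power (real CARD('n) * recip p1) a b (fst (Li z)) * indicat_real (ball 0 1) (snd (Li z)))" (is "_ \<le> ?N")
proof -
  have "ennreal h * ennreal (V powr recip q) \<le> ennreal h * Lp_norm q lborel (\<lambda>x. ennreal (indicat_real (ball (0::real^'n) 1) x))"
    unfolding indicat_real_ball using p by (intro mult_left_mono Lp_norm_indicator_lower) (auto simp: emeasure_unit_ball)
  also have "\<dots> \<le> ennreal C * ?N"
    using h by (intro product_test) (auto simp: ring_power_mult n H[symmetric] ring_integral_def)
  finally have "ennreal (1 / C) * (ennreal h * ennreal (V powr recip q)) \<le> ennreal (1 / C) * (ennreal C * ?N)"
    by (intro mult_left_mono) auto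
  then show ?thesis
    using C h by (simp add: mult.assoc[symmetric] ennreal_mult[symmetric] ac_simps)
qed

text \<open>Here \<phi> = |x1|^(-n/p1) has critical integral h against the kernel. By
  \<open>inj_P\<close> its norm in u is at most a multiple of h^(1/p1), and annuli shrinking towards
  0 keep the support in the unit tube, so y stays bounded.\<close>

lemma log_product_A22:
  assumes A22: "inj ((*v) A22)" and eq: "recip p2 = recip q"
  shows "1 \<le> recip p1"
proof -
  let ?n = "real CARD('n)"
  have n: "?n * recip p1 + lam = ?n"
    using scaling eq lam by (simp add: field_simps)
  define D where "D = V powr recip q / C"
  have D: "0 < D" using C by (simp add: D_def)
  obtain \<rho> A where \<rho>: "0 < \<rho>" "\<And>z. z \<in> tube (cball 0 1) \<Longrightarrow> norm (fst z) \<le> \<rho> \<and> norm (snd z) \<le> \<rho>"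
    and A: "0 < A" "\<And>x. emeasure lborel (cball (x::real^'n) \<rho>) = ennreal A"
    using unit_tube_bounded by blast
  obtain K where K: "0 < K" and K_eq: "\<And>G v. G \<in> borel_measurable borel \<Longrightarrow>
      Lp_norm p1 lborel (\<lambda>u. G (fst (Li (u, 0)) + v)) = ennreal K * Lp_norm p1 lborel G"
    using Lp_norm_affine[OF linear_P inj_P[OF A22] p(1)] by blast
  show ?thesis
  proof (rule powr_le_powr_imp_le)
    fix M :: real
    obtain a h where h: "0 < h" "M \<le> h" and a: "0 < a" and H: "ring_integral TYPE(real^'n) a 1 = ennreal h"
      using ring_integral_large_near_0[of M] by blast
    define \<phi> where "\<phi> = (ring_power (?n * recip p1) a 1 :: real^'n \<Rightarrow> real)"
    have [measurable]: "\<phi> \<in> borel_measurable borel" by (simp add: \<phi>_def)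
    define F where "F z = \<phi> (fst (Li z)) * indicat_real (ball 0 1) (snd (Li z))" for z
    have [measurable]: "F \<in> borel_measurable borel" unfolding F_def by measurable
    have inner: "Lp_norm p1 lborel (\<lambda>u. ennreal (F (u, y))) \<le> ennreal (K * h powr recip p1) * indicator (cball 0 \<rho>) y" for y
    proof (cases "norm y \<le> \<rho>")
      case True
      have "F (u, y) \<le> \<phi> (fst (Li (u, 0)) + fst (Li (0, y)))" for u
        by (simp add: F_def Li_split[of u y] \<phi>_def indicator_def)
      then have "Lp_norm p1 lborel (\<lambda>u. ennreal (F (u, y))) \<le> Lp_norm p1 lborel (\<lambda>u. ennreal (\<phi> (fst (Li (u, 0)) + fst (Li (0, y)))))"
        using p by (intro Lp_norm_mono ennreal_leI) auto
      also have "\<dots> = ennreal K * Lp_norm p1 lborel (\<lambda>x. ennreal (\<phi> x))"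
        by (rule K_eq[of "\<lambda>x. ennreal (\<phi> x)"]) measurable
      also have "\<dots> \<le> ennreal K * ennreal (h powr recip p1)"
        using Lp_norm_ring_power_le[OF p(1) H h(1)] by (intro mult_left_mono) (auto simp: \<phi>_def)
      finally show ?thesis using True K by (simp add: ennreal_mult)
    next
      case False
      have "F (u, y) = 0" for u
      proof (rule ccontr)
        assume "F (u, y) \<noteq> 0"
        then have "(u, y) \<in> tube (cball 0 1)"
          by (auto simp: F_def \<phi>_def ring_power_def tube_def indicator_def ring_set_def split: if_splits)
        then show False using \<rho>(2) False by fastforce
      qed
      then show ?thesis using p by (simp add: Lp_norm_zero)
    qed
    have m: "(\<lambda>y. Lp_norm p1 lborel (\<lambda>u. ennreal (F (u, y)))) \<in> borel_measurable borel"
      using p by (intro borel_measurable_Lp_norm_slice[where h = "\<lambda>z. ennreal (F z)"]) auto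
    have "ennreal (D * h) \<le> pos_mixed_norm p1 p2 F"
      unfolding F_def \<phi>_def D_def by (rule log_product_test[OF n H h(1)])
    also have "\<dots> \<le> Lp_norm p2 lborel (\<lambda>y. ennreal (K * h powr recip p1) * indicator (cball (0::real^'n) \<rho>) y)"
      unfolding pos_mixed_norm_def using m inner p by (intro Lp_norm_mono) auto
    also have "\<dots> \<le> ennreal (K * h powr recip p1) * Lp_norm p2 lborel (indicator (cball (0::real^'n) \<rho>))"
      using K p by (intro Lp_norm_cmult_le) auto
    also have "\<dots> \<le> ennreal (K * h powr recip p1) * ennreal (A powr recip p2)"
      using p A by (intro mult_left_mono Lp_norm_indicator_upper) auto
    finally have "D * h \<le> K * h powr recip p1 * A powr recip p2"
      using K by (simp add: ennreal_mult[symmetric])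
    then have "h powr 1 \<le> K * A powr recip p2 / D * h powr recip p1"
      using D h by (simp add: field_simps)
    then show "\<exists>h\<ge>M. h powr 1 \<le> K * A powr recip p2 / D * h powr recip p1"
      using h by blast
  qed
qed

text \<open>With p1 = p2 the mixed norm is a plain norm on pairs, which every linear isomorphism
  changes only by a factor. This settles the case in which both A21 and A22 are singular.\<close>

lemma log_product_diagonal:
  assumes eq: "p1 = q" "p2 = q"
  shows "1 \<le> recip p1"
proof -
  let ?n = "real CARD('n)"
  have n: "?n * recip p1 + lam = ?n"
    using scaling eq lam by (simp add: field_simps)
  define i where "i = recip p1"
  have "0 < ?n * recip p1" using n lam by linarith
  then have i: "0 < i" unfolding i_def by (simp add: zero_less_mult_iff)
  then have fin: "p1 \<noteq> \<infinity>" by (auto simp: i_def)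
  define D where "D = V powr recip q / C"
  have D: "0 < D" using C by (simp add: D_def)
  have pp: "p2 = p1" using eq by simp
  have injLi: "inj Li" by (metis L_Li injI)
  obtain c where c: "0 < c" and ceq: "\<And>f v. f \<in> borel_measurable borel \<Longrightarrow>
      (\<integral>\<^sup>+z. f (Li z + v)) = ennreal c * (\<integral>\<^sup>+z. f z)"
    using nn_integral_lborel_linear[OF linear_Li injLi] by blast
  show ?thesis
  proof (rule powr_le_powr_imp_le)
    fix M :: real
    obtain a h where h: "0 < h" "M \<le> h" and a: "0 < a" and H: "ring_integral TYPE(real^'n) a 1 = ennreal h"
      using ring_integral_large_near_0[of M] by blast
    define G where "G z = ennreal (ring_power ?n a 1 (fst z)) * indicator (ball (0::real^'n) 1) (snd z)"
      for z :: "(real^'n) \<times> (real^'n)"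
    have [measurable]: "G \<in> borel_measurable borel" unfolding G_def by measurable
    let ?F = "\<lambda>z. ring_power (?n * recip p1) a 1 (fst (Li z)) * indicat_real (ball 0 1) (snd (Li z))"
    have F_G: "epowr (ennreal (?F z)) (1 / recip p1) = G (Li z)" for z
      using i by (simp add: G_def i_def ring_power_def indicator_def epowr_ennreal powr_powr)
    have "(\<integral>\<^sup>+z. G z) = (\<integral>\<^sup>+z. G z \<partial>(lborel \<Otimes>\<^sub>M lborel))"
      by (simp add: lborel_prod)
    also have "\<dots> = (\<integral>\<^sup>+y. \<integral>\<^sup>+x. G (x, y))"
      by (rule lborel_pair.nn_integral_snd[symmetric]) (simp add: lborel_prod)
    also have "\<dots> = (\<integral>\<^sup>+y. ennreal h * indicator (ball (0::real^'n) 1) y)"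
      by (simp add: G_def nn_integral_multc H[symmetric] ring_integral_def)
    also have "\<dots> = ennreal h * ennreal V"
      by (subst nn_integral_cmult_indicator) (auto simp: emeasure_unit_ball)
    finally have G_int: "(\<integral>\<^sup>+z. G z) = ennreal (h * V)" using h by (simp add: ennreal_mult)
    have "pos_mixed_norm p1 p2 ?F = epowr (\<integral>\<^sup>+y. \<integral>\<^sup>+x. G (Li (x, y))) i"
      unfolding pos_mixed_norm_def pp Lp_norm_recip[OF p(1) fin] F_G epowr_epowr
      using i by (simp add: i_def)
    also have "(\<integral>\<^sup>+y. \<integral>\<^sup>+x. G (Li (x, y))) = (\<integral>\<^sup>+z. G (Li z) \<partial>(lborel \<Otimes>\<^sub>M lborel))"
      by (rule lborel_pair.nn_integral_snd[where f = "\<lambda>z. G (Li z)"]) (simp add: lborel_prod)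
    also have "\<dots> = (\<integral>\<^sup>+z. G (Li z + 0))" by (simp add: lborel_prod)
    also have "\<dots> = ennreal (c * (h * V))"
      using ceq[of G 0] c h V by (simp add: G_int ennreal_mult[symmetric])
    finally have "pos_mixed_norm p1 p2 ?F = ennreal ((c * (h * V)) powr i)"
      using c h V by (simp add: epowr_ennreal)
    then have "D * h \<le> (c * (h * V)) powr i"
      using log_product_test[OF n H h(1)] by (simp add: D_def)
    then have "h powr 1 \<le> (c * V) powr i / D * h powr recip p1"
      using D c h V by (simp add: powr_mult field_simps i_def)
    then show "\<exists>h\<ge>M. h powr 1 \<le> (c * V) powr i / D * h powr recip p1"
      using h by blast
  qed
qed

text \<open>The order is forced: invertibility of A21 gives 1/p1 < 1/q, this excludes a singular A22
  through \<open>long_u\<close>, and an invertible A22 gives 1/q < 1/p2.\<close>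

lemma necessary:
  assumes "recip p2 \<le> 1"
  shows "recip p2 < 1 \<and> recip q < recip p2 \<and> recip p1 < recip q \<and> inj ((*v) A21) \<and> inj ((*v) A22)"
proof -
  have \<theta>: "0 < lam / real CARD('n)" using lam by simp
  have not_inj_A22D: "\<exists>v. v \<noteq> 0 \<and> A22 *v v = 0" if "\<not> inj ((*v) A22)"
    using that linear_injective_0[OF matrix_vector_mul_linear[of A22]] by auto
  have long_u': "recip q \<le> recip p1" if "\<not> inj ((*v) A22)"
    using not_inj_A22D[OF that] long_u by blast
  have A21: "inj ((*v) A21)"
  proof (rule ccontr)
    assume A21: "\<not> inj ((*v) A21)"
    \<comment> \<open>If A22 were zero, the surjectivity of the block map onto the second component
      would rest on A21 alone.\<close>
    have "\<exists>v. A22 *v v \<noteq> 0"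
    proof (rule ccontr)
      assume "\<not> (\<exists>v. A22 *v v \<noteq> 0)"
      then have *: "y = A21 *v fst (Li (0, y))" for y
        using arg_cong[OF L_Li[of "(0, y)"], of snd] by (simp add: block_map_def)
      have "surj ((*v) A21)" unfolding surj_def using * by blast
      then show False using A21 linear_surjective_imp_injective[OF matrix_vector_mul_linear] by blast
    qed
    then have eq2: "recip p2 = recip q" using long_y thin_y[OF A21] by force
    show False
    proof (cases "inj ((*v) A22)")
      case True
      then have "1 \<le> recip p1" using log_product_A22 eq2 by blast
      \<comment> \<open>With p2 = q the scaling relation reads 1/p1 = 1 - lam/n, which is less than
        1.\<close>
      then show False using scaling eq2 \<theta> by linarith
    next
      case False
      then obtain v where v: "v \<noteq> 0" "A22 *v v = 0" using not_inj_A22D by blast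
      \<comment> \<open>A kernel vector of A22 provides the u-direction with nonzero x2-component
        that \<open>thin_u\<close> asks for; together with \<open>long_u\<close> it yields p1 =
        q.\<close>
      have "L (0, v) = (A12 *v v, 0)" using v by (simp add: block_map_def)
      then have "Li (A12 *v v, 0) = (0, v)" by (metis Li_L)
      then have "recip p1 \<le> recip q" using thin_u[of "A12 *v v"] v by simp
      then have "recip p1 = recip q" using long_u'[OF False] by simp
      then have "p1 = q" "p2 = q"
        using eq2 recip_less_iff p by (metis less_irrefl linorder_less_linear)+
      then have "1 \<le> recip p1" by (rule log_product_diagonal)
      then show False using scaling eq2 \<theta> by linarith
    qed
  qed
  obtain e :: "real^'n" where e: "e \<noteq> 0" using vector_choose_size[of 1] by (metis norm_zero zero_le_one zero_neq_one)
  have "snd (Li (e, 0)) \<noteq> 0"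
    using e inj_Q[OF A21] linear_injective_0[OF linear_Q] by blast
  then have "recip p1 \<le> recip q" by (rule thin_u)
  moreover have "recip p1 \<noteq> recip q"
  proof
    assume eq1: "recip p1 = recip q"
    then have "1 \<le> recip p2" by (rule log_shear[OF A21])
    then show False using scaling eq1 \<theta> by linarith
  qed
  ultimately have i1: "recip p1 < recip q" by simp
  have A22: "inj ((*v) A22)" using long_u' i1 by force
  then have "A22 *v e \<noteq> 0"
    using e linear_injective_0[OF matrix_vector_mul_linear[of A22]] by blast
  then have "recip q \<le> recip p2" by (rule long_y)
  moreover have "recip p2 \<noteq> recip q"
  proof
    assume eq2: "recip p2 = recip q"
    then have "1 \<le> recip p1" by (rule log_product_A22[OF A22])
    then show False using scaling eq2 \<theta> by linarith
  qed
  moreover have "recip p2 \<noteq> 1" using endpoint_p2[OF A21] i1 by force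
  ultimately show ?thesis using assms i1 A21 A22 by simp
qed

end

theorem theorem5p1:
  fixes A11 A12 A21 A22 :: "real^'n^'n"
    and p1 p2 q :: ennreal
    and lam :: real
  assumes "1 \<le> p1" and "1 \<le> p2"
    and "0 < lam" and "lam < real CARD('n)"
    and "0 < q"
    and "1 / p1 + 1 / p2 = 1 / q + ennreal ((real CARD('n) - lam) / real CARD('n))"
  shows "T_bounded p1 p2 q lam A11 A12 A21 A22 \<longleftrightarrow>
    1 < p2 \<and> p2 < q \<and> q < p1 \<and> p1 \<le> \<infinity> \<and>
    invertible (block_matrix A11 A12 A21 A22) \<and> invertible A21 \<and> invertible A22"
proof -
  have pos: "0 < p1" "0 < p2" "0 < q"
    using assms(1,2,5) by (auto intro: less_le_trans[OF zero_less_one])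
  have "0 \<le> (real CARD('n) - lam) / real CARD('n)" using assms by simp
  then have "recip p1 + recip p2 = recip q + (real CARD('n) - lam) / real CARD('n)"
    using assms(6) pos by (simp add: divide_eq_recip ennreal_plus[symmetric] del: ennreal_plus)
  then have scaling: "recip p1 + recip p2 = recip q + (1 - lam / real CARD('n))"
    using assms by (simp add: diff_divide_distrib)
  show ?thesis
  proof
    assume "T_bounded p1 p2 q lam A11 A12 A21 A22"
    then have pb: "pos_bounded p1 p2 q lam A11 A12 A21 A22"
      using pos by (rule pos_bounded_if_T_bounded)
    then have inj: "inj (block_map A11 A12 A21 A22)"
      using pos assms by (intro pos_bounded_imp_inj)
    obtain C where C: "0 < C" "\<forall>F\<in>borel_measurable borel. (\<forall>z. 0 \<le> F z) \<longrightarrow>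
        Lp_norm q lborel (pos_T lam A11 A12 A21 A22 F) \<le> ennreal C * pos_mixed_norm p1 p2 F"
      using pb unfolding pos_bounded_def by blast
    interpret bounded_block A11 A12 A21 A22 p1 p2 q lam C "unit_ball_vol (real CARD('n))"
    proof unfold_locales
      fix F :: "(real^'n) \<times> (real^'n) \<Rightarrow> real"
      assume "F \<in> borel_measurable borel" "\<And>z. 0 \<le> F z"
      then show "Lp_norm q lborel (pos_T lam A11 A12 A21 A22 F) \<le> ennreal C * pos_mixed_norm p1 p2 F"
        using C(2) by blast
    qed (fact assms pos scaling inj C refl)+
    have "recip p2 \<le> 1" using recip_less_iff[of 1 p2] assms(2) pos by (simp add: not_less[symmetric])
    then have "recip p2 < 1 \<and> recip q < recip p2 \<and> recip p1 < recip q \<and> inj ((*v) A21) \<and> inj ((*v) A22)"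
      by (rule necessary)
    then show "1 < p2 \<and> p2 < q \<and> q < p1 \<and> p1 \<le> \<infinity> \<and>
        invertible (block_matrix A11 A12 A21 A22) \<and> invertible A21 \<and> invertible A22"
      using inj pos recip_less_iff[of p2 1] recip_less_iff[of q p2] recip_less_iff[of p1 q]
      by (simp add: invertible_block_matrix_iff invertible_iff_inj[of A21] invertible_iff_inj[of A22])
  next
    assume *: "1 < p2 \<and> p2 < q \<and> q < p1 \<and> p1 \<le> \<infinity> \<and>
      invertible (block_matrix A11 A12 A21 A22) \<and> invertible A21 \<and> invertible A22"
    then have inj: "inj (block_map A11 A12 A21 A22)" by (simp add: invertible_block_matrix_iff)
    have "pos_bounded p1 p2 q lam A11 A12 A21 A22"
      using * assms scaling inj by (intro pos_bounded_sufficient) auto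
    then show "T_bounded p1 p2 q lam A11 A12 A21 A22"
      using * pos inj by (intro T_bounded_if_pos_bounded) auto
  qed
qed

end
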